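(* A pentagonal tiling of an oriented compact connected surface without boundary is the pentagonal subdivision $T(5)$ of some tiling $T$ if and only if all its tiles are non-degenerate and it is possible to label some vertices by $\bullet$ and some other vertices by $\circ$ such that the vertices of each tile, read along the orientation of the surface, have the pattern $\bullet,\ 3,\ \circ,\ 3,\ 3$, where $3$ stands for an unlabelled vertex of degree $3$.
   Context: A tiling of a compact connected surface without boundary is a graph embedded in the surface such that the complementary regions (tiles) are open disks; tilings are edge-to-edge, every vertex has degree at least $3$, every tile has at least $3$ edges, and tiles may be degenerate (boundary not a simple closed curve); a polygon is non-degenerate if its boundary is a simple closed curve. A pentagonal tiling has $5$ edges along each tile boundary. Pentagonal subdivision: let $T$ be a tiling of an oriented surface. Divide each edge of $T$ into three segments by two dividing points. For a tile $t$ and an edge $e$ on its boundary, traverse $e$ in the direction induced by the orientation of $\partial t$ and call the dividing point met first the first dividing point of $e$ from the viewpoint of $t$ (from the viewpoint of the tile on the other side, the roles of the two points are swapped). Choose a center point in each tile $t$ and join it to the first dividing point (from the viewpoint of $t$) of each edge of $t$, doing this for every pair $(t,e)$. The resulting pentagonal tiling is the pentagonal subdivision $T(5)$; its vertices are the vertices of $T$, the centers of tiles of $T$, and the dividing points (of degree $3$). *)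

theory Defs
  imports "HOL-Analysis.Analysis"
begin

text \<open>
  A surface is a subset \<open>S\<close> of some Hausdorff space. A graph embedded in it is given by the set
  \<open>\<Gamma>\<close> of its directed edges: parametrised paths, each edge being present with both of its
  directions \<open>\<gamma>\<close> and \<open>reversepath \<gamma>\<close>. An edge may be a loop, and several edges may have the
  same end points. There are no isolated vertices, since in a tiling all degrees are at least 3.
\<close>

definition closed_surface :: "'a::t2_space set \<Rightarrow> bool" where
  "closed_surface S \<longleftrightarrow> S \<noteq> {} \<and> compact S \<and> connected S \<and>
     (\<forall>x\<in>S. \<exists>U. openin (top_of_set S) U \<and> x \<in> U \<and> U homeomorphic (ball 0 1 :: complex set))"

definition embedded_graph :: "'a::t2_space set \<Rightarrow> (real \<Rightarrow> 'a) set \<Rightarrow> bool" where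
  "embedded_graph S \<Gamma> \<longleftrightarrow> finite \<Gamma> \<and>
     (\<forall>\<gamma>\<in>\<Gamma>. simple_path \<gamma> \<and> path_image \<gamma> \<subseteq> S \<and> reversepath \<gamma> \<in> \<Gamma>) \<and>
     (\<forall>\<gamma>\<in>\<Gamma>. \<forall>\<delta>\<in>\<Gamma>. \<delta> \<noteq> \<gamma> \<longrightarrow> \<delta> \<noteq> reversepath \<gamma> \<longrightarrow> \<gamma> ` {0<..<1} \<inter> path_image \<delta> = {})"

definition vertices :: "(real \<Rightarrow> 'a::t2_space) set \<Rightarrow> 'a set" where
  "vertices \<Gamma> = pathstart ` \<Gamma>"

text \<open>A loop contributes 2 to the degree, once for each of its directions.\<close>

definition vertex_degree :: "(real \<Rightarrow> 'a::t2_space) set \<Rightarrow> 'a \<Rightarrow> nat" where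
  "vertex_degree \<Gamma> v = card {\<gamma>\<in>\<Gamma>. pathstart \<gamma> = v}"

definition tiles :: "'a::t2_space set \<Rightarrow> (real \<Rightarrow> 'a) set \<Rightarrow> 'a set set" where
  "tiles S \<Gamma> = components (S - (\<Union>\<gamma>\<in>\<Gamma>. path_image \<gamma>))"

text \<open>
  \<open>t\<close> is an open disk whose boundary is the closed walk along the directed edges \<open>\<gamma>s\<close>: a
  homeomorphism from the open unit disk to \<open>t\<close> extends continuously to the closed disk, and the
  \<open>n = length \<gamma>s\<close> arcs between consecutive \<open>n\<close>-th roots of unity run along the directed edges in
  \<open>\<gamma>s\<close>. The extension need not be injective on the circle, so degenerate tiles are included.
  The walk is determined by \<open>t\<close> up to its starting point and its direction.
\<close>

definition boundary_walk :: "'a::t2_space set \<Rightarrow> (real \<Rightarrow> 'a) list \<Rightarrow> bool" where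
  "boundary_walk t \<gamma>s \<longleftrightarrow> (\<exists>h h'.
     continuous_on (cball (0::complex) 1) h \<and> homeomorphism (ball 0 1) t h h' \<and>
     (\<forall>j<length \<gamma>s. \<forall>s\<in>{0..1}.
        h (cis (2 * pi * (real j + s) / real (length \<gamma>s))) = (\<gamma>s ! j) s))"

definition tiling :: "'a::t2_space set \<Rightarrow> (real \<Rightarrow> 'a) set \<Rightarrow> bool" where
  "tiling S \<Gamma> \<longleftrightarrow> embedded_graph S \<Gamma> \<and> (\<forall>v\<in>vertices \<Gamma>. 3 \<le> vertex_degree \<Gamma> v) \<and>
     (\<forall>t\<in>tiles S \<Gamma>. \<exists>\<gamma>s. set \<gamma>s \<subseteq> \<Gamma> \<and> 3 \<le> length \<gamma>s \<and> boundary_walk t \<gamma>s)"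

text \<open>
  An orientation of a tiled surface is a choice \<open>B t\<close> of a boundary walk for each tile \<open>t\<close> that is
  coherent: the two sides of every edge are traversed in opposite directions. As an edge has two
  sides, this says that every directed edge is traversed exactly once by the walks altogether.
\<close>

definition oriented_tiling ::
  "'a::t2_space set \<Rightarrow> (real \<Rightarrow> 'a) set \<Rightarrow> ('a set \<Rightarrow> (real \<Rightarrow> 'a) list) \<Rightarrow> bool" where
  "oriented_tiling S \<Gamma> B \<longleftrightarrow> tiling S \<Gamma> \<and>
     (\<forall>t\<in>tiles S \<Gamma>. set (B t) \<subseteq> \<Gamma> \<and> 3 \<le> length (B t) \<and> boundary_walk t (B t)) \<and>
     bij_betw (\<lambda>(t, j). B t ! j) (SIGMA t:tiles S \<Gamma>. {..<length (B t)}) \<Gamma>"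

definition pentagonal_tiling ::
  "'a::t2_space set \<Rightarrow> (real \<Rightarrow> 'a) set \<Rightarrow> ('a set \<Rightarrow> (real \<Rightarrow> 'a) list) \<Rightarrow> bool" where
  "pentagonal_tiling S \<Gamma> B \<longleftrightarrow> oriented_tiling S \<Gamma> B \<and> (\<forall>t\<in>tiles S \<Gamma>. length (B t) = 5)"

text \<open>The closed curve that runs through the walk \<open>\<gamma>s\<close> is simple.\<close>

definition nondegenerate :: "(real \<Rightarrow> 'a::t2_space) list \<Rightarrow> bool" where
  "nondegenerate \<gamma>s \<longleftrightarrow> inj_on (\<lambda>(j, s). (\<gamma>s ! j) s) ({..<length \<gamma>s} \<times> {0..<1})"

text \<open>
  Two arcs agree up to an increasing reparametrisation iff they have the same \<open>course\<close>.
\<close>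

definition course :: "(real \<Rightarrow> 'a::t2_space) \<Rightarrow> 'a set \<times> 'a \<times> 'a" where
  "course p = (path_image p, pathstart p, pathfinish p)"

text \<open>
  \<open>a \<gamma>\<close> is the parameter of the first dividing point of the directed edge \<open>\<gamma>\<close>. The second one is
  the first dividing point of \<open>reversepath \<gamma>\<close>, which \<open>\<gamma>\<close> meets at the parameter
  \<open>1 - a (reversepath \<gamma>)\<close>.
\<close>

definition first_segment ::
  "((real \<Rightarrow> 'a::t2_space) \<Rightarrow> real) \<Rightarrow> (real \<Rightarrow> 'a) \<Rightarrow> real \<Rightarrow> 'a" where
  "first_segment a \<gamma> = \<gamma> \<circ> linepath 0 (a \<gamma>)"

definition middle_segment ::
  "((real \<Rightarrow> 'a::t2_space) \<Rightarrow> real) \<Rightarrow> (real \<Rightarrow> 'a) \<Rightarrow> real \<Rightarrow> 'a" where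
  "middle_segment a \<gamma> = \<gamma> \<circ> linepath (a \<gamma>) (1 - a (reversepath \<gamma>))"

definition last_segment ::
  "((real \<Rightarrow> 'a::t2_space) \<Rightarrow> real) \<Rightarrow> (real \<Rightarrow> 'a) \<Rightarrow> real \<Rightarrow> 'a" where
  "last_segment a \<gamma> = \<gamma> \<circ> linepath (1 - a (reversepath \<gamma>)) 1"

text \<open>
  In an oriented tiling the pairs of a tile \<open>t\<close> and an edge on its boundary, traversed in the
  direction induced by \<open>t\<close>, correspond to the directed edges. Hence the arc that joins the center
  \<open>c t\<close> to the first dividing point of such an edge can be indexed by the directed edge alone.
\<close>

definition subdivision_data ::
  "'a::t2_space set \<Rightarrow> (real \<Rightarrow> 'a) set \<Rightarrow> ('a set \<Rightarrow> (real \<Rightarrow> 'a) list) \<Rightarrow>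
   ((real \<Rightarrow> 'a) \<Rightarrow> real) \<Rightarrow> ('a set \<Rightarrow> 'a) \<Rightarrow> ((real \<Rightarrow> 'a) \<Rightarrow> real \<Rightarrow> 'a) \<Rightarrow> bool" where
  "subdivision_data S \<Gamma> B a c spoke \<longleftrightarrow>
     (\<forall>\<gamma>\<in>\<Gamma>. 0 < a \<gamma> \<and> a \<gamma> < 1 - a (reversepath \<gamma>)) \<and>
     (\<forall>t\<in>tiles S \<Gamma>. c t \<in> t \<and>
        (\<forall>\<gamma>\<in>set (B t). arc (spoke \<gamma>) \<and> pathstart (spoke \<gamma>) = c t \<and>
           pathfinish (spoke \<gamma>) = \<gamma> (a \<gamma>) \<and> spoke \<gamma> ` {0..<1} \<subseteq> t) \<and>
        (\<forall>\<gamma>\<in>set (B t). \<forall>\<delta>\<in>set (B t). \<gamma> \<noteq> \<delta> \<longrightarrow>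
           path_image (spoke \<gamma>) \<inter> path_image (spoke \<delta>) = {c t}))"

text \<open>
  The pentagon, with its orientation, between the spokes to two consecutive edges \<open>\<gamma>\<close>, \<open>\<delta>\<close> of a
  tile.
\<close>

definition subdivision_pentagon ::
  "((real \<Rightarrow> 'a::t2_space) \<Rightarrow> real) \<Rightarrow> ((real \<Rightarrow> 'a) \<Rightarrow> real \<Rightarrow> 'a) \<Rightarrow>
   (real \<Rightarrow> 'a) \<Rightarrow> (real \<Rightarrow> 'a) \<Rightarrow> (real \<Rightarrow> 'a) list" where
  "subdivision_pentagon a spoke \<gamma> \<delta> =
     [spoke \<gamma>, middle_segment a \<gamma>, last_segment a \<gamma>, first_segment a \<delta>, reversepath (spoke \<delta>)]"

text \<open>
  The oriented tiling \<open>(\<Gamma>', B')\<close> is \<open>T(5)\<close> for the oriented tiling \<open>T = (\<Gamma>, B)\<close> of the same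
  surface, for some choice of dividing points, centers and joining arcs. Parametrisations of
  edges and starting points of boundary walks are immaterial, whence \<open>course\<close> and \<open>rotate\<close>.
  The last clause makes the orientations agree. As every directed edge of \<open>\<Gamma>'\<close> lies on exactly
  one tile, the tiles it describes are all the tiles of \<open>\<Gamma>'\<close>.
\<close>

definition pentagonal_subdivision ::
  "'a::t2_space set \<Rightarrow> (real \<Rightarrow> 'a) set \<Rightarrow> ('a set \<Rightarrow> (real \<Rightarrow> 'a) list) \<Rightarrow>
   (real \<Rightarrow> 'a) set \<Rightarrow> ('a set \<Rightarrow> (real \<Rightarrow> 'a) list) \<Rightarrow> bool" where
  "pentagonal_subdivision S \<Gamma> B \<Gamma>' B' \<longleftrightarrow> (\<exists>a c spoke.
     subdivision_data S \<Gamma> B a c spoke \<and>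
     course ` \<Gamma>' = course ` (\<Union>\<gamma>\<in>\<Gamma>. {first_segment a \<gamma>, middle_segment a \<gamma>, last_segment a \<gamma>,
                                      spoke \<gamma>, reversepath (spoke \<gamma>)}) \<and>
     (\<forall>t\<in>tiles S \<Gamma>. \<forall>j<length (B t). \<exists>p\<in>tiles S \<Gamma>'. p \<subseteq> t \<and> (\<exists>k.
        map course (rotate k (B' p)) =
        map course (subdivision_pentagon a spoke (B t ! j) (B t ! (Suc j mod length (B t)))))))"

text \<open>
  \<open>Bul\<close> and \<open>Cir\<close> are the sets of vertices labelled by a bullet and by a circle.
\<close>

definition pattern_labelling ::
  "'a::t2_space set \<Rightarrow> (real \<Rightarrow> 'a) set \<Rightarrow> ('a set \<Rightarrow> (real \<Rightarrow> 'a) list) \<Rightarrow> 'a set \<Rightarrow> 'a set \<Rightarrow> bool" where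
  "pattern_labelling S \<Gamma> B Bul Cir \<longleftrightarrow>
     Bul \<subseteq> vertices \<Gamma> \<and> Cir \<subseteq> vertices \<Gamma> \<and> Bul \<inter> Cir = {} \<and>
     (\<forall>t\<in>tiles S \<Gamma>. \<exists>k v0 v1 v2 v3 v4.
        map pathstart (rotate k (B t)) = [v0, v1, v2, v3, v4] \<and> v0 \<in> Bul \<and> v2 \<in> Cir \<and>
        (\<forall>v\<in>{v1, v3, v4}. v \<notin> Bul \<and> v \<notin> Cir \<and> vertex_degree \<Gamma> v = 3))"

end

(*
  In a pentagonal subdivision the bullets are the old vertices and the circles are the centers of
  the old tiles; the dividing points have degree 3 because edges that are not loops are determined
  by their courses. A pentagon could only be degenerate if a tile of the old tiling ran back along
  the edge just traversed. Then the vertex at which it turns would have degree 1, as the tiles at a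
  vertex of a surface form a single cycle.

  Conversely, the labels force the reverse of a side of a pentagon to be a side at a prescribed place
  of the neighbouring pentagon. Deleting the circles and the sides at them leaves chains of three
  sides from bullet to bullet, which are the edges of the old tiling. Its tiles consist of the
  pentagons around one circle, again in a single cycle; straightening these pentagons to sectors of
  the disk and glueing them gives the required map of the closed disk.
*)

theory Submission imports Defs begin

text \<open>The local hypothesis on \<open>S\<close> does real work. On a space pinched at a vertex
  the walks may still traverse every directed edge once, while the tiles at that vertex form several
  cycles. Removing such a vertex disconnects its small neighbourhoods, which a disk excludes; every
  statement about cycles is reduced to this. The map of a closed disk onto a closed tile need not be
  injective on the circle, so the tiles cannot be handled as embedded polygons. Continuity of each
  glued or inverse map is obtained from compactness instead: in a Hausdorff space the images of
  compact sets are closed. No planar curve theorem is needed to straighten a pentagon, since its map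
  already starts from a disk. It suffices to reparametrise the disk by a convex sector with
  prescribed boundary values. At least three pentagons meet at a circle, so the sectors have angle
  below \<open>pi\<close> and are convex.\<close>

section \<open>Glueing and straightening of disks\<close>

text \<open>The finitely many \<open>P i\<close> together act as a quotient map: the preimage of a
  closed set under \<open>g\<close> is a finite union of continuous images of compact sets, hence
  closed. No \<open>P i\<close> has to be injective, so the square of radial coordinates used next
  may collapse to a point along an edge.\<close>

lemma continuous_on_glue:
  fixes P :: "'i \<Rightarrow> 'b::t2_space \<Rightarrow> 'c::t2_space" and G :: "'i \<Rightarrow> 'b \<Rightarrow> 'd::topological_space"
  assumes fin: "finite I"
    and A: "\<And>i. i \<in> I \<Longrightarrow> compact (A i)"
    and P: "\<And>i. i \<in> I \<Longrightarrow> continuous_on (A i) (P i)"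
    and G: "\<And>i. i \<in> I \<Longrightarrow> continuous_on (A i) (G i)"
    and agree: "\<And>i j x y. \<lbrakk>i \<in> I; j \<in> I; x \<in> A i; y \<in> A j; P i x = P j y\<rbrakk> \<Longrightarrow> G i x = G j y"
  obtains g where "continuous_on (\<Union>i\<in>I. P i ` A i) g"
    "\<And>i x. \<lbrakk>i \<in> I; x \<in> A i\<rbrakk> \<Longrightarrow> g (P i x) = G i x"
proof
  define g where "g z = (SOME y. \<exists>i\<in>I. \<exists>x\<in>A i. z = P i x \<and> y = G i x)" for z
  show g: "g (P i x) = G i x" if "i \<in> I" "x \<in> A i" for i x
    unfolding g_def
  proof (rule some_equality)
    show "\<exists>j\<in>I. \<exists>y\<in>A j. P i x = P j y \<and> G i x = G j y"
      using that by blast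
  qed (use that agree in metis)
  show "continuous_on (\<Union>i\<in>I. P i ` A i) g"
    unfolding continuous_on_closed_vimage
  proof (intro continuous_on_closed_invariant[THEN iffD2] allI impI)
    fix C :: "'d set" assume C: "closed C"
    have cpt: "compact (P i ` (A i \<inter> G i -` C))" if "i \<in> I" for i
    proof (rule compact_continuous_image)
      show "compact (A i \<inter> G i -` C)"
        using closedin_compact[OF A] continuous_closedin_preimage[OF G C] that by blast
      show "continuous_on (A i \<inter> G i -` C) (P i)"
        using P[OF that] by (rule continuous_on_subset) auto
    qed
    have "compact (\<Union>i\<in>I. P i ` (A i \<inter> G i -` C))"
      using fin cpt by blast
    moreover have "(\<Union>i\<in>I. P i ` (A i \<inter> G i -` C)) \<inter> (\<Union>i\<in>I. P i ` A i) = g -` C \<inter> (\<Union>i\<in>I. P i ` A i)"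
      using g by (safe; fastforce)
    ultimately show "\<exists>D. closed D \<and> D \<inter> (\<Union>i\<in>I. P i ` A i) = g -` C \<inter> (\<Union>i\<in>I. P i ` A i)"
      using compact_imp_closed by blast
  qed
qed

lemma cis_eq_iff: "cis x = cis y \<longleftrightarrow> (\<exists>m::int. x = y + 2 * pi * m)"
proof
  assume "cis x = cis y"
  then have "sin x = sin y \<and> cos x = cos y"
    by (metis cis.simps)
  then show "\<exists>m::int. x = y + 2 * pi * m"
    by (subst (asm) sin_cos_eq_iff) (auto simp: algebra_simps)
next
  assume "\<exists>m::int. x = y + 2 * pi * m"
  then show "cis x = cis y"
    using cis_multiple_2pi[OF Ints_of_int] by (auto simp flip: cis_mult)
qed

lemma cis_surj_unit_interval:
  assumes "norm z = 1"
  obtains u where "u \<in> {0..<1}" "z = cis (2 * pi * u)"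
proof
  show "Arg2pi z / (2 * pi) \<in> {0..<1}"
    using Arg2pi[of z] by (auto simp: field_simps)
  show "z = cis (2 * pi * (Arg2pi z / (2 * pi)))"
    using Arg2pi_eq[of z] assms by (simp add: cis_conv_exp)
qed

text \<open>A point of \<open>K\<close> is described by a frontier point \<open>q u\<close> and the
  fraction of the segment from \<open>b\<close> to \<open>q u\<close> at which it lies; the map
  keeps both numbers. Thus \<open>K\<close> and the disk are seen as the same quotient of a
  square.\<close>

lemma convex_radial_homeomorphism:
  fixes K :: "complex set"
  assumes K: "compact K" "convex K" and b: "b \<in> interior K"
    and q: "simple_path q" "pathfinish q = pathstart q" "path_image q = frontier K"
  obtains \<Phi> where "continuous_on K \<Phi>" "inj_on \<Phi> K" "\<Phi> ` K = cball (0::complex) 1"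
    "\<And>u. u \<in> {0..1} \<Longrightarrow> \<Phi> (q u) = cis (2 * pi * u)"
    "\<And>z. z \<in> interior K \<Longrightarrow> \<Phi> z \<in> ball 0 1"
proof -
  define A where "A = {0..1::real} \<times> {0..1::real}"
  define P where "P x = b + fst x *\<^sub>R (q (snd x) - b)" for x
  define G where "G x = fst x *\<^sub>R cis (2 * pi * snd x)" for x :: "real \<times> real"
  have cq: "continuous_on {0..1} q"
    using q(1) unfolding simple_path_def path_def by blast
  have bdq: "q u \<in> K" "q u \<notin> interior K" if "u \<in> {0..1}" for u
    using q(3) that K(1) compact_imp_closed[of K] unfolding path_image_def frontier_def by auto
  have qeq: "u = u' \<or> (u \<in> {0,1} \<and> u' \<in> {0,1})" if "q u = q u'" "u \<in> {0..1}" "u' \<in> {0..1}" for u u'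
    using q(1) that unfolding simple_path_def loop_free_def by blast
  \<comment> \<open>For \<open>l' < l\<close> the point \<open>q u\<close> would arise from
    \<open>q u'\<close> by a proper shrinking towards the interior point \<open>b\<close>, and would
    be interior itself.\<close>
  have ray: "l' \<ge> l" if eq: "b + l *\<^sub>R (q u - b) = b + l' *\<^sub>R (q u' - b)"
    and "l \<in> {0..1}" "l' \<in> {0..1}" "u \<in> {0..1}" "u' \<in> {0..1}" for l l' u u'
  proof (rule ccontr)
    assume lt: "\<not> l' \<ge> l"
    define e where "e = 1 - l' / l"
    have l: "l > 0" using lt that by auto
    have e: "0 < e" "e \<le> 1" using l lt that by (auto simp: e_def field_simps)
    have "l *\<^sub>R (q u - b) = l' *\<^sub>R (q u' - b)" using eq by simp
    then have "q u - b = (l' / l) *\<^sub>R (q u' - b)"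
      using l by (metis divideR_right less_numeral_extra(3) scaleR_scaleR divide_inverse_commute)
    then have "q u = q u' - e *\<^sub>R (q u' - b)"
      by (simp add: e_def algebra_simps)
    moreover have "q u' - e *\<^sub>R (q u' - b) \<in> interior K"
      using mem_interior_convex_shrink[OF K(2) b bdq(1)[OF that(5)] e] .
    ultimately show False using bdq(2)[OF that(4)] by metis
  qed
  \<comment> \<open>Left to right makes the glued map well defined, right to left makes it
    injective.\<close>
  have PG: "P x = P y \<longleftrightarrow> G x = G y" if "x \<in> A" "y \<in> A" for x y
  proof -
    obtain l u l' u' where x: "x = (l,u)" and y: "y = (l',u')" by fastforce
    have A: "l \<in> {0..1}" "l' \<in> {0..1}" "u \<in> {0..1}" "u' \<in> {0..1}" using that by (auto simp: A_def x y)
    show ?thesis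
    proof
      assume P: "P x = P y"
      then have "l = l'"
        using ray[of l u l' u'] ray[of l' u' l u] A by (auto simp: P_def x y intro: antisym)
      moreover have "l = 0 \<or> q u = q u'" using P \<open>l = l'\<close> by (auto simp: P_def x y)
      moreover have "cis (2*pi*u) = cis (2*pi*u')" if "q u = q u'"
        using qeq[OF that] A by auto
      ultimately show "G x = G y" by (auto simp: G_def x y)
    next
      assume G: "G x = G y"
      then have "norm (G x) = norm (G y)" by simp
      then have l: "l = l'" using A by (simp add: G_def x y)
      have "l = 0 \<or> cis (2*pi*u) = cis (2*pi*u')"
        using G l by (auto simp: G_def x y)
      moreover have "q u = q u'" if "cis (2*pi*u) = cis (2*pi*u')"
      proof -
        obtain m :: int where "2*pi*u = 2*pi*u' + 2*pi*m" using \<open>cis (2*pi*u) = cis (2*pi*u')\<close> unfolding cis_eq_iff by blast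
        then have "2*pi*u = 2*pi*(u'+m)" by (simp add: algebra_simps)
        then have "u = u' + m" by simp
        moreover from this have "m \<in> {-1,0,1}" using A by auto
        ultimately have "u = u' \<or> (u = 1 \<and> u' = 0) \<or> (u = 0 \<and> u' = 1)" using A by auto
        then show ?thesis using q(2) by (auto simp: pathstart_def pathfinish_def)
      qed
      ultimately show "P x = P y" using l by (auto simp: P_def x y)
    qed
  qed
  have cA: "compact A" unfolding A_def by (intro compact_Times) auto
  have cP: "continuous_on A P"
  proof -
    have "continuous_on A (\<lambda>x. q (snd x))"
      by (rule continuous_on_compose2[OF cq]) (auto simp: A_def intro!: continuous_intros)
    then show ?thesis unfolding P_def by (intro continuous_intros)
  qed
  have cG: "continuous_on A G" unfolding G_def
    by (intro continuous_intros continuous_on_scaleR)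
  have PA: "P ` A = K"
  proof
    show "P ` A \<subseteq> K"
    proof (clarsimp simp: A_def P_def)
      fix l u :: real assume "0 \<le> l" "l \<le> 1" "0 \<le> u" "u \<le> 1"
      then have "(1 - l) *\<^sub>R b + l *\<^sub>R q u \<in> K"
        using K(2) b bdq interior_subset by (intro convexD_alt) auto
      then show "b + l *\<^sub>R (q u - b) \<in> K" by (simp add: algebra_simps)
    qed
    show "K \<subseteq> P ` A"
    proof
      fix z assume z: "z \<in> K"
      show "z \<in> P ` A"
      proof (cases "z = b")
        case True
        then have "z = P (0,0)" by (simp add: P_def)
        then show ?thesis by (auto simp: A_def)
      next
        case False
        then obtain d where d: "d > 0" "b + d *\<^sub>R (z - b) \<in> frontier K"
          using ray_to_frontier[of K b "z - b"] compact_imp_bounded[OF K(1)] b by auto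
        then obtain u where u: "u \<in> {0..1}" "b + d *\<^sub>R (z - b) = q u"
          using d(2) unfolding q(3)[symmetric] path_image_def by blast
        \<comment> \<open>For \<open>d < 1\<close> the frontier point would lie strictly between
          \<open>b\<close> and \<open>z\<close>, where all points are interior.\<close>
        have "d \<ge> 1"
        proof (rule ccontr)
          assume "\<not> d \<ge> 1"
          then have "z - (1-d) *\<^sub>R (z - b) \<in> interior K"
            using d by (intro mem_interior_convex_shrink[OF K(2) b z]) auto
          moreover have "z - (1-d) *\<^sub>R (z - b) = q u" unfolding u(2)[symmetric] by (simp add: algebra_simps)
          ultimately show False using bdq u by auto
        qed
        have "z = P (1/d, u)" using d by (simp add: P_def u(2)[symmetric])
        then show ?thesis using \<open>d \<ge> 1\<close> u by (auto simp: A_def)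
      qed
    qed
  qed
  have GA: "G ` A = cball 0 1"
  proof
    show "G ` A \<subseteq> cball 0 1" by (auto simp: A_def G_def)
    show "cball 0 1 \<subseteq> G ` A"
    proof
      fix z :: complex assume z: "z \<in> cball 0 1"
      show "z \<in> G ` A"
      proof (cases "z = 0")
        case True
        then have "z = G (0,0)" by (simp add: G_def)
        then show ?thesis by (auto simp: A_def)
      next
        case False
        obtain u where u: "u \<in> {0..<1}" "sgn z = cis (2*pi*u)"
          using cis_surj_unit_interval[of "sgn z"] False by (auto simp: norm_sgn)
        have "z = G (norm z, u)" using u(2) False by (simp add: G_def flip: u(2)) (simp add: sgn_div_norm)
        then show ?thesis using z u by (auto simp: A_def)
      qed
    qed
  qed
  obtain g where g: "continuous_on (\<Union>i\<in>{()}. P ` A) g" "\<And>x. x \<in> A \<Longrightarrow> g (P x) = G x"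
  proof (rule continuous_on_glue[of "{()}" "\<lambda>_. A" "\<lambda>_. P" "\<lambda>_. G"])
    show "G x = G y" if "x \<in> A" "y \<in> A" "P x = P y" for x y
      using PG that by blast
  qed (use cA cP cG in auto)
  show thesis
  proof
    show "continuous_on K g" using g(1) PA by simp
    show "inj_on g K" unfolding PA[symmetric] by (auto simp: inj_on_def g PG)
    have "g ` K = G ` A" unfolding PA[symmetric] image_image by (auto simp: g)
    then show "g ` K = cball 0 1" using GA by simp
    show "g (q u) = cis (2 * pi * u)" if "u \<in> {0..1}" for u
      using g(2)[of "(1,u)"] that by (simp add: A_def P_def G_def)
    fix z assume z: "z \<in> interior K"
    then have "z \<in> P ` A" using PA interior_subset by blast
    then obtain l u where lu: "(l,u) \<in> A" "z = P (l,u)" by fastforce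
    then have "l \<noteq> 1" using z bdq[of u] by (auto simp: P_def A_def)
    then show "g z \<in> ball 0 1" using g(2)[OF lu(1)] lu by (auto simp: A_def G_def)
  qed
qed


text \<open>Angles are measured in \<open>n\<close>-ths of a full turn. For a walk of length
  \<open>n\<close>, \<open>boundary_walk\<close> then places the point of side \<open>j\<close> with
  parameter \<open>s\<close> at \<open>polar n 1 (j + s)\<close>.\<close>

definition polar :: "nat \<Rightarrow> real \<Rightarrow> real \<Rightarrow> complex" where
  "polar n r x = of_real r * cis (2 * pi * x / real n)"

lemma norm_polar [simp]: "norm (polar n r x) = \<bar>r\<bar>"
  by (simp add: polar_def norm_mult)

lemma polar_0 [simp]: "polar n 0 x = 0"
  by (simp add: polar_def)

lemma polar_mult_polar: "polar n r x * polar n s y = polar n (r * s) (x + y)"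
  by (simp add: polar_def cis_mult ring_distribs add_divide_distrib)

lemma polar_add_int:
  assumes "n > 0"
  shows "polar n r (x + real n * of_int m) = polar n r x"
proof -
  have "2 * pi * (x + real n * of_int m) / real n = 2 * pi * x / real n + 2 * pi * of_int m"
    using assms by (simp add: field_simps)
  then have "cis (2 * pi * (x + real n * of_int m) / real n) = cis (2 * pi * x / real n)"
    unfolding cis_eq_iff by blast
  then show ?thesis by (simp add: polar_def)
qed

lemma polar_eqD:
  assumes "n > 0" "r \<ge> 0" "r' \<ge> 0" "polar n r x = polar n r' x'"
  shows "r = r' \<and> (r = 0 \<or> (\<exists>m::int. x = x' + real n * m))"
proof -
  have r: "r = r'" using arg_cong[OF assms(4), of norm] assms(2,3) by simp
  have "\<exists>m::int. x = x' + real n * m" if "r \<noteq> 0"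
  proof -
    have "cis (2 * pi * x / real n) = cis (2 * pi * x' / real n)"
      using assms(4) r that by (simp add: polar_def)
    then obtain m :: int where "2 * pi * x / real n = 2 * pi * x' / real n + 2 * pi * m"
      unfolding cis_eq_iff by blast
    then have "2 * pi * x = 2 * pi * (x' + real n * m)" using assms(1) by (simp add: field_simps)
    then show ?thesis by auto
  qed
  then show ?thesis using r by blast
qed

lemma continuous_on_polar [continuous_intros]:
  assumes "continuous_on A f" "continuous_on A g"
  shows "continuous_on A (\<lambda>x. polar n (f x) (g x))"
proof -
  have "continuous_on A (\<lambda>x. 2 * pi * g x * inverse (real n))"
    using assms by (intro continuous_intros)
  then show ?thesis unfolding polar_def divide_inverse
    using assms by (intro continuous_intros) auto
qed

lemma polar_surj:
  assumes "n > 0" "z \<noteq> 0"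
  obtains x where "x \<in> {0..<real n}" "z = polar n (norm z) x"
proof -
  obtain u where u: "u \<in> {0..<1}" "sgn z = cis (2 * pi * u)"
    using cis_surj_unit_interval[of "sgn z"] assms by (auto simp: norm_sgn)
  have "z = of_real (norm z) * sgn z" using assms(2) by (simp add: sgn_div_norm scaleR_conv_of_real)
  moreover have "2 * pi * (n * u) / n = 2 * pi * u" using assms(1) by simp
  ultimately have "z = polar n (norm z) (n * u)" using u(2) unfolding polar_def by (simp only:)
  moreover have "n * u \<in> {0..<real n}" using u(1) assms(1) by auto
  ultimately show thesis by (rule that[rotated])
qed

section \<open>Sectors of the disk and their straightening to a pentagon\<close>

definition sector :: "nat \<Rightarrow> complex set" where
  "sector n = {polar n r x |r x. r \<in> {0..1} \<and> x \<in> {0..1}}"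

context
  fixes n :: nat
  assumes n: "n \<ge> 3"
begin

lemma polar_unit_eqD:
  assumes "r \<in> {0..1}" "r' \<in> {0..1}" "x \<in> {0..1}" "x' \<in> {0..1}" "polar n r x = polar n r' x'"
  shows "r = r' \<and> (r = 0 \<or> x = x')"
proof -
  have "x = x'" if "x = x' + real n * m" for m :: int
  proof -
    have "\<bar>real n * m\<bar> \<le> 1" using that assms by auto
    moreover have "\<bar>real n * m\<bar> \<ge> 3 * \<bar>m\<bar>"
      using n by (simp add: abs_mult mult_right_mono)
    ultimately have "\<bar>real_of_int m\<bar> < 1" by linarith
    then have "m = 0" by linarith
    then show ?thesis using that by simp
  qed
  then show ?thesis using polar_eqD[OF _ _ _ assms(5)] n assms by auto
qed

text \<open>With \<open>n \<ge> 3\<close> the sector has an angle of at most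
  \<open>2 * pi / 3\<close>, hence below \<open>pi\<close>, so the sign of the sine decides on which
  side of a radius a point lies.\<close>

lemma sin_sector:
  assumes "x \<in> {0..1}"
  shows "sin (2 * pi * x / real n) \<ge> 0" "sin (2 * pi * x / real n) = 0 \<longleftrightarrow> x = 0"
proof -
  have "2 * pi * x / real n \<le> 2 * pi * 1 / 3"
    using assms n by (intro frac_le mult_left_mono) auto
  also have "\<dots> < pi" using pi_gt_zero by linarith
  finally have lt: "2 * pi * x / real n < pi" .
  show "sin (2 * pi * x / real n) \<ge> 0" using lt assms by (intro sin_ge_zero) auto
  show "sin (2 * pi * x / real n) = 0 \<longleftrightarrow> x = 0"
  proof
    assume "sin (2 * pi * x / real n) = 0"
    then have "\<not> 0 < 2 * pi * x / real n" using sin_gt_zero lt by fastforce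
    then show "x = 0" using assms n by (auto simp: zero_less_divide_iff zero_less_mult_iff)
  qed simp
qed

lemma Im_polar: "Im (polar n r x) = r * sin (2 * pi * x / real n)"
  by (simp add: polar_def)

lemma Im_polar_rotated: "Im (polar n r x * polar n 1 (-1)) = - r * sin (2 * pi * (1 - x) / real n)"
proof -
  have "2 * pi * (x + -1) / real n = - (2 * pi * (1 - x) / real n)"
    using n by (simp add: field_simps)
  then show ?thesis unfolding polar_mult_polar Im_polar by (simp only: sin_minus mult_1_right mult_minus_right mult_minus_left)
qed

text \<open>The vectors \<open>\<i>\<close> and \<open>\<i> * polar n 1 1\<close> are normal to the
  two bounding radii of the sector.\<close>

lemma inner_polar:
  "\<i> \<bullet> polar n r x = r * sin (2 * pi * x / real n)"
  "(\<i> * polar n 1 1) \<bullet> polar n r x = - r * sin (2 * pi * (1 - x) / real n)"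
proof -
  show "\<i> \<bullet> polar n r x = r * sin (2 * pi * x / real n)"
    by (simp add: Im_polar)
  have "(\<i> * polar n 1 1) \<bullet> polar n r x = Im (polar n r x * polar n 1 (-1))"
    by (simp add: inner_complex_def polar_def)
  then show "(\<i> * polar n 1 1) \<bullet> polar n r x = - r * sin (2 * pi * (1 - x) / real n)"
    by (simp only: Im_polar_rotated)
qed

text \<open>As the part of a disk between two half-planes, the sector has its compactness, convexity
  and interior at once.\<close>

lemma sector_eq:
  "sector n = cball 0 1 \<inter> {z. \<i> \<bullet> z \<ge> 0} \<inter> {z. (\<i> * polar n 1 1) \<bullet> z \<le> 0}"
proof -
  show ?thesis
  proof (intro equalityI subsetI)
    fix z assume "z \<in> sector n"
    then obtain r x where z: "z = polar n r x" "r \<in> {0..1}" "x \<in> {0..1}" unfolding sector_def by blast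
    then show "z \<in> cball 0 1 \<inter> {z. \<i> \<bullet> z \<ge> 0} \<inter> {z. (\<i> * polar n 1 1) \<bullet> z \<le> 0}"
      using sin_sector(1)[of x] sin_sector(1)[of "1 - x"]
      unfolding Int_iff mem_Collect_eq z(1) inner_polar by auto
  next
    fix z assume z: "z \<in> cball 0 1 \<inter> {z. \<i> \<bullet> z \<ge> 0} \<inter> {z. (\<i> * polar n 1 1) \<bullet> z \<le> 0}"
    show "z \<in> sector n"
    proof (cases "z = 0")
      case True
      then have "z = polar n 0 0" by simp
      then show ?thesis unfolding sector_def by force
    next
      case False
      obtain x where x: "x \<in> {0..<real n}" "z = polar n (norm z) x"
        using polar_surj[of n z] n False by auto
      have "\<i> \<bullet> polar n (norm z) x \<ge> 0" "(\<i> * polar n 1 1) \<bullet> polar n (norm z) x \<le> 0"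
        using z unfolding x(2)[symmetric] by blast+
      then have s: "sin (2 * pi * x / real n) \<ge> 0" "sin (2 * pi * (1 - x) / real n) \<ge> 0"
        using False unfolding inner_polar by (auto simp: zero_le_mult_iff)
      have "x \<le> 1"
      proof (rule ccontr)
        \<comment> \<open>The first half-plane bounds the angle of \<open>x\<close> by
          \<open>pi\<close>. The angle of \<open>x - 1\<close> then lies strictly between 0 and
          \<open>pi\<close>, against the second half-plane.\<close>
        assume x1: "\<not> x \<le> 1"
        have h: "2 * pi * x / real n < 2 * pi" using x n by (auto simp: field_simps)
        have "2 * pi * x / real n \<le> pi"
        proof (rule ccontr)
          assume "\<not> ?thesis"
          then have "sin (2 * pi * x / real n) < 0" using h by (intro sin_lt_zero) auto
          then show False using s by simp
        qed
        moreover have "2 * pi * (x - 1) / real n < 2 * pi * x / real n"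
          using n by (intro divide_strict_right_mono mult_strict_left_mono) auto
        moreover have "0 < 2 * pi * (x - 1) / real n" using x1 n by auto
        ultimately have "sin (2 * pi * (x - 1) / real n) > 0"
          by (intro sin_gt_zero) auto
        moreover have "2 * pi * (1 - x) / real n = - (2 * pi * (x - 1) / real n)" using n by (simp add: field_simps)
        ultimately show False using s(2) by (simp only: sin_minus)
      qed
      then have "norm z \<in> {0..1}" "x \<in> {0..1}" using x(1) z by auto
      then show ?thesis unfolding sector_def by (intro CollectI exI[of _ "norm z"] exI[of _ x] conjI x(2))
    qed
  qed
qed

lemma interior_sector_iff:
  assumes "r \<in> {0..1}" "x \<in> {0..1}"
  shows "polar n r x \<in> interior (sector n) \<longleftrightarrow> 0 < r \<and> r < 1 \<and> 0 < x \<and> x < 1"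
proof -
  have nz: "\<i> * polar n 1 1 \<noteq> 0" by (simp add: polar_def)
  have "interior (sector n) = ball 0 1 \<inter> {z. \<i> \<bullet> z > 0} \<inter> {z. (\<i> * polar n 1 1) \<bullet> z < 0}"
    unfolding sector_eq interior_Int interior_cball
      interior_halfspace_ge[OF complex_i_not_zero] interior_halfspace_le[OF nz] ..
  then have "polar n r x \<in> interior (sector n) \<longleftrightarrow>
     r < 1 \<and> r * sin (2 * pi * x / real n) > 0 \<and> r * sin (2 * pi * (1 - x) / real n) > 0"
    using assms by (simp only: Int_iff mem_Collect_eq inner_polar mem_ball dist_0_norm norm_polar) auto
  also have "\<dots> \<longleftrightarrow> 0 < r \<and> r < 1 \<and> 0 < x \<and> x < 1"
    using sin_sector[of x] sin_sector[of "1 - x"] assms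
    by (auto simp: zero_less_mult_iff order_less_le)
  finally show ?thesis .
qed

lemma compact_sector: "compact (sector n)"
  unfolding sector_eq by (intro compact_Int_closed closed_halfspace_ge closed_halfspace_le compact_cball)

lemma convex_sector: "convex (sector n)"
  unfolding sector_eq by (intro convex_Int convex_halfspace_ge convex_halfspace_le convex_cball)

text \<open>
  The radial extension of a map of the boundary of the sector onto the boundary of a pentagon: the
  two radii are two sides of the pentagon, and the arc consists of the other three sides.
\<close>

lemma sector_to_pentagon:
  obtains \<Phi> where "continuous_on (sector n) \<Phi>" "inj_on \<Phi> (sector n)" "\<Phi> ` sector n = cball (0::complex) 1"
    "\<And>r. r \<in> {0..1} \<Longrightarrow> \<Phi> (polar n r 0) = polar 5 1 r"
    "\<And>x. x \<in> {0..1} \<Longrightarrow> \<Phi> (polar n 1 x) = polar 5 1 (1 + 3 * x)"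
    "\<And>r. r \<in> {0..1} \<Longrightarrow> \<Phi> (polar n r 1) = polar 5 1 (5 - r)"
    "\<And>r x. \<lbrakk>0 < r; r < 1; 0 < x; x < 1\<rbrakk> \<Longrightarrow> \<Phi> (polar n r x) \<in> ball 0 1"
proof -
  \<comment> \<open>\<open>R\<close> and \<open>X\<close> are the polar coordinates of a point that
    runs once around the sector: out along one radius, along the arc, back along the other radius.
    The times 1/5, 3/5 and 1/5 give the five sides of the pentagon equal shares.\<close>
  define R where "R u = (if u \<le> 1/5 then 5 * u else if u \<le> 4/5 then 1 else 5 - 5 * u)" for u :: real
  define X where "X u = (if u \<le> 1/5 then 0 else if u \<le> 4/5 then (5 * u - 1) / 3 else 1)" for u :: real
  define q where "q u = polar n (R u) (X u)" for u
  have RX: "R u \<in> {0..1}" "X u \<in> {0..1}" if "u \<in> {0..1}" for u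
    using that by (auto simp: R_def X_def)
  have q_arc: "q ((1 + 3 * x) / 5) = polar n 1 x" if "x \<in> {0..1}" for x
  proof -
    have "R ((1 + 3 * x) / 5) = 1" "X ((1 + 3 * x) / 5) = x"
      using that by (auto simp: R_def X_def field_simps)
    then show ?thesis by (simp add: q_def)
  qed
  have q_radius: "q ((5 - r) / 5) = polar n r 1" if "r \<in> {0..1}" for r
  proof -
    have "R ((5 - r) / 5) = r" "X ((5 - r) / 5) = 1"
      using that by (auto simp: R_def X_def field_simps)
    then show ?thesis by (simp add: q_def)
  qed
  have cont: "continuous_on {0..1} R" "continuous_on {0..1} X"
    unfolding R_def X_def
    by (intro continuous_on_cases_le continuous_intros; auto)+
  have simple: "simple_path q"
    unfolding simple_path_def loop_free_def
  proof (intro conjI ballI impI)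
    show "path q" unfolding path_def q_def by (intro continuous_intros cont)
    fix u u' :: real assume u: "u \<in> {0..1}" "u' \<in> {0..1}" "q u = q u'"
    have "R u = R u' \<and> (R u = 0 \<or> X u = X u')"
      using polar_unit_eqD[OF RX(1)[OF u(1)] RX(1)[OF u(2)] RX(2)[OF u(1)] RX(2)[OF u(2)] u(3)[unfolded q_def]] .
    then show "u = u' \<or> u = 0 \<and> u' = 1 \<or> u = 1 \<and> u' = 0"
      using u by (auto simp: R_def X_def split: if_splits)
  qed
  have frontier: "path_image q = frontier (sector n)"
  proof -
    have fr: "frontier (sector n) = sector n - interior (sector n)"
      by (simp add: frontier_def compact_sector compact_imp_closed)
    show ?thesis
    proof (intro equalityI subsetI)
      fix z assume "z \<in> path_image q"
      then obtain u where u: "u \<in> {0..1}" "z = q u" unfolding path_image_def by blast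
      have "\<not> (0 < R u \<and> R u < 1 \<and> 0 < X u \<and> X u < 1)"
        by (auto simp: R_def X_def)
      then have "z \<notin> interior (sector n)"
        unfolding u(2) q_def using interior_sector_iff RX[OF u(1)] by blast
      moreover have "z \<in> sector n" unfolding u(2) q_def sector_def using RX[OF u(1)] by blast
      ultimately show "z \<in> frontier (sector n)" using fr by blast
    next
      fix z assume "z \<in> frontier (sector n)"
      then have zs: "z \<in> sector n" "z \<notin> interior (sector n)" unfolding fr by auto
      from zs(1) obtain r x where z: "z = polar n r x" "r \<in> {0..1}" "x \<in> {0..1}"
        unfolding sector_def by blast
      have "\<not> (0 < r \<and> r < 1 \<and> 0 < x \<and> x < 1)"
        using zs(2) unfolding z(1) interior_sector_iff[OF z(2,3)] .
      then consider "r = 0" | "r = 1" "x > 0" | "x = 0" | "x = 1" using z by fastforce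
      then have "\<exists>u\<in>{0..1}. z = q u"
      proof cases
        case 1
        then show ?thesis by (intro bexI[of _ 0]) (auto simp: z q_def R_def)
      next
        case 2
        then show ?thesis using z q_arc[of x] by (intro bexI[of _ "(1 + 3 * x) / 5"]) auto
      next
        case 3
        then show ?thesis using z by (intro bexI[of _ "r / 5"]) (auto simp: q_def R_def X_def)
      next
        case 4
        then show ?thesis using z q_radius[of r] by (intro bexI[of _ "(5 - r) / 5"]) auto
      qed
      then show "z \<in> path_image q" unfolding path_image_def by blast
    qed
  qed
  have "polar n (1/2) (1/2) \<in> interior (sector n)" by (subst interior_sector_iff) auto
  then obtain \<Phi> where \<Phi>: "continuous_on (sector n) \<Phi>" "inj_on \<Phi> (sector n)" "\<Phi> ` sector n = cball (0::complex) 1"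
    "\<And>u. u \<in> {0..1} \<Longrightarrow> \<Phi> (q u) = cis (2 * pi * u)"
    "\<And>z. z \<in> interior (sector n) \<Longrightarrow> \<Phi> z \<in> ball 0 1"
    using convex_radial_homeomorphism[OF compact_sector convex_sector _ simple _ frontier]
    by (auto simp: pathstart_def pathfinish_def q_def R_def)
  have \<Phi>q: "\<Phi> (q (u / 5)) = polar 5 1 u" if "u \<in> {0..5}" for u
    using \<Phi>(4)[of "u / 5"] that by (simp add: polar_def)
  show thesis
  proof (rule that[OF \<Phi>(1-3)])
    show "\<Phi> (polar n r 0) = polar 5 1 r" if "r \<in> {0..1}" for r
      using \<Phi>q[of r] that by (simp add: q_def R_def X_def)
    show "\<Phi> (polar n 1 x) = polar 5 1 (1 + 3 * x)" if "x \<in> {0..1}" for x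
      using \<Phi>q[of "1 + 3 * x"] q_arc[OF that] that by simp
    show "\<Phi> (polar n r 1) = polar 5 1 (5 - r)" if "r \<in> {0..1}" for r
      using \<Phi>q[of "5 - r"] q_radius[OF that] that by simp
    show "\<Phi> (polar n r x) \<in> ball 0 1" if "0 < r" "r < 1" "0 < x" "x < 1" for r x
      using \<Phi>(5) interior_sector_iff[of r x] that by auto
  qed
qed

end

section \<open>Vertices of oriented tilings\<close>

text \<open>This is how the local disks of a surface enter: a small ball in a disk chart stays
  connected without its centre, and its preimage fits into any given neighbourhood of
  \<open>v\<close>.\<close>

lemma homeomorphic_disk_punctured_neighbourhood:
  assumes S: "closed_surface S" and U: "openin (top_of_set S) U" "v \<in> U"
  obtains V where "openin (top_of_set S) V" "v \<in> V" "V \<subseteq> U" "connected (V - {v})"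
proof -
  have vS: "v \<in> S" using U openin_imp_subset by blast
  then obtain U0 where U0: "openin (top_of_set S) U0" "v \<in> U0" "U0 homeomorphic (ball 0 1 :: complex set)"
    using S unfolding closed_surface_def by blast
  then obtain f g where fg: "homeomorphism U0 (ball (0::complex) 1) f g"
    unfolding homeomorphic_def by blast
  have "openin (top_of_set U0) (U \<inter> U0)"
  proof -
    obtain T where T: "open T" "U = S \<inter> T" using U(1) unfolding openin_open by blast
    have "U \<inter> U0 = U0 \<inter> T" using T(2) openin_imp_subset[OF U0(1)] by auto
    then show ?thesis using openin_open_Int[OF T(1)] by metis
  qed
  then have "openin (top_of_set (ball 0 1)) (f ` (U \<inter> U0))"
    using homeomorphism_imp_open_map[OF fg] by blast
  then have "open (f ` (U \<inter> U0))" by (simp add: openin_open_eq)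
  moreover have "f v \<in> f ` (U \<inter> U0)" using U(2) U0(2) by blast
  ultimately obtain e where e: "e > 0" "ball (f v) e \<subseteq> f ` (U \<inter> U0)"
    unfolding open_contains_ball by blast
  have gf: "g (f x) = x" if "x \<in> U0" for x using fg that unfolding homeomorphism_def by blast
  have fU0: "f ` U0 = ball 0 1" using fg unfolding homeomorphism_def by blast
  define V where "V = g ` ball (f v) e"
  have sub: "ball (f v) e \<subseteq> ball 0 1" using e(2) fU0 by blast
  have VU: "V \<subseteq> U \<inter> U0" using e(2) gf unfolding V_def by fastforce
  have gb: "f (g y) = y" if "y \<in> ball (f v) e" for y
    using that sub fg unfolding homeomorphism_def by blast
  show thesis
  proof
    have "openin (top_of_set U0) V"
      unfolding V_def using sub
      by (intro homeomorphism_imp_open_map[OF homeomorphism_symD[OF fg]]) (auto simp: openin_open_eq)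
    then show "openin (top_of_set S) V" using U0(1) openin_trans by blast
    show "v \<in> V" unfolding V_def using gf[OF U0(2)] e(1) by (metis centre_in_ball image_eqI)
    show "V \<subseteq> U" using VU by blast
    have "V - {v} = g ` (ball (f v) e - {f v})"
      unfolding V_def using gf[OF U0(2)] gb by force
    moreover have "connected (g ` (ball (f v) e - {f v}))"
    proof (rule connected_continuous_image)
      show "continuous_on (ball (f v) e - {f v}) g"
        using fg sub unfolding homeomorphism_def by (meson Diff_subset continuous_on_subset subset_trans)
      show "connected (ball (f v) e - {f v})"
        by (rule connected_punctured_ball) simp
    qed
    ultimately show "connected (V - {v})" by simp
  qed
qed

section \<open>Caps at the corners of a tile\<close>

text \<open>A cap is a neighbourhood, in the closed disk, of an \<open>n\<close>-th root of unity.\<close>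

definition cap :: "nat \<Rightarrow> nat \<Rightarrow> complex set" where
  "cap n j = cball 0 1 \<inter> {z. polar n 1 (real j) \<bullet> z \<ge> cos (pi / (2 * real n))}"

lemma inner_polar_polar: "polar n 1 x \<bullet> z = Re (z * polar n 1 (- x))"
  by (simp add: inner_complex_def polar_def)

lemma cos_cap_pos: "n \<ge> 2 \<Longrightarrow> cos (pi / (2 * real n)) > 0"
proof (rule cos_gt_zero_pi)
  assume "n \<ge> 2"
  then show "pi / (2 * real n) < pi / 2" by (simp add: field_simps)
  have "- (pi / 2) < 0" by simp
  also have "0 \<le> pi / (2 * real n)" by simp
  finally show "- (pi / 2) < pi / (2 * real n)" .
qed

text \<open>The threshold angle \<open>pi / (2 * real n)\<close> is a quarter of the angle of a
  side, whence the bound 1/4. Points of smaller radius satisfy it too: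
  \<open>r * cos \<theta>\<close> with \<open>r \<le> 1\<close> reaches the positive threshold only
  if \<open>cos \<theta>\<close> does.\<close>

lemma cap_polar:
  assumes n: "n \<ge> 2" and z: "z \<in> cap n j"
  obtains r x where "0 < r" "r \<le> 1" "\<bar>x\<bar> \<le> 1 / 4" "z = polar n r (real j + x)"
proof -
  define w where "w = z * polar n 1 (- real j)"
  have normw: "norm w = norm z" by (simp add: w_def norm_mult)
  have Rew: "Re w \<ge> cos (pi / (2 * real n))" using z by (simp add: w_def cap_def inner_polar_polar)
  then have "w \<noteq> 0" using cos_cap_pos[OF n] by auto
  then obtain y where y: "y \<in> {0..<real n}" "w = polar n (norm w) y"
    using polar_surj[of n w] n by auto
  \<comment> \<open>The angle is taken within half a turn of 0, where its cosine controls its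
    absolute value.\<close>
  define x where "x = (if y \<le> real n / 2 then y else y - real n)"
  have "polar n (norm w) x = polar n (norm w) y"
    using polar_add_int[of n "norm w" y "-1"] n by (auto simp: x_def)
  then have w: "w = polar n (norm w) x" using y(2) by simp
  have absx: "\<bar>x\<bar> \<le> real n / 2" using y(1) by (auto simp: x_def)
  have "norm w \<le> 1" "norm w > 0" using normw z \<open>w \<noteq> 0\<close> by (auto simp: cap_def)
  have "Re w = norm w * cos (2 * pi * x / real n)" by (subst w) (simp add: polar_def)
  then have "norm w * cos (2 * pi * x / real n) > 0" using Rew cos_cap_pos[OF n] by linarith
  then have "cos (2 * pi * x / real n) > 0" using \<open>norm w > 0\<close> by (simp add: zero_less_mult_iff)
  then have "norm w * cos (2 * pi * x / real n) \<le> 1 * cos (2 * pi * x / real n)"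
    using \<open>norm w \<le> 1\<close> by (intro mult_right_mono) auto
  then have "cos (pi / (2 * real n)) \<le> cos (2 * pi * x / real n)"
    using Rew \<open>Re w = _\<close> by linarith
  also have "cos (2 * pi * x / real n) = cos \<bar>2 * pi * x / real n\<bar>" by (rule cos_abs_real[symmetric])
  finally have "cos (pi / (2 * real n)) \<le> cos \<bar>2 * pi * x / real n\<bar>" .
  moreover have "\<bar>2 * pi * x / real n\<bar> \<le> pi"
    using absx n by (simp add: abs_mult field_simps)
  moreover have "pi / (2 * real n) \<le> pi" using n by (simp add: field_simps)
  ultimately have "\<bar>2 * pi * x / real n\<bar> \<le> pi / (2 * real n)"
    by (subst (asm) cos_mono_le_eq) auto
  then have "\<bar>x\<bar> \<le> 1 / 4" using n by (simp add: abs_mult field_simps)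
  moreover have "z = polar n (norm w) (real j + x)"
  proof -
    have "z = w * polar n 1 (real j)"
      by (simp add: w_def mult.assoc polar_mult_polar) (simp add: polar_def)
    then show ?thesis by (subst (asm) w) (simp add: polar_mult_polar add.commute)
  qed
  ultimately show thesis using that \<open>norm w \<le> 1\<close> \<open>norm w > 0\<close> by blast
qed

text \<open>Two offsets of at most 1/4 differ by at most 1/2, too little to lead from different
  integers below \<open>n\<close> to the same angle.\<close>

lemma cap_disjoint:
  assumes "n \<ge> 2" "z \<in> cap n j" "z \<in> cap n j'" "j < n" "j' < n"
  shows "j = j'"
proof -
  obtain r x r' x' where p: "0 < r" "\<bar>x\<bar> \<le> 1 / 4" "z = polar n r (real j + x)"
      "0 < r'" "\<bar>x'\<bar> \<le> 1 / 4" "z = polar n r' (real j' + x')"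
    using cap_polar[OF assms(1,2)] cap_polar[OF assms(1,3)] by metis
  then obtain m :: int where m: "real j + x = real j' + x' + real n * m"
    using polar_eqD[of n r r' "real j + x" "real j' + x'"] assms(1) by auto
  have "\<bar>real_of_int (int j - int j' - int n * m)\<bar> \<le> 1/2" 
    using m p(2,5) unfolding of_int_diff of_int_mult of_int_of_nat_eq by linarith
  then have "int j - int j' = int n * m" by linarith
  then have "int j mod int n = int j' mod int n"
    by (metis diff_add_cancel mod_mult_self4)
  then show ?thesis using assms by simp
qed

text \<open>These points lie on side \<open>j\<close> close to its start. Through them every edge
  leaving a vertex is seen to enter a cap there.\<close>

lemma polar_in_cap:
  assumes "n \<ge> 2" "0 \<le> s" "s \<le> 1 / 4"
  shows "polar n 1 (real j + s) \<in> cap n j"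
proof -
  have "polar n 1 (real j) \<bullet> polar n 1 (real j + s) = cos (2 * pi * s / real n)"
    by (simp add: inner_polar_polar polar_mult_polar) (simp add: polar_def)
  also have "2 * pi * s / real n \<le> pi / (2 * real n)" using assms by (simp add: field_simps)
  then have "cos (2 * pi * s / real n) \<ge> cos (pi / (2 * real n))"
    using assms by (intro cos_monotone_0_pi_le) (auto simp: field_simps)
  finally show ?thesis by (simp add: cap_def)
qed

lemma reversepath_neq: "simple_path \<gamma> \<Longrightarrow> reversepath \<gamma> \<noteq> \<gamma>"
proof
  assume s: "simple_path \<gamma>" and eq: "reversepath \<gamma> = \<gamma>"
  have "\<gamma> (1/4) = \<gamma> (3/4)" using fun_cong[OF eq, of "1/4"] by (simp add: reversepath_def)
  moreover have "(1/4::real) \<in> {0..1}" "(3/4::real) \<in> {0..1}" by auto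
  ultimately show False using s unfolding simple_path_def loop_free_def by fastforce
qed

lemma cball_frontier_polar:
  assumes "n > 0" "norm z = 1"
  obtains j s where "j < n" "s \<in> {0..<1}" "z = polar n 1 (real j + s)"
proof -
  have "z \<noteq> 0" using assms(2) by auto
  then obtain x where x: "x \<in> {0..<real n}" "z = polar n (norm z) x" using polar_surj[OF assms(1)] by blast
  show thesis
  proof
    show "nat \<lfloor>x\<rfloor> < n" using x(1) assms(1) by (simp add: nat_less_iff floor_less_iff)
    have "real (nat \<lfloor>x\<rfloor>) = \<lfloor>x\<rfloor>" using x(1) by simp
    then show "x - real (nat \<lfloor>x\<rfloor>) \<in> {0..<1}" by (auto simp: less_eq_real_def) linarith+
    show "z = polar n 1 (real (nat \<lfloor>x\<rfloor>) + (x - real (nat \<lfloor>x\<rfloor>)))" using x(2) assms(2) by simp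
  qed
qed

lemma boundary_walk_polar:
  assumes "boundary_walk t \<gamma>s"
  obtains h where "continuous_on (cball 0 1) h" "inj_on h (ball 0 1)" "h ` ball 0 1 = t"
    "\<And>j s. \<lbrakk>j < length \<gamma>s; s \<in> {0..1}\<rbrakk> \<Longrightarrow> h (polar (length \<gamma>s) 1 (real j + s)) = (\<gamma>s ! j) s"
proof -
  obtain h h' where h: "continuous_on (cball 0 1) h" "homeomorphism (ball (0::complex) 1) t h h'"
     "\<forall>j<length \<gamma>s. \<forall>s\<in>{0..1}. h (cis (2 * pi * (real j + s) / real (length \<gamma>s))) = (\<gamma>s ! j) s"
    using assms unfolding boundary_walk_def by blast
  show thesis
  proof
    show "inj_on h (ball 0 1)" "h ` ball 0 1 = t"
      using h(2) unfolding homeomorphism_def by (auto intro: inj_on_inverseI)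
  qed (use h in \<open>auto simp: polar_def\<close>)
qed

text \<open>The inverse is continuous by compactness: \<open>h\<close> sends relatively closed
  subsets of the closed disk to compact sets, and as the circle misses \<open>t\<close>,
  intersecting with \<open>t\<close> leaves only images of points of the open disk.\<close>

lemma boundary_walkI:
  fixes t :: "'a::t2_space set"
  assumes h: "continuous_on (cball 0 1) h" "inj_on h (ball 0 1)" "h ` ball 0 1 = t"
    and disj: "h ` sphere 0 1 \<inter> t = {}"
    and walk: "\<And>j s. \<lbrakk>j < length \<gamma>s; s \<in> {0..1}\<rbrakk> \<Longrightarrow> h (polar (length \<gamma>s) 1 (real j + s)) = (\<gamma>s ! j) s"
  shows "boundary_walk t \<gamma>s"
proof -
  have "\<exists>h'. homeomorphism (ball 0 1) t h h'"
  proof (rule homeomorphism_injective_closed_map[OF _ h(3) h(2)])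
    show "continuous_on (ball 0 1) h" using h(1) by (rule continuous_on_subset) auto
    fix C assume "closedin (top_of_set (ball (0::complex) 1)) C"
    then obtain D where D: "closed D" "C = ball 0 1 \<inter> D" unfolding closedin_closed by blast
    have "compact (h ` (cball 0 1 \<inter> D))"
    proof (rule compact_continuous_image)
      show "continuous_on (cball 0 1 \<inter> D) h" using h(1) by (rule continuous_on_subset) auto
      show "compact (cball 0 1 \<inter> D)" using D by (intro compact_Int_closed) auto
    qed
    then have "closed (h ` (cball 0 1 \<inter> D))" by (rule compact_imp_closed)
    moreover have "h ` C = t \<inter> h ` (cball 0 1 \<inter> D)"
    proof (intro equalityI subsetI)
      fix y assume "y \<in> t \<inter> h ` (cball 0 1 \<inter> D)"
      then obtain z where z: "z \<in> cball 0 1" "z \<in> D" "y = h z" "y \<in> t" by blast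
      then have "z \<notin> sphere 0 1" using disj by blast
      then show "y \<in> h ` C" using z D(2) by auto
    qed (use D h(3) in auto)
    ultimately show "closedin (top_of_set t) (h ` C)" unfolding closedin_closed by blast
  qed blast
  then obtain h' where "homeomorphism (ball 0 1) t h h'" by blast
  then show ?thesis unfolding boundary_walk_def
    using h(1) walk by (intro exI[of _ h] exI[of _ h']) (auto simp: polar_def)
qed

lemma polar_mod:
  assumes "n > 0"
  shows "polar n r (real (a mod n) + s) = polar n r (real a + s)"
proof -
  have "real a = real (n * (a div n) + a mod n)" by simp
  then have "real (a mod n) + s = (real a + s) + real n * of_int (- int (a div n))"
    unfolding of_nat_add of_nat_mult by simp
  then show ?thesis using polar_add_int[OF assms] by metis
qed

lemma boundary_walk_joint:
  assumes w: "boundary_walk t \<gamma>s" and j: "j < length \<gamma>s"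
  shows "pathstart (\<gamma>s ! (Suc j mod length \<gamma>s)) = pathfinish (\<gamma>s ! j)"
proof -
  let ?n = "length \<gamma>s"
  obtain h where h: "\<And>j s. \<lbrakk>j < ?n; s \<in> {0..1}\<rbrakk> \<Longrightarrow> h (polar ?n 1 (real j + s)) = (\<gamma>s ! j) s"
    using boundary_walk_polar[OF w] by blast
  have n: "?n > 0" using j by linarith
  have j': "Suc j mod ?n < ?n" using n by simp
  have "polar ?n 1 (real (Suc j mod ?n)) = polar ?n 1 (real j + 1)"
    using polar_mod[OF n, of 1 "Suc j" 0] by (simp add: add.commute)
  then show ?thesis using h[OF j', of 0] h[OF j, of 1] by (simp add: pathstart_def pathfinish_def)
qed

text \<open>The disk is turned by \<open>k\<close> sides before \<open>h\<close> is applied.\<close>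

lemma boundary_walk_rotate:
  assumes "boundary_walk t \<gamma>s"
  shows "boundary_walk t (rotate k \<gamma>s)"
proof (cases "\<gamma>s = []")
  case False
  let ?n = "length \<gamma>s"
  define R where "R z = z * polar ?n 1 (real k)" for z
  define R' where "R' z = z * polar ?n 1 (- real k)" for z
  obtain h h' where h: "continuous_on (cball 0 1) h" "homeomorphism (ball (0::complex) 1) t h h'"
     "\<And>j s. \<lbrakk>j < ?n; s \<in> {0..1}\<rbrakk> \<Longrightarrow> h (polar ?n 1 (real j + s)) = (\<gamma>s ! j) s"
    using assms unfolding boundary_walk_def polar_def by force
  have RR: "R (R' z) = z" "R' (R z) = z" for z
    by (simp_all add: R_def R'_def mult.assoc polar_mult_polar) (simp_all add: polar_def)
  have nR: "norm (R z) = norm z" "norm (R' z) = norm z" for z by (simp_all add: R_def R'_def norm_mult)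
  have cR: "continuous_on A R" "continuous_on A R'" for A
    unfolding R_def R'_def by (intro continuous_intros)+
  have img: "R ` ball 0 1 = ball 0 1" "R' ` ball 0 1 = ball 0 1"
    using RR nR by (auto simp: image_iff) (metis dist_0_norm mem_ball)+
  have "homeomorphism (ball 0 1) (ball 0 1) R R'"
    unfolding homeomorphism_def using RR img cR by auto
  then have "homeomorphism (ball 0 1) t (h \<circ> R) (R' \<circ> h')"
    using h(2) by (rule homeomorphism_compose)
  moreover have "continuous_on (cball 0 1) (h \<circ> R)"
    by (intro continuous_on_compose cR continuous_on_subset[OF h(1)]) (auto simp: nR)
  moreover have "(h \<circ> R) (polar ?n 1 (real j + s)) = (rotate k \<gamma>s ! j) s" if "j < ?n" "s \<in> {0..1}" for j s
  proof -
    have n: "?n > 0" using that(1) by linarith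
    have i: "(k + j) mod ?n < ?n" using n by simp
    have "polar ?n 1 (real ((k + j) mod ?n) + s) = polar ?n 1 (real j + s + real k)"
      using polar_mod[OF n, of 1 "k + j" s] by (simp add: algebra_simps)
    also have "\<dots> = R (polar ?n 1 (real j + s))" by (simp add: R_def polar_mult_polar)
    finally show ?thesis using h(3)[OF i that(2)] that by (simp add: nth_rotate)
  qed
  ultimately show ?thesis unfolding boundary_walk_def
    by (intro exI[of _ "h \<circ> R"] exI[of _ "R' \<circ> h'"]) (simp add: polar_def)
qed (use assms in simp)

section \<open>Charts of the tiles and the corners at a vertex\<close>

locale oriented_tiled =
  fixes S :: "'a::t2_space set" and \<Gamma> :: "(real \<Rightarrow> 'a) set" and B :: "'a set \<Rightarrow> (real \<Rightarrow> 'a) list"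
  assumes oriented: "oriented_tiling S \<Gamma> B"
begin

definition skeleton :: "'a set" where "skeleton = (\<Union>\<gamma>\<in>\<Gamma>. path_image \<gamma>)"

lemma embedded: "embedded_graph S \<Gamma>"
  using oriented unfolding oriented_tiling_def tiling_def by blast

lemma finite_edges: "finite \<Gamma>"
  using embedded unfolding embedded_graph_def by blast

lemma edge_simple: "\<gamma> \<in> \<Gamma> \<Longrightarrow> simple_path \<gamma>"
  and edge_in_surface: "\<gamma> \<in> \<Gamma> \<Longrightarrow> path_image \<gamma> \<subseteq> S"
  and edge_reverse: "\<gamma> \<in> \<Gamma> \<Longrightarrow> reversepath \<gamma> \<in> \<Gamma>"
  using embedded unfolding embedded_graph_def by blast+

text \<open>This joins the disjointness of different edges with the simplicity of a single one: the
  only coincidence that \<open>simple_path\<close> allows is that of the two ends, and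
  \<open>s\<close> is not an end.\<close>

lemma edge_inner_eq:
  assumes "\<gamma> \<in> \<Gamma>" "\<delta> \<in> \<Gamma>" "s \<in> {0<..<1}" "u \<in> {0..1}" "\<gamma> s = \<delta> u"
  shows "\<delta> = \<gamma> \<and> u = s \<or> \<delta> = reversepath \<gamma> \<and> u = 1 - s"
proof -
  have inj: "x = s" if "x \<in> {0..1}" "\<gamma> x = \<gamma> s" for x
    using edge_simple[OF assms(1)] assms(3) that unfolding simple_path_def loop_free_def by fastforce
  have "\<gamma> s \<in> \<gamma> ` {0<..<1}" using assms(3) by (rule imageI)
  moreover have "\<gamma> s \<in> path_image \<delta>"
    unfolding assms(5) path_image_def using assms(4) by (rule imageI)
  ultimately have "\<delta> = \<gamma> \<or> \<delta> = reversepath \<gamma>" using embedded assms(1,2) unfolding embedded_graph_def by blast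
  then show ?thesis
  proof
    assume "\<delta> = reversepath \<gamma>"
    then have "\<gamma> (1 - u) = \<gamma> s" using assms(5) by (simp add: reversepath_def)
    then show ?thesis using inj[of "1 - u"] assms(4) \<open>\<delta> = reversepath \<gamma>\<close> by auto
  qed (use inj[of u] assms in auto)
qed

lemma pathstart_in_vertices: "\<gamma> \<in> \<Gamma> \<Longrightarrow> pathstart \<gamma> \<in> vertices \<Gamma>"
  unfolding vertices_def by blast

lemma pathfinish_in_vertices: "\<gamma> \<in> \<Gamma> \<Longrightarrow> pathfinish \<gamma> \<in> vertices \<Gamma>"
  using pathstart_in_vertices[OF edge_reverse] by simp

lemma edge_inner_not_vertex:
  assumes "\<gamma> \<in> \<Gamma>" "s \<in> {0<..<1}"
  shows "\<gamma> s \<notin> vertices \<Gamma>"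
proof
  assume "\<gamma> s \<in> vertices \<Gamma>"
  then obtain \<delta> where "\<delta> \<in> \<Gamma>" "\<gamma> s = \<delta> 0" unfolding vertices_def pathstart_def by blast
  then show False using edge_inner_eq[OF assms(1) _ assms(2), of \<delta> 0] assms(2) by auto
qed

lemma edge_in_skeleton: "\<gamma> \<in> \<Gamma> \<Longrightarrow> s \<in> {0..1} \<Longrightarrow> \<gamma> s \<in> skeleton"
  unfolding skeleton_def path_image_def by blast

lemma vertices_in_skeleton: "vertices \<Gamma> \<subseteq> skeleton"
  unfolding vertices_def pathstart_def using edge_in_skeleton by auto

lemma tiles_eq: "tiles S \<Gamma> = components (S - skeleton)"
  unfolding tiles_def skeleton_def ..

lemma tile_subset: "t \<in> tiles S \<Gamma> \<Longrightarrow> t \<subseteq> S - skeleton"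
  unfolding tiles_eq by (rule in_components_subset)

lemma tile_disjoint: "t \<in> tiles S \<Gamma> \<Longrightarrow> t' \<in> tiles S \<Gamma> \<Longrightarrow> x \<in> t \<Longrightarrow> x \<in> t' \<Longrightarrow> t = t'"
  unfolding tiles_eq using components_nonoverlap by blast

lemma walk_edge: "t \<in> tiles S \<Gamma> \<Longrightarrow> j < length (B t) \<Longrightarrow> B t ! j \<in> \<Gamma>"
  and walk_length: "t \<in> tiles S \<Gamma> \<Longrightarrow> 3 \<le> length (B t)"
  and walk_boundary: "t \<in> tiles S \<Gamma> \<Longrightarrow> boundary_walk t (B t)"
  using oriented unfolding oriented_tiling_def by (auto dest: nth_mem)

lemma walk_unique:
  assumes "t \<in> tiles S \<Gamma>" "j < length (B t)" "t' \<in> tiles S \<Gamma>" "j' < length (B t')" "B t ! j = B t' ! j'"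
  shows "t = t' \<and> j = j'"
proof -
  have "inj_on (\<lambda>(t, j). B t ! j) (SIGMA t:tiles S \<Gamma>. {..<length (B t)})"
    using oriented unfolding oriented_tiling_def bij_betw_def by blast
  from inj_onD[OF this, of "(t,j)" "(t',j')"] show ?thesis using assms by auto
qed

lemma walk_cover:
  assumes "\<gamma> \<in> \<Gamma>"
  obtains t j where "t \<in> tiles S \<Gamma>" "j < length (B t)" "B t ! j = \<gamma>"
proof -
  have "(\<lambda>(t, j). B t ! j) ` (SIGMA t:tiles S \<Gamma>. {..<length (B t)}) = \<Gamma>"
    using oriented unfolding oriented_tiling_def bij_betw_def by blast
  then have "\<gamma> \<in> (\<lambda>(t, j). B t ! j) ` (SIGMA t:tiles S \<Gamma>. {..<length (B t)})" using assms by simp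
  then show thesis by (auto intro: that)
qed

lemma finite_tiles: "finite (tiles S \<Gamma>)"
proof -
  have "bij_betw (\<lambda>(t, j). B t ! j) (SIGMA t:tiles S \<Gamma>. {..<length (B t)}) \<Gamma>"
    using oriented unfolding oriented_tiling_def by blast
  then have "finite (SIGMA t:tiles S \<Gamma>. {..<length (B t)})"
    using finite_edges bij_betw_finite by blast
  then have "finite (fst ` (SIGMA t:tiles S \<Gamma>. {..<length (B t)}))" by blast
  moreover have "tiles S \<Gamma> \<subseteq> fst ` (SIGMA t:tiles S \<Gamma>. {..<length (B t)})"
    using walk_length by force
  ultimately show ?thesis by (rule rev_finite_subset)
qed

lemma walk_joint:
  "t \<in> tiles S \<Gamma> \<Longrightarrow> j < length (B t) \<Longrightarrow> pathstart (B t ! (Suc j mod length (B t))) = pathfinish (B t ! j)"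
  by (rule boundary_walk_joint[OF walk_boundary])

lemma degree_ge_3: "v \<in> vertices \<Gamma> \<Longrightarrow> 3 \<le> vertex_degree \<Gamma> v"
  using oriented unfolding oriented_tiling_def tiling_def by blast

text \<open>One map is fixed for each tile, because caps at different corners of a tile can be
  compared only inside the same disk.\<close>

definition chart :: "'a set \<Rightarrow> complex \<Rightarrow> 'a" where
  "chart t = (SOME h. continuous_on (cball 0 1) h \<and> inj_on h (ball 0 1) \<and> h ` ball 0 1 = t \<and>
     (\<forall>j<length (B t). \<forall>s\<in>{0..1}. h (polar (length (B t)) 1 (real j + s)) = (B t ! j) s))"

lemma chart:
  assumes "t \<in> tiles S \<Gamma>"
  shows chart_continuous: "continuous_on (cball 0 1) (chart t)"
    and chart_inj: "inj_on (chart t) (ball 0 1)"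
    and chart_ball: "chart t ` ball 0 1 = t"
    and chart_boundary: "\<lbrakk>j < length (B t); s \<in> {0..1}\<rbrakk> \<Longrightarrow> chart t (polar (length (B t)) 1 (real j + s)) = (B t ! j) s"
proof -
  have "\<exists>h. continuous_on (cball 0 1) h \<and> inj_on h (ball 0 1) \<and> h ` ball 0 1 = t \<and>
     (\<forall>j<length (B t). \<forall>s\<in>{0..1}. h (polar (length (B t)) 1 (real j + s)) = (B t ! j) s)"
    by (rule boundary_walk_polar[OF walk_boundary[OF assms]]) blast
  from someI_ex[OF this, folded chart_def]
  show "continuous_on (cball 0 1) (chart t)" "inj_on (chart t) (ball 0 1)" "chart t ` ball 0 1 = t"
    "\<lbrakk>j < length (B t); s \<in> {0..1}\<rbrakk> \<Longrightarrow> chart t (polar (length (B t)) 1 (real j + s)) = (B t ! j) s"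
    by blast+
qed

lemma chart_sphere:
  assumes "t \<in> tiles S \<Gamma>" "norm z = 1"
  obtains j s where "j < length (B t)" "s \<in> {0..<1}" "z = polar (length (B t)) 1 (real j + s)" "chart t z = (B t ! j) s"
proof -
  obtain j s where "j < length (B t)" "s \<in> {0..<1}" "z = polar (length (B t)) 1 (real j + s)"
    using cball_frontier_polar[of "length (B t)" z] assms walk_length[OF assms(1)] by (metis gr_zeroI not_numeral_le_zero)
  then show thesis using that chart_boundary[OF assms(1)] by auto
qed

text \<open>The circle is covered by the sides, and the open disk goes to the tile, which misses the
  skeleton.\<close>

lemma chart_in_skeleton_iff:
  assumes "t \<in> tiles S \<Gamma>" "norm z \<le> 1"
  shows "chart t z \<in> skeleton \<longleftrightarrow> norm z = 1"
proof
  assume "chart t z \<in> skeleton"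
  then have "chart t z \<notin> t" using tile_subset[OF assms(1)] by blast
  then have "z \<notin> ball 0 1" using chart_ball[OF assms(1)] by blast
  then show "norm z = 1" using assms by simp
next
  assume "norm z = 1"
  then show "chart t z \<in> skeleton"
    using chart_sphere[OF assms(1)] edge_in_skeleton walk_edge[OF assms(1)]
    by (metis atLeastAtMost_iff atLeastLessThan_iff less_eq_real_def)
qed

lemma surface_covered: "S \<subseteq> (\<Union>t\<in>tiles S \<Gamma>. chart t ` cball 0 1)"
proof
  fix x assume x: "x \<in> S"
  show "x \<in> (\<Union>t\<in>tiles S \<Gamma>. chart t ` cball 0 1)"
  proof (cases "x \<in> skeleton")
    case True
    then obtain \<gamma> s where "\<gamma> \<in> \<Gamma>" and s: "s \<in> {0..1}" "x = \<gamma> s" unfolding skeleton_def path_image_def by blast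
    then obtain t j where "t \<in> tiles S \<Gamma>" "j < length (B t)" "B t ! j = \<gamma>" using walk_cover by blast
    moreover from this have "x = chart t (polar (length (B t)) 1 (real j + s))" using chart_boundary s by auto
    ultimately show ?thesis by (auto intro!: bexI[of _ t] image_eqI)
  next
    case False
    then have "x \<in> \<Union> (tiles S \<Gamma>)" unfolding tiles_eq using x by simp
    then obtain t where "t \<in> tiles S \<Gamma>" "x \<in> chart t ` ball 0 1" using chart_ball by blast
    then show ?thesis using ball_subset_cball by blast
  qed
qed

text \<open>
  The closed disks of the tiles turn a small punctured neighbourhood of \<open>v\<close> into a union of caps.
  Caps of corners that are not in the same cycle around \<open>v\<close> meet only in \<open>v\<close>, so
  connectedness of the punctured neighbourhood leaves a single cycle.
\<close>

lemma single_cycle_at_vertex: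
  assumes S: "closed_surface S"
    and C: "C \<subseteq> {\<gamma>\<in>\<Gamma>. pathstart \<gamma> = v}" "C \<noteq> {}"
    and cycle: "\<And>t j. \<lbrakk>t \<in> tiles S \<Gamma>; j < length (B t)\<rbrakk> \<Longrightarrow>
        B t ! (Suc j mod length (B t)) \<in> C \<longleftrightarrow> reversepath (B t ! j) \<in> C"
  shows "C = {\<gamma>\<in>\<Gamma>. pathstart \<gamma> = v}"
proof (rule ccontr)
  assume "C \<noteq> {\<gamma>\<in>\<Gamma>. pathstart \<gamma> = v}"
  then obtain \<delta>1 \<delta>2 where \<delta>: "\<delta>1 \<in> \<Gamma>" "pathstart \<delta>1 = v" "\<delta>1 \<in> C" "\<delta>2 \<in> \<Gamma>" "pathstart \<delta>2 = v" "\<delta>2 \<notin> C"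
    using C by blast
  \<comment> \<open>The corner of \<open>t\<close> at the start of side \<open>j\<close> lies
    between two edges leaving \<open>v\<close>: \<open>B t ! j\<close> and the reverse of the
    previous side. The hypothesis \<open>cycle\<close> says that \<open>C\<close> contains both or
    neither.\<close>
  define K where "K = {(t, j). t \<in> tiles S \<Gamma> \<and> j < length (B t) \<and> pathstart (B t ! j) = v}"
  define W where "W = (\<lambda>(t, j). chart t ` cap (length (B t)) j)"
  define X where "X = (\<Union>k\<in>{(t, j)\<in>K. B t ! j \<in> C}. W k)"
  define Y where "Y = (\<Union>k\<in>{(t, j)\<in>K. B t ! j \<notin> C}. W k)"
  have vert: "v \<in> vertices \<Gamma>" using \<delta> pathstart_in_vertices by blast
  have finK: "finite K"
  proof (rule finite_subset)
    show "K \<subseteq> (SIGMA t:tiles S \<Gamma>. {..<length (B t)})" unfolding K_def by auto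
  qed (use finite_tiles in auto)
  have cW: "closed (W (t, j))" if "(t, j) \<in> K" for t j
  proof -
    have t: "t \<in> tiles S \<Gamma>" using that by (simp add: K_def)
    have "compact (cap (length (B t)) j)"
      unfolding cap_def by (intro compact_Int_closed compact_cball closed_halfspace_ge)
    then have "compact (W (t, j))" unfolding W_def
      by (auto intro!: compact_continuous_image continuous_on_subset[OF chart_continuous[OF t]] simp: cap_def)
    then show ?thesis by (rule compact_imp_closed)
  qed
  have cX: "closed X" and cY: "closed Y"
    unfolding X_def Y_def using finK cW by (auto intro!: closed_UN finite_subset[OF _ finK])
  \<comment> \<open>Within a cap the circle consists of a first quarter of side \<open>j\<close> and
    a last quarter of the previous side. Directed away from \<open>v\<close>, the latter is also a
    first quarter, and by \<open>cycle\<close> both edges give the same answer about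
    \<open>C\<close>.\<close>
  have edge_point: "\<exists>\<delta>\<in>\<Gamma>. \<exists>u. 0 < u \<and> u \<le> 1/4 \<and> x = \<delta> u \<and> (\<delta> \<in> C \<longleftrightarrow> B t ! j \<in> C)"
    if k: "(t, j) \<in> K" and x: "x \<in> W (t, j)" "x \<in> skeleton" "x \<noteq> v" for t j x
  proof -
    let ?n = "length (B t)"
    have t: "t \<in> tiles S \<Gamma>" and j: "j < ?n" and v: "pathstart (B t ! j) = v"
      using k by (auto simp: K_def)
    have n: "?n \<ge> 2" using walk_length[OF t] by simp
    obtain z where z: "z \<in> cap ?n j" "x = chart t z" using x(1) by (auto simp: W_def)
    obtain r y where ry: "0 < r" "r \<le> 1" "\<bar>y\<bar> \<le> 1 / 4" "z = polar ?n r (real j + y)"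
      using cap_polar[OF n z(1)] .
    have "norm z = 1" using chart_in_skeleton_iff[OF t, of z] x z ry by simp
    then have z1: "z = polar ?n 1 (real j + y)" using ry by simp
    have "y \<noteq> 0"
    proof
      assume "y = 0"
      then have "x = v" using chart_boundary[OF t j, of 0] z1 z(2) v by (simp add: pathstart_def)
      then show False using x by simp
    qed
    show ?thesis
    proof (cases "y > 0")
      case True
      then show ?thesis
        using chart_boundary[OF t j, of y] ry z1 z(2) walk_edge[OF t j]
        by (intro bexI[of _ "B t ! j"] exI[of _ y]) auto
    next
      case False
      define i where "i = (if j = 0 then ?n - 1 else j - 1)"
      have i: "i < ?n" "Suc i mod ?n = j" using j n by (auto simp: i_def)
      have "real j + y = real i + (1 + y) + real ?n * of_int (if j = 0 then -1 else 0)"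
        using j by (auto simp: i_def)
      then have "z = polar ?n 1 (real i + (1 + y))" using z1 polar_add_int j by (metis less_nat_zero_code neq0_conv)
      then have "x = reversepath (B t ! i) (- y)"
        using chart_boundary[OF t i(1), of "1 + y"] z(2) ry(3) False by (auto simp: reversepath_def)
      then show ?thesis using False \<open>y \<noteq> 0\<close> ry(3) edge_reverse[OF walk_edge[OF t i(1)]] cycle[OF t i(1)]
        unfolding i(2) by (intro bexI[of _ "reversepath (B t ! i)"] exI[of _ "- y"]) auto
    qed
  qed
  have XY: "x = v" if xXY: "x \<in> X" "x \<in> Y" for x
  proof (rule ccontr)
    assume "x \<noteq> v"
    obtain t j t' j' where k: "(t, j) \<in> K" "B t ! j \<in> C" "x \<in> W (t, j)"
      and k': "(t', j') \<in> K" "B t' ! j' \<notin> C" "x \<in> W (t', j')"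
      using xXY unfolding X_def Y_def by blast
    show False
    proof (cases "x \<in> skeleton")
      case True
      obtain \<delta> u where d: "\<delta> \<in> \<Gamma>" "0 < u" "u \<le> 1/4" "x = \<delta> u" "\<delta> \<in> C"
        using edge_point[OF k(1,3) True \<open>x \<noteq> v\<close>] k(2) by blast
      obtain \<delta>' u' where d': "\<delta>' \<in> \<Gamma>" "0 < u'" "u' \<le> 1/4" "x = \<delta>' u'" "\<delta>' \<notin> C"
        using edge_point[OF k'(1,3) True \<open>x \<noteq> v\<close>] k'(2) by blast
      \<comment> \<open>Either both points lie on the same edge, which cannot be inside and outside
        \<open>C\<close>, or \<open>u' = 1 - u\<close>, which is impossible as both are at most
        1/4.\<close>
      show False using edge_inner_eq[OF d(1) d'(1), of u u'] d d' by auto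
    next
      case False
      obtain z where z: "z \<in> cap (length (B t)) j" "x = chart t z" using k(3) by (auto simp: W_def)
      obtain z' where z': "z' \<in> cap (length (B t')) j'" "x = chart t' z'" using k'(3) by (auto simp: W_def)
      have t: "t \<in> tiles S \<Gamma>" "t' \<in> tiles S \<Gamma>" and j: "j < length (B t)" "j' < length (B t')"
        using k k' by (auto simp: K_def)
      have b: "z \<in> ball 0 1" "z' \<in> ball 0 1"
        using chart_in_skeleton_iff[OF t(1), of z] chart_in_skeleton_iff[OF t(2), of z'] False z z'
        by (auto simp: cap_def)
      then have "x \<in> t" "x \<in> t'" using chart_ball t z z' by blast+
      then have tt: "t = t'" using tile_disjoint t by blast
      then have "z = z'" using chart_inj[OF t(1)] b z z' by (metis inj_onD)
      then have "j = j'" using cap_disjoint[of "length (B t)" z j j'] walk_length[OF t(1)] z z' j tt by auto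
      then show False using k(2) k'(2) tt by simp
    qed
  qed
  \<comment> \<open>\<open>M t\<close> is the closed disk without the open caps at the corners at
    \<open>v\<close>. Its image is compact and misses \<open>v\<close>; removing these images leaves
    a neighbourhood of \<open>v\<close> covered by \<open>X\<close> and \<open>Y\<close>.\<close>
  define M where "M t = cball 0 1 - (\<Union>j\<in>{j. (t, j) \<in> K}. {z. polar (length (B t)) 1 (real j) \<bullet> z > cos (pi / (2 * real (length (B t))))})" for t
  have cM: "closed (chart t ` M t)" if t: "t \<in> tiles S \<Gamma>" for t
  proof -
    have "compact (M t)" unfolding M_def by (intro compact_diff compact_cball open_UN ballI open_halfspace_gt)
    then have "compact (chart t ` M t)"
      by (intro compact_continuous_image continuous_on_subset[OF chart_continuous[OF t]]) (auto simp: M_def)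
    then show ?thesis by (rule compact_imp_closed)
  qed
  have vM: "v \<notin> chart t ` M t" if t: "t \<in> tiles S \<Gamma>" for t
  proof
    assume "v \<in> chart t ` M t"
    then obtain z where z: "z \<in> M t" "v = chart t z" by blast
    then have "norm z = 1" using chart_in_skeleton_iff[OF t, of z] vert vertices_in_skeleton by (auto simp: M_def)
    then obtain j s where js: "j < length (B t)" "s \<in> {0..<1}" "z = polar (length (B t)) 1 (real j + s)" "v = (B t ! j) s"
      using chart_sphere[OF t] z(2) by metis
    have "s = 0" using edge_inner_not_vertex[OF walk_edge[OF t js(1)], of s] js vert by fastforce
    then have "(t, j) \<in> K" using js t by (simp add: K_def pathstart_def)
    moreover have "cos (pi / (2 * real (length (B t)))) < 1"
    proof -
      have n: "2 * real (length (B t)) \<ge> 1" using walk_length[OF t] by linarith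
      then have "0 < pi / (2 * real (length (B t)))" by (intro divide_pos_pos) (simp, linarith)
      moreover have "pi / (2 * real (length (B t))) \<le> pi / 1" using n by (intro divide_left_mono) auto
      ultimately show ?thesis using cos_monotone_0_pi[of 0 "pi / (2 * real (length (B t)))"] by simp
    qed
    then have "polar (length (B t)) 1 (real j) \<bullet> z > cos (pi / (2 * real (length (B t))))"
      using js(3) \<open>s = 0\<close> by (simp add: inner_polar_polar polar_mult_polar) (simp add: polar_def)
    ultimately show False using z(1) by (auto simp: M_def)
  qed
  define U where "U = S - (\<Union>t\<in>tiles S \<Gamma>. chart t ` M t)"
  have vS: "v \<in> S" using vert edge_in_surface unfolding vertices_def by auto
  have "openin (top_of_set S) U"
  proof -
    have "closed (\<Union>t\<in>tiles S \<Gamma>. chart t ` M t)" using finite_tiles cM by blast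
    moreover have "U = S \<inter> (- (\<Union>t\<in>tiles S \<Gamma>. chart t ` M t))" unfolding U_def by blast
    ultimately show ?thesis unfolding openin_open by blast
  qed
  moreover have "v \<in> U" unfolding U_def using vS vM by blast
  ultimately obtain V where V: "openin (top_of_set S) V" "v \<in> V" "V \<subseteq> U" "connected (V - {v})"
    using homeomorphic_disk_punctured_neighbourhood[OF S] by metis
  have "U \<subseteq> X \<union> Y"
  proof
    fix x assume x: "x \<in> U"
    have "x \<in> S" using x unfolding U_def by (rule DiffD1)
    then obtain t z where t: "t \<in> tiles S \<Gamma>" "z \<in> cball 0 1" "x = chart t z"
      using subsetD[OF surface_covered] by blast
    then have "z \<notin> M t" using x unfolding U_def by blast
    then obtain j where "(t, j) \<in> K" "z \<in> cap (length (B t)) j"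
      using t(2) unfolding M_def cap_def by force
    then have "(t, j) \<in> K" "x \<in> W (t, j)" using t by (auto simp: W_def)
    then show "x \<in> X \<union> Y" unfolding X_def Y_def by blast
  qed
  moreover have "X \<inter> Y \<inter> (V - {v}) = {}" using XY by blast
  ultimately have "X \<inter> (V - {v}) = {} \<or> Y \<inter> (V - {v}) = {}"
    using V by (intro connected_closedD[OF V(4) _ _ cX cY]) auto
  moreover have "\<exists>t j. (t, j) \<in> K \<and> B t ! j = \<delta> \<and> W (t, j) \<inter> (V - {v}) \<noteq> {}"
    if d: "\<delta> \<in> \<Gamma>" "pathstart \<delta> = v" for \<delta>
  proof -
    obtain t j where t: "t \<in> tiles S \<Gamma>" and j: "j < length (B t)" and Bt: "B t ! j = \<delta>"
      using walk_cover[OF d(1)] by blast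
    obtain V' where V': "open V'" "V = S \<inter> V'" using V(1) unfolding openin_open by blast
    have "continuous_on {0..1} \<delta>" using edge_simple[OF d(1)] unfolding simple_path_def path_def by blast
    moreover have "\<delta> 0 \<in> V'" using d(2) V(2) V' by (simp add: pathstart_def)
    ultimately obtain O' where O': "open O'" "0 \<in> O'" "\<And>s. s \<in> {0..1} \<Longrightarrow> s \<in> O' \<Longrightarrow> \<delta> s \<in> V'"
      using V'(1) unfolding continuous_on_topological by (metis atLeastAtMost_iff order_refl zero_le_one)
    then obtain e where e: "e > 0" "ball 0 e \<subseteq> O'" using open_contains_ball by blast
    \<comment> \<open>Below \<open>e\<close> to stay in \<open>V\<close>, at most 1/4 to stay in the
      cap.\<close>
    define s where "s = min (e/2) (1/4)"
    have s: "0 < s" "s \<le> 1/4" "s < e" using e(1) by (auto simp: s_def)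
    have "\<delta> s \<in> V'" using O'(3)[of s] s subsetD[OF e(2), of s] by auto
    moreover have "\<delta> s \<in> S" using edge_in_surface[OF d(1)] s unfolding path_image_def by auto
    moreover have "\<delta> s \<noteq> v" using edge_inner_not_vertex[OF d(1), of s] s vert by auto
    moreover have "\<delta> s \<in> W (t, j)"
      using chart_boundary[OF t j, of s] polar_in_cap[of "length (B t)" s j] walk_length[OF t] s Bt
      unfolding W_def by (auto intro!: image_eqI)
    ultimately show ?thesis using t j Bt d V' by (intro exI[of _ t] exI[of _ j]) (auto simp: K_def)
  qed
  ultimately show False
    using \<delta> unfolding X_def Y_def by blast
qed

end

context oriented_tiled
begin

text \<open>The edge at which the walk turns back is both sides of its corner. As each directed edge
  has only one place in the walks, no other corner has it as a side, so the singleton already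
  satisfies the condition of \<open>single_cycle_at_vertex\<close>.\<close>

lemma walk_not_backtracking:
  assumes S: "closed_surface S" and t: "t \<in> tiles S \<Gamma>" and j: "j < length (B t)"
  shows "B t ! (Suc j mod length (B t)) \<noteq> reversepath (B t ! j)"
proof
  let ?\<gamma> = "B t ! j"
  assume eq: "B t ! (Suc j mod length (B t)) = reversepath ?\<gamma>"
  have \<gamma>: "?\<gamma> \<in> \<Gamma>" using walk_edge t j by blast
  have "{reversepath ?\<gamma>} = {\<delta>\<in>\<Gamma>. pathstart \<delta> = pathfinish ?\<gamma>}"
  proof (rule single_cycle_at_vertex[OF S])
    show "{reversepath ?\<gamma>} \<subseteq> {\<delta>\<in>\<Gamma>. pathstart \<delta> = pathfinish ?\<gamma>}" using edge_reverse[OF \<gamma>] by simp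
    fix t' j' assume t': "t' \<in> tiles S \<Gamma>" and j': "j' < length (B t')"
    let ?n = "length (B t)" and ?n' = "length (B t')"
    have less: "Suc j mod ?n < ?n" "Suc j' mod ?n' < ?n'" using walk_length[OF t] walk_length[OF t'] by (auto intro!: mod_less_divisor)
    show "B t' ! (Suc j' mod ?n') \<in> {reversepath ?\<gamma>} \<longleftrightarrow> reversepath (B t' ! j') \<in> {reversepath ?\<gamma>}"
    proof
      assume "B t' ! (Suc j' mod ?n') \<in> {reversepath ?\<gamma>}"
      then have "t' = t \<and> Suc j' mod ?n' = Suc j mod ?n"
        using walk_unique[OF t' less(2) t less(1)] eq by (metis singletonD)
      then have "t' = t" "j' = j" using j j' by (auto simp: mod_Suc split: if_splits)
      then show "reversepath (B t' ! j') \<in> {reversepath ?\<gamma>}" by simp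
    next
      assume "reversepath (B t' ! j') \<in> {reversepath ?\<gamma>}"
      then have "B t' ! j' = ?\<gamma>" by (metis reversepath_reversepath singletonD)
      then show "B t' ! (Suc j' mod ?n') \<in> {reversepath ?\<gamma>}"
        using walk_unique[OF t' j' t j] eq by auto
    qed
  qed simp
  then have "vertex_degree \<Gamma> (pathfinish ?\<gamma>) = card {reversepath ?\<gamma>}" unfolding vertex_degree_def by simp
  then show False using degree_ge_3[OF pathfinish_in_vertices[OF \<gamma>]] by simp
qed

text \<open>Away from vertices a walk can meet itself only by containing an edge together with its
  reverse. With distinct vertices each of these two sides would have to follow the other, which is
  impossible in a walk of length at least 3.\<close>

lemma nondegenerate_iff:
  assumes t: "t \<in> tiles S \<Gamma>"
  shows "nondegenerate (B t) \<longleftrightarrow> distinct (map pathstart (B t))"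
proof
  assume nd: "nondegenerate (B t)"
  show "distinct (map pathstart (B t))"
    unfolding distinct_conv_nth
  proof (intro allI impI)
    fix i j assume "i < length (map pathstart (B t))" "j < length (map pathstart (B t))" "i \<noteq> j"
    then show "map pathstart (B t) ! i \<noteq> map pathstart (B t) ! j"
      using inj_onD[OF nd[unfolded nondegenerate_def], of "(i, 0)" "(j, 0)"] by (auto simp: pathstart_def)
  qed
next
  assume dist: "distinct (map pathstart (B t))"
  let ?n = "length (B t)"
  have n: "?n \<ge> 3" by (rule walk_length[OF t])
  have start: "i = j" if "i < ?n" "j < ?n" "pathstart (B t ! i) = pathstart (B t ! j)" for i j
    using dist that unfolding distinct_conv_nth by auto
  have inner: "j = i \<and> u = s"
    if "j < ?n" "i < ?n" "s \<in> {0<..<1}" "u \<in> {0..<1}" and eq: "(B t ! j) s = (B t ! i) u" for i j s u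
  proof -
    have jS: "Suc j mod ?n < ?n" "Suc i mod ?n < ?n" using n by (auto intro!: mod_less_divisor)
    have "B t ! i \<noteq> reversepath (B t ! j)"
    proof
      assume rev: "B t ! i = reversepath (B t ! j)"
      have "i = Suc j mod ?n"
        using start[OF that(2) jS(1)] walk_joint[OF t that(1)] rev by simp
      moreover have "j = Suc i mod ?n"
        using start[OF that(1) jS(2)] walk_joint[OF t that(2)] rev by simp
      ultimately show False using n that(1,2) by (auto simp: mod_Suc split: if_splits)
    qed
    then have "B t ! i = B t ! j \<and> u = s"
      using edge_inner_eq[OF walk_edge[OF t that(1)] walk_edge[OF t that(2)] that(3), of u] eq that(4) by auto
    then show ?thesis using walk_unique[OF t that(2) t that(1)] by auto
  qed
  show "nondegenerate (B t)"
    unfolding nondegenerate_def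
  proof (rule inj_onI)
    fix x y assume xy: "x \<in> {..<?n} \<times> {0..<1}" "y \<in> {..<?n} \<times> {0..<1}"
      "(\<lambda>(j, s). (B t ! j) s) x = (\<lambda>(j, s). (B t ! j) s) y"
    obtain j i :: nat and s u :: real where x: "x = (j, s)" and y: "y = (i, u)" by fastforce
    have *: "j \<in> {..<?n}" "s \<in> {0..<1}" "i \<in> {..<?n}" "u \<in> {0..<1}" "(B t ! j) s = (B t ! i) u"
      using xy by (auto simp: x y)
    consider "s > 0" | "u > 0" | "s = 0" "u = 0" using * by force
    then have "j = i \<and> s = u"
    proof cases
      case 1 then show ?thesis using inner[of j i s u] * by auto
    next
      case 2 then show ?thesis using inner[of i j u s] * by auto
    next
      case 3 then show ?thesis using start[of j i] * by (auto simp: pathstart_def)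
    qed
    then show "x = y" by (simp add: x y)
  qed
qed

text \<open>A loop and its reverse have the same course; this is why closed edges are
  excluded.\<close>

lemma course_eqD:
  assumes "\<gamma> \<in> \<Gamma>" "\<delta> \<in> \<Gamma>" "course \<gamma> = course \<delta>" "pathstart \<gamma> \<noteq> pathfinish \<gamma>"
  shows "\<gamma> = \<delta>"
proof -
  have "\<gamma> (1/2) \<in> path_image \<delta>" using assms(3) unfolding course_def path_image_def by auto
  then obtain u where "u \<in> {0..1}" "\<gamma> (1/2) = \<delta> u" unfolding path_image_def by blast
  then have "\<delta> = \<gamma> \<or> \<delta> = reversepath \<gamma>" using edge_inner_eq[OF assms(1,2), of "1/2" u] by auto
  moreover have "pathstart \<gamma> = pathstart \<delta>" using assms(3) unfolding course_def by blast
  ultimately show ?thesis using assms(4) by (metis pathstart_reversepath)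
qed

end

section \<open>The labels of a pentagonal subdivision\<close>

locale subdivided_tiling = oriented_tiled S \<Gamma> B
  for S :: "'a::t2_space set" and \<Gamma> B +
  fixes a c spoke
  assumes data: "subdivision_data S \<Gamma> B a c spoke"
begin

abbreviation (input) dividing :: "(real \<Rightarrow> 'a) \<Rightarrow> 'a" where "dividing \<gamma> \<equiv> \<gamma> (a \<gamma>)"

definition segments :: "(real \<Rightarrow> 'a) set" where
  "segments = (\<Union>\<gamma>\<in>\<Gamma>. {first_segment a \<gamma>, middle_segment a \<gamma>, last_segment a \<gamma>, spoke \<gamma>, reversepath (spoke \<gamma>)})"

lemma parameter_bounds:
  assumes "\<gamma> \<in> \<Gamma>"
  shows "0 < a \<gamma>" "a \<gamma> < 1 - a (reversepath \<gamma>)" "0 < a (reversepath \<gamma>)"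
  using data assms edge_reverse unfolding subdivision_data_def by blast+

text \<open>If \<delta> were the reverse of \<gamma>, their parameters would add up to 1, whereas
  \<open>a \<gamma> + a (reversepath \<gamma>) < 1\<close>.\<close>

lemma dividing_eqD:
  assumes "\<gamma> \<in> \<Gamma>" "\<delta> \<in> \<Gamma>" "dividing \<gamma> = dividing \<delta>"
  shows "\<gamma> = \<delta>"
  using edge_inner_eq[OF assms(1,2), of "a \<gamma>" "a \<delta>"] assms(3)
    parameter_bounds[OF assms(1)] parameter_bounds[OF assms(2)] by auto

lemma dividing_reverse: "\<gamma> (1 - a (reversepath \<gamma>)) = dividing (reversepath \<gamma>)"
  by (simp add: reversepath_def)

lemma dividing_not_vertex: "\<gamma> \<in> \<Gamma> \<Longrightarrow> dividing \<gamma> \<notin> vertices \<Gamma>"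
  using edge_inner_not_vertex[of \<gamma> "a \<gamma>"] parameter_bounds[of \<gamma>] by simp

lemma center_not_in_skeleton: "t \<in> tiles S \<Gamma> \<Longrightarrow> c t \<notin> skeleton"
  using data tile_subset unfolding subdivision_data_def by blast

lemma center_neq_vertex: "t \<in> tiles S \<Gamma> \<Longrightarrow> v \<in> vertices \<Gamma> \<Longrightarrow> c t \<noteq> v"
  using center_not_in_skeleton vertices_in_skeleton by blast

lemma center_neq_dividing: "t \<in> tiles S \<Gamma> \<Longrightarrow> \<gamma> \<in> \<Gamma> \<Longrightarrow> c t \<noteq> dividing \<gamma>"
proof -
  assume "t \<in> tiles S \<Gamma>" and \<gamma>: "\<gamma> \<in> \<Gamma>"
  moreover have "dividing \<gamma> \<in> skeleton" using parameter_bounds[OF \<gamma>] by (intro edge_in_skeleton[OF \<gamma>]) auto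
  ultimately show "c t \<noteq> dividing \<gamma>" using center_not_in_skeleton by metis
qed

lemma segment_ends:
  "pathstart (first_segment a \<gamma>) = pathstart \<gamma>" "pathfinish (first_segment a \<gamma>) = dividing \<gamma>"
  "pathstart (middle_segment a \<gamma>) = dividing \<gamma>" "pathfinish (middle_segment a \<gamma>) = dividing (reversepath \<gamma>)"
  "pathstart (last_segment a \<gamma>) = dividing (reversepath \<gamma>)" "pathfinish (last_segment a \<gamma>) = pathfinish \<gamma>"
  by (simp_all add: first_segment_def middle_segment_def last_segment_def pathstart_def pathfinish_def
      linepath_def dividing_reverse)

lemma spoke_ends:
  assumes "t \<in> tiles S \<Gamma>" "j < length (B t)"
  shows "pathstart (spoke (B t ! j)) = c t" "pathfinish (spoke (B t ! j)) = dividing (B t ! j)"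
  using data assms unfolding subdivision_data_def by auto

lemma spoke_cover:
  assumes "\<gamma> \<in> \<Gamma>"
  obtains t where "t \<in> tiles S \<Gamma>" "pathstart (spoke \<gamma>) = c t" "pathfinish (spoke \<gamma>) = dividing \<gamma>"
  using walk_cover[OF assms] spoke_ends that by metis

text \<open>This also covers loops of the old tiling: their pieces are not closed, so courses
  suffice to identify the edges of the subdivision.\<close>

lemma segment_not_closed:
  assumes "f \<in> segments"
  shows "pathstart f \<noteq> pathfinish f"
proof -
  obtain \<gamma> where \<gamma>: "\<gamma> \<in> \<Gamma>" and f: "f \<in> {first_segment a \<gamma>, middle_segment a \<gamma>, last_segment a \<gamma>, spoke \<gamma>, reversepath (spoke \<gamma>)}"
    using assms unfolding segments_def by blast
  have r: "reversepath \<gamma> \<in> \<Gamma>" using edge_reverse \<gamma> .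
  obtain t where t: "t \<in> tiles S \<Gamma>" "pathstart (spoke \<gamma>) = c t" "pathfinish (spoke \<gamma>) = dividing \<gamma>"
    using spoke_cover[OF \<gamma>] .
  have "dividing \<gamma> \<noteq> dividing (reversepath \<gamma>)"
    using dividing_eqD[OF \<gamma> r] reversepath_neq[OF edge_simple[OF \<gamma>]] by metis
  moreover have "pathstart \<gamma> \<noteq> dividing \<gamma>" "pathfinish \<gamma> \<noteq> dividing (reversepath \<gamma>)"
    using dividing_not_vertex[OF \<gamma>] dividing_not_vertex[OF r] pathstart_in_vertices[OF \<gamma>] pathfinish_in_vertices[OF \<gamma>]
    by metis+
  moreover have "c t \<noteq> dividing \<gamma>" using center_neq_dividing[OF t(1) \<gamma>] .
  ultimately show ?thesis using f t(2,3) by (auto simp: segment_ends)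
qed

text \<open>The piece from the dividing point back to the old vertex is represented by the last
  segment of the reversed edge, not by a reversed first segment.\<close>

lemma segments_at_dividing:
  assumes \<gamma>: "\<gamma> \<in> \<Gamma>"
  shows "{f\<in>segments. pathstart f = dividing \<gamma>} =
     {middle_segment a \<gamma>, last_segment a (reversepath \<gamma>), reversepath (spoke \<gamma>)}"
proof (intro equalityI subsetI)
  fix f assume "f \<in> {f\<in>segments. pathstart f = dividing \<gamma>}"
  then obtain \<delta> where \<delta>: "\<delta> \<in> \<Gamma>" and start: "pathstart f = dividing \<gamma>"
    and f: "f \<in> {first_segment a \<delta>, middle_segment a \<delta>, last_segment a \<delta>, spoke \<delta>, reversepath (spoke \<delta>)}"
    unfolding segments_def by blast
  obtain t where t: "t \<in> tiles S \<Gamma>" "pathstart (spoke \<delta>) = c t" "pathfinish (spoke \<delta>) = dividing \<delta>"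
    using spoke_cover[OF \<delta>] .
  consider "f = first_segment a \<delta>" | "f = middle_segment a \<delta>" | "f = last_segment a \<delta>"
    | "f = spoke \<delta>" | "f = reversepath (spoke \<delta>)" using f by blast
  then show "f \<in> {middle_segment a \<gamma>, last_segment a (reversepath \<gamma>), reversepath (spoke \<gamma>)}"
  proof cases
    case 1
    then show ?thesis using start dividing_not_vertex[OF \<gamma>] pathstart_in_vertices[OF \<delta>] by (simp add: segment_ends)
  next
    case 2
    then show ?thesis using start dividing_eqD[OF \<gamma> \<delta>] by (simp add: segment_ends)
  next
    case 3
    then have "\<gamma> = reversepath \<delta>" using start dividing_eqD[OF \<gamma> edge_reverse[OF \<delta>]] by (simp add: segment_ends)
    then show ?thesis using 3 by simp
  next
    case 4
    then show ?thesis using start t center_neq_dividing[OF t(1) \<gamma>] by simp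
  next
    case 5
    then show ?thesis using start t dividing_eqD[OF \<gamma> \<delta>] by simp
  qed
next
  fix f assume f: "f \<in> {middle_segment a \<gamma>, last_segment a (reversepath \<gamma>), reversepath (spoke \<gamma>)}"
  have "f \<in> segments" using f \<gamma> edge_reverse[OF \<gamma>] unfolding segments_def by blast
  moreover obtain t where t: "t \<in> tiles S \<Gamma>" "pathstart (spoke \<gamma>) = c t" "pathfinish (spoke \<gamma>) = dividing \<gamma>"
    using spoke_cover[OF \<gamma>] .
  ultimately show "f \<in> {f\<in>segments. pathstart f = dividing \<gamma>}" using f by (auto simp: segment_ends)
qed

end

section \<open>Tiles and degrees of the subdivision, read off from the courses\<close>

locale pentagonally_subdivided = subdivided_tiling S \<Gamma> B a c spoke + sub: oriented_tiled S \<Gamma>' B'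
  for S :: "'a::t2_space set" and \<Gamma> B a c spoke \<Gamma>' B' +
  assumes surface: "closed_surface S"
    and courses: "course ` \<Gamma>' = course ` segments"
    and pentagons: "\<And>t j. \<lbrakk>t \<in> tiles S \<Gamma>; j < length (B t)\<rbrakk> \<Longrightarrow> \<exists>p\<in>tiles S \<Gamma>'. \<exists>k.
        map course (rotate k (B' p)) =
        map course (subdivision_pentagon a spoke (B t ! j) (B t ! (Suc j mod length (B t))))"
begin

text \<open>The edges in \<Gamma>' are given only through their courses; by injectivity they can be
  counted and identified in this way.\<close>

lemma course_inj: "inj_on course \<Gamma>'"
proof (rule inj_onI)
  fix e f assume ef: "e \<in> \<Gamma>'" "f \<in> \<Gamma>'" "course e = course f"
  then obtain g where "g \<in> segments" "course e = course g" using courses by blast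
  then have "pathstart e \<noteq> pathfinish e" using segment_not_closed[of g] by (simp add: course_def)
  then show "e = f" using sub.course_eqD ef by blast
qed

lemma degree_dividing:
  assumes \<gamma>: "\<gamma> \<in> \<Gamma>"
  shows "vertex_degree \<Gamma>' (dividing \<gamma>) = 3"
proof -
  have start: "pathstart e = fst (snd (course e))" for e :: "real \<Rightarrow> 'a" by (simp add: course_def)
  have "vertex_degree \<Gamma>' (dividing \<gamma>) = card (course ` {e\<in>\<Gamma>'. pathstart e = dividing \<gamma>})"
    unfolding vertex_degree_def
    by (rule card_image[symmetric]) (rule inj_on_subset[OF course_inj], blast)
  also have "course ` {e\<in>\<Gamma>'. pathstart e = dividing \<gamma>} = {k \<in> course ` \<Gamma>'. fst (snd k) = dividing \<gamma>}"
    using start by auto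
  also have "\<dots> = course ` {f\<in>segments. pathstart f = dividing \<gamma>}"
    unfolding courses using start by auto
  also have "\<dots> = {course (middle_segment a \<gamma>), course (last_segment a (reversepath \<gamma>)), course (reversepath (spoke \<gamma>))}"
    unfolding segments_at_dividing[OF \<gamma>] by simp
  also have "card \<dots> = 3"
  proof -
    obtain t where t: "t \<in> tiles S \<Gamma>" "pathstart (spoke \<gamma>) = c t" "pathfinish (spoke \<gamma>) = dividing \<gamma>"
      using spoke_cover[OF \<gamma>] .
    \<comment> \<open>The three courses start at the same point and are told apart by their other
      ends.\<close>
    have "dividing (reversepath \<gamma>) \<noteq> pathstart \<gamma>" "c t \<noteq> pathstart \<gamma>" "c t \<noteq> dividing (reversepath \<gamma>)"
      using dividing_not_vertex[OF edge_reverse[OF \<gamma>]] pathstart_in_vertices[OF \<gamma>] center_neq_vertex[OF t(1)]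
        center_neq_dividing[OF t(1) edge_reverse[OF \<gamma>]] by metis+
    then have "course (middle_segment a \<gamma>) \<noteq> course (last_segment a (reversepath \<gamma>))"
      "course (middle_segment a \<gamma>) \<noteq> course (reversepath (spoke \<gamma>))"
      "course (last_segment a (reversepath \<gamma>)) \<noteq> course (reversepath (spoke \<gamma>))"
      unfolding course_def using t by (auto simp: segment_ends)
    then show ?thesis by simp
  qed
  finally show ?thesis .
qed

lemma pentagon_of_segment:
  assumes "f \<in> segments"
  obtains t j where "t \<in> tiles S \<Gamma>" "j < length (B t)"
    "f \<in> set (subdivision_pentagon a spoke (B t ! j) (B t ! (Suc j mod length (B t))))"
proof -
  obtain \<gamma> where \<gamma>: "\<gamma> \<in> \<Gamma>" and f: "f \<in> {first_segment a \<gamma>, middle_segment a \<gamma>, last_segment a \<gamma>, spoke \<gamma>, reversepath (spoke \<gamma>)}"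
    using assms unfolding segments_def by blast
  obtain t j where t: "t \<in> tiles S \<Gamma>" and j: "j < length (B t)" and Bt: "B t ! j = \<gamma>"
    using walk_cover[OF \<gamma>] .
  \<comment> \<open>The first segment and the reversed spoke of \<gamma> lie on the pentagon in
    which \<gamma> is the second of the two edges, so they require the preceding index.\<close>
  define i where "i = (if j = 0 then length (B t) - 1 else j - 1)"
  have i: "i < length (B t)" "Suc i mod length (B t) = j" using j by (auto simp: i_def)
  consider "f \<in> {spoke \<gamma>, middle_segment a \<gamma>, last_segment a \<gamma>}" | "f \<in> {first_segment a \<gamma>, reversepath (spoke \<gamma>)}"
    using f by blast
  then show thesis
  proof cases
    case 1
    then show thesis using Bt by (intro that[OF t j]) (auto simp: subdivision_pentagon_def)
  next
    case 2
    then show thesis using Bt i(2) by (intro that[OF t i(1)]) (auto simp: subdivision_pentagon_def)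
  qed
qed

text \<open>The assumption \<open>pentagons\<close> only makes every described pentagon a tile. For
  the converse, one side of \<open>p\<close> has the course of a segment, the segment lies on a
  described pentagon, and a directed edge belongs to one tile only.\<close>

lemma tile_is_pentagon:
  assumes p: "p \<in> tiles S \<Gamma>'"
  obtains t j k where "t \<in> tiles S \<Gamma>" "j < length (B t)"
    "map course (rotate k (B' p)) =
     map course (subdivision_pentagon a spoke (B t ! j) (B t ! (Suc j mod length (B t))))"
proof -
  have i: "0 < length (B' p)" using sub.walk_length[OF p] by linarith
  have e: "B' p ! 0 \<in> \<Gamma>'" using sub.walk_edge[OF p i] .
  then obtain f where f: "f \<in> segments" "course (B' p ! 0) = course f" using courses by blast
  obtain t j where t: "t \<in> tiles S \<Gamma>" and j: "j < length (B t)"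
    and fp: "f \<in> set (subdivision_pentagon a spoke (B t ! j) (B t ! (Suc j mod length (B t))))"
    using pentagon_of_segment[OF f(1)] .
  obtain p' k where p': "p' \<in> tiles S \<Gamma>'" and k: "map course (rotate k (B' p')) =
        map course (subdivision_pentagon a spoke (B t ! j) (B t ! (Suc j mod length (B t))))"
    using pentagons[OF t j] by blast
  have "course f \<in> set (map course (rotate k (B' p')))" using fp unfolding k by simp
  then obtain i' where i': "i' < length (B' p')" "course f = course (B' p' ! i')"
    by (auto simp: in_set_conv_nth)
  then have "B' p ! 0 = B' p' ! i'"
    using inj_onD[OF course_inj _ e sub.walk_edge[OF p' i'(1)]] f(2) by simp
  then have "p = p'" using sub.walk_unique[OF p i p' i'(1)] by blast
  then show thesis using that[OF t j] k by blast
qed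

lemma tile_vertices:
  assumes p: "p \<in> tiles S \<Gamma>'"
  obtains t \<gamma> \<delta> k where "t \<in> tiles S \<Gamma>" "\<gamma> \<in> \<Gamma>" "\<delta> \<in> \<Gamma>" "\<gamma> \<noteq> \<delta>" "\<delta> \<noteq> reversepath \<gamma>"
    "map pathstart (rotate k (B' p)) =
      [pathstart \<delta>, dividing \<delta>, c t, dividing \<gamma>, dividing (reversepath \<gamma>)]"
proof -
  obtain t j k where t: "t \<in> tiles S \<Gamma>" and j: "j < length (B t)" and
    k: "map course (rotate k (B' p)) =
     map course (subdivision_pentagon a spoke (B t ! j) (B t ! (Suc j mod length (B t))))"
    using tile_is_pentagon[OF p] .
  let ?\<gamma> = "B t ! j" and ?\<delta> = "B t ! (Suc j mod length (B t))"
  have n: "length (B t) \<ge> 3" using walk_length[OF t] .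
  then have i: "Suc j mod length (B t) < length (B t)" by (intro mod_less_divisor) linarith
  have "?\<gamma> \<noteq> ?\<delta>" using walk_unique[OF t j t i] n j by (auto simp: mod_Suc split: if_splits)
  have start: "map pathstart es = map (fst \<circ> snd) (map course es)" for es :: "(real \<Rightarrow> 'a) list"
    by (simp add: course_def)
  have "map pathstart (rotate k (B' p)) = map pathstart (subdivision_pentagon a spoke ?\<gamma> ?\<delta>)"
    unfolding start k ..
  also have "\<dots> = [c t, dividing ?\<gamma>, dividing (reversepath ?\<gamma>), pathstart ?\<delta>, dividing ?\<delta>]"
    using spoke_ends[OF t j] spoke_ends[OF t i] by (simp add: subdivision_pentagon_def segment_ends)
  finally have k': "map pathstart (rotate k (B' p)) = \<dots>" .
  \<comment> \<open>\<open>subdivision_pentagon\<close> starts at the center; three sides further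
    comes the old vertex, where the pattern starts.\<close>
  have "map pathstart (rotate (3 + k) (B' p)) = rotate 3 (map pathstart (rotate k (B' p)))"
    by (simp only: rotate_map rotate_rotate)
  also have "\<dots> = [pathstart ?\<delta>, dividing ?\<delta>, c t, dividing ?\<gamma>, dividing (reversepath ?\<gamma>)]"
    unfolding k' by (simp add: eval_nat_numeral)
  finally show thesis
    by (rule that[OF t walk_edge[OF t j] walk_edge[OF t i] \<open>?\<gamma> \<noteq> ?\<delta>\<close> walk_not_backtracking[OF surface t j]])
qed

text \<open>Old vertices, centers and dividing points are points of different kinds, and the three
  dividing points differ because \<gamma>, its reverse and \<delta> are three different directed
  edges.\<close>

lemma tiles_nondegenerate:
  assumes p: "p \<in> tiles S \<Gamma>'"
  shows "nondegenerate (B' p)"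
proof -
  obtain t \<gamma> \<delta> k where t: "t \<in> tiles S \<Gamma>" and g: "\<gamma> \<in> \<Gamma>" "\<delta> \<in> \<Gamma>" "\<gamma> \<noteq> \<delta>" "\<delta> \<noteq> reversepath \<gamma>"
    and k: "map pathstart (rotate k (B' p)) =
      [pathstart \<delta>, dividing \<delta>, c t, dividing \<gamma>, dividing (reversepath \<gamma>)]"
    using tile_vertices[OF p] .
  note r = edge_reverse[OF g(1)]
  have "pathstart \<delta> \<notin> {dividing \<delta>, c t, dividing \<gamma>, dividing (reversepath \<gamma>)}"
    using dividing_not_vertex[OF g(1)] dividing_not_vertex[OF g(2)] dividing_not_vertex[OF r]
      center_neq_vertex[OF t pathstart_in_vertices[OF g(2)]] pathstart_in_vertices[OF g(2)] by force
  moreover have "c t \<notin> {dividing \<delta>, dividing \<gamma>, dividing (reversepath \<gamma>)}"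
    using center_neq_dividing[OF t] g r by blast
  moreover have "dividing \<delta> \<noteq> dividing \<gamma>" "dividing \<delta> \<noteq> dividing (reversepath \<gamma>)" "dividing \<gamma> \<noteq> dividing (reversepath \<gamma>)"
    using dividing_eqD[OF g(1,2)] dividing_eqD[OF r g(2)] dividing_eqD[OF g(1) r] g
      reversepath_neq[OF edge_simple[OF g(1)]] by metis+
  ultimately have "distinct (map pathstart (rotate k (B' p)))" unfolding k by auto
  then have "distinct (map pathstart (B' p))" by (simp flip: rotate_map)
  then show ?thesis using sub.nondegenerate_iff[OF p] by blast
qed

lemma pattern: "pattern_labelling S \<Gamma>' B' (vertices \<Gamma>) (c ` tiles S \<Gamma>)"
  unfolding pattern_labelling_def
proof (intro conjI ballI)
  have ends: "pathstart f \<in> vertices \<Gamma>'" if "f \<in> segments" for f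
  proof -
    have "course f \<in> course ` \<Gamma>'" using that courses by blast
    then obtain e where "e \<in> \<Gamma>'" "course e = course f" by auto
    then show ?thesis using sub.pathstart_in_vertices[of e] by (simp add: course_def)
  qed
  show "vertices \<Gamma> \<subseteq> vertices \<Gamma>'"
  proof
    fix v assume "v \<in> vertices \<Gamma>"
    then obtain \<gamma> where "\<gamma> \<in> \<Gamma>" "v = pathstart (first_segment a \<gamma>)" unfolding vertices_def segment_ends by blast
    then show "v \<in> vertices \<Gamma>'" using ends unfolding segments_def by blast
  qed
  show "c ` tiles S \<Gamma> \<subseteq> vertices \<Gamma>'"
  proof clarify
    fix t assume t: "t \<in> tiles S \<Gamma>"
    then have j: "0 < length (B t)" using walk_length[OF t] by linarith
    have "spoke (B t ! 0) \<in> segments" using walk_edge[OF t j] unfolding segments_def by blast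
    then show "c t \<in> vertices \<Gamma>'" using ends spoke_ends[OF t j] by metis
  qed
  show "vertices \<Gamma> \<inter> c ` tiles S \<Gamma> = {}" using center_neq_vertex by blast
  fix p assume p: "p \<in> tiles S \<Gamma>'"
  obtain t \<gamma> \<delta> k where t: "t \<in> tiles S \<Gamma>" and g: "\<gamma> \<in> \<Gamma>" "\<delta> \<in> \<Gamma>"
    and k: "map pathstart (rotate k (B' p)) =
      [pathstart \<delta>, dividing \<delta>, c t, dividing \<gamma>, dividing (reversepath \<gamma>)]"
    using tile_vertices[OF p] by metis
  have unlabelled: "dividing \<epsilon> \<notin> vertices \<Gamma> \<and> dividing \<epsilon> \<notin> c ` tiles S \<Gamma> \<and> vertex_degree \<Gamma>' (dividing \<epsilon>) = 3"
    if "\<epsilon> \<in> \<Gamma>" for \<epsilon>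
    using dividing_not_vertex[OF that] degree_dividing[OF that] center_neq_dividing[OF _ that] by (metis imageE)
  have labels: "v \<notin> vertices \<Gamma> \<and> v \<notin> c ` tiles S \<Gamma> \<and> vertex_degree \<Gamma>' v = 3"
    if "v \<in> {dividing \<delta>, dividing \<gamma>, dividing (reversepath \<gamma>)}" for v
    using that unlabelled[OF g(1)] unlabelled[OF g(2)] unlabelled[OF edge_reverse[OF g(1)]]
    by (elim insertE) simp_all
  show "\<exists>k v0 v1 v2 v3 v4. map pathstart (rotate k (B' p)) = [v0, v1, v2, v3, v4] \<and>
      v0 \<in> vertices \<Gamma> \<and> v2 \<in> c ` tiles S \<Gamma> \<and>
      (\<forall>v\<in>{v1, v3, v4}. v \<notin> vertices \<Gamma> \<and> v \<notin> c ` tiles S \<Gamma> \<and> vertex_degree \<Gamma>' v = 3)"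
    by (intro exI) (rule conjI[OF k conjI[OF pathstart_in_vertices[OF g(2)] conjI[OF imageI[OF t] ballI[OF labels]]]])
qed

end

section \<open>The coarse tiling of a labelled pentagonal tiling\<close>

text \<open>A rotation only permutes the positions within one tile, and no walk has repeated
  entries, so the bijection with the directed edges persists. It allows the walks to be normalised
  to start at a bullet.\<close>

lemma (in oriented_tiled) oriented_tiling_rotate:
  "oriented_tiling S \<Gamma> (\<lambda>t. rotate (k t) (B t))"
proof -
  have dist: "distinct (B t)" if t: "t \<in> tiles S \<Gamma>" for t
    unfolding distinct_conv_nth using walk_unique[OF t _ t] by blast
  have "bij_betw (\<lambda>(t, j). rotate (k t) (B t) ! j) (SIGMA t:tiles S \<Gamma>. {..<length (B t)}) \<Gamma>"
    unfolding bij_betw_def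
  proof
    show "inj_on (\<lambda>(t, j). rotate (k t) (B t) ! j) (SIGMA t:tiles S \<Gamma>. {..<length (B t)})"
    proof (rule inj_onI, clarify)
      fix t j t' j'
      assume t: "t \<in> tiles S \<Gamma>" "t' \<in> tiles S \<Gamma>" and j: "j < length (B t)" "j' < length (B t')"
        and eq: "rotate (k t) (B t) ! j = rotate (k t') (B t') ! j'"
      have "rotate (k t) (B t) ! j \<in> set (B t)" "rotate (k t') (B t') ! j' \<in> set (B t')"
        using j by (metis length_rotate nth_mem set_rotate)+
      then have "t = t'" unfolding eq in_set_conv_nth using walk_unique t by metis
      then show "t = t' \<and> j = j'"
        using eq j dist[OF t(1)] by (metis distinct_rotate length_rotate nth_eq_iff_index_eq)
    qed
    show "(\<lambda>(t, j). rotate (k t) (B t) ! j) ` (SIGMA t:tiles S \<Gamma>. {..<length (B t)}) = \<Gamma>"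
    proof (intro equalityI subsetI)
      fix \<gamma> assume "\<gamma> \<in> (\<lambda>(t, j). rotate (k t) (B t) ! j) ` (SIGMA t:tiles S \<Gamma>. {..<length (B t)})"
      then obtain t j where t: "t \<in> tiles S \<Gamma>" and "j < length (B t)" "\<gamma> = rotate (k t) (B t) ! j" by auto
      then have "\<gamma> \<in> set (B t)" by (metis length_rotate nth_mem set_rotate)
      then show "\<gamma> \<in> \<Gamma>" using walk_edge[OF t] by (metis in_set_conv_nth)
    next
      fix \<gamma> assume "\<gamma> \<in> \<Gamma>"
      then obtain t j where t: "t \<in> tiles S \<Gamma>" and "j < length (B t)" "B t ! j = \<gamma>" using walk_cover by blast
      then have "\<gamma> \<in> set (rotate (k t) (B t))" by auto
      then obtain i where "i < length (B t)" "\<gamma> = rotate (k t) (B t) ! i" by (metis in_set_conv_nth length_rotate)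
      then show "\<gamma> \<in> (\<lambda>(t, j). rotate (k t) (B t) ! j) ` (SIGMA t:tiles S \<Gamma>. {..<length (B t)})"
        using t by (intro image_eqI[of _ _ "(t, i)"]) auto
    qed
  qed
  then show ?thesis
    using oriented boundary_walk_rotate[OF walk_boundary] unfolding oriented_tiling_def by simp
qed

text \<open>
  The walks are rotated so that they start at a bullet. The index of the reverse of the \<open>j\<close>-th side
  of a pentagon in the other tile is \<open>mirror j\<close>: the labels of the end points determine the index.
\<close>

definition mirror :: "nat \<Rightarrow> nat" where "mirror j = [4, 2, 1, 3, 0] ! j"

lemma mirror_simps [simp]: "mirror 0 = 4" "mirror (Suc 0) = 2" "mirror 2 = 1" "mirror 3 = 3" "mirror 4 = 0"
  by (simp_all add: mirror_def)

lemma less_5_cases: "j < 5 \<longleftrightarrow> j = 0 \<or> j = 1 \<or> j = 2 \<or> j = 3 \<or> j = (4::nat)"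
  by auto

lemma mirror_less: "j < 5 \<Longrightarrow> mirror j < 5" and mirror_mirror: "j < 5 \<Longrightarrow> mirror (mirror j) = j"
  by (auto simp: less_5_cases)

section \<open>Labelled pentagons and their neighbours\<close>

locale pentagon_pattern = oriented_tiled S \<Gamma> B for S :: "'a::t2_space set" and \<Gamma> B +
  fixes Bul Cir :: "'a set"
  assumes surface: "closed_surface S"
    and five: "\<And>t. t \<in> tiles S \<Gamma> \<Longrightarrow> length (B t) = 5"
    and nondegen: "\<And>t. t \<in> tiles S \<Gamma> \<Longrightarrow> nondegenerate (B t)"
    and labels_disjoint: "Bul \<inter> Cir = {}"
    and bullet: "\<And>t. t \<in> tiles S \<Gamma> \<Longrightarrow> pathstart (B t ! 0) \<in> Bul"
    and circle: "\<And>t. t \<in> tiles S \<Gamma> \<Longrightarrow> pathstart (B t ! 2) \<in> Cir"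
    and plain: "\<And>t j. \<lbrakk>t \<in> tiles S \<Gamma>; j \<in> {1, 3, 4}\<rbrakk> \<Longrightarrow>
        pathstart (B t ! j) \<notin> Bul \<and> pathstart (B t ! j) \<notin> Cir \<and> vertex_degree \<Gamma> (pathstart (B t ! j)) = 3"
begin

lemma side: "t \<in> tiles S \<Gamma> \<Longrightarrow> j < 5 \<Longrightarrow> B t ! j \<in> \<Gamma>"
  using walk_edge five by simp

lemma side_unique:
  "\<lbrakk>t \<in> tiles S \<Gamma>; q \<in> tiles S \<Gamma>; i < 5; j < 5; B t ! i = B q ! j\<rbrakk> \<Longrightarrow> t = q \<and> i = j"
  using walk_unique five by simp

lemma side_cover:
  assumes "\<gamma> \<in> \<Gamma>"
  obtains t j where "t \<in> tiles S \<Gamma>" "j < 5" "\<gamma> = B t ! j"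
  using walk_cover[OF assms] five that by metis

lemma side_finish:
  assumes "t \<in> tiles S \<Gamma>"
  shows "pathfinish (B t ! 0) = pathstart (B t ! 1)" "pathfinish (B t ! 1) = pathstart (B t ! 2)"
    "pathfinish (B t ! 2) = pathstart (B t ! 3)" "pathfinish (B t ! 3) = pathstart (B t ! 4)"
    "pathfinish (B t ! 4) = pathstart (B t ! 0)"
proof -
  have joint: "pathfinish (B t ! j) = pathstart (B t ! i)" if "j < 5" "i = Suc j mod 5" for i j
    using walk_joint[OF assms, of j] five[OF assms] that by simp
  show "pathfinish (B t ! 0) = pathstart (B t ! 1)" "pathfinish (B t ! 1) = pathstart (B t ! 2)"
    "pathfinish (B t ! 2) = pathstart (B t ! 3)" "pathfinish (B t ! 3) = pathstart (B t ! 4)"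
    "pathfinish (B t ! 4) = pathstart (B t ! 0)"
    by (rule joint; simp)+
qed

definition label :: "'a \<Rightarrow> nat" where "label v = (if v \<in> Bul then 0 else if v \<in> Cir then 1 else 2)"

lemma label_side:
  assumes "t \<in> tiles S \<Gamma>"
  shows "label (pathstart (B t ! 0)) = 0" "label (pathstart (B t ! 1)) = 2" "label (pathstart (B t ! 2)) = 1"
    "label (pathstart (B t ! 3)) = 2" "label (pathstart (B t ! 4)) = 2"
  using bullet[OF assms] circle[OF assms] labels_disjoint plain[OF assms, of 1] plain[OF assms, of 3] plain[OF assms, of 4]
  unfolding label_def by auto

text \<open>With 0, 1, 2 for bullet, circle and no label, the sides have the end labels (0,2),
  (2,1), (1,2), (2,2), (2,0). These pairs are all different, and swapping their entries permutes
  them as \<open>mirror\<close> does.\<close>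

lemma reverse_side_index:
  assumes "t \<in> tiles S \<Gamma>" "q \<in> tiles S \<Gamma>" "i < 5" "j < 5" "B q ! i = reversepath (B t ! j)"
  shows "i = mirror j"
proof -
  have "label (pathstart (B q ! i)) = label (pathfinish (B t ! j))"
    "label (pathfinish (B q ! i)) = label (pathstart (B t ! j))" using assms(5) by auto
  then show ?thesis using assms(3,4) label_side[OF assms(1)] label_side[OF assms(2)]
      side_finish[OF assms(1)] side_finish[OF assms(2)]
    unfolding less_5_cases by (elim disjE) (simp_all del: One_nat_def, simp_all)
qed

definition across :: "'a set \<Rightarrow> nat \<Rightarrow> 'a set" where
  "across t j = (THE q. q \<in> tiles S \<Gamma> \<and> B q ! (mirror j) = reversepath (B t ! j))"

lemma across:
  assumes "t \<in> tiles S \<Gamma>" "j < 5"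
  shows "across t j \<in> tiles S \<Gamma>" "B (across t j) ! mirror j = reversepath (B t ! j)"
proof -
  obtain q i where q: "q \<in> tiles S \<Gamma>" "i < 5" "B q ! i = reversepath (B t ! j)"
    using side_cover[OF edge_reverse[OF side[OF assms]]] by metis
  then have "i = mirror j" using reverse_side_index assms by blast
  then have "\<exists>!q. q \<in> tiles S \<Gamma> \<and> B q ! (mirror j) = reversepath (B t ! j)"
    using q side_unique by metis
  from theI'[OF this, folded across_def]
  show "across t j \<in> tiles S \<Gamma>" "B (across t j) ! mirror j = reversepath (B t ! j)" by blast+
qed

lemma across_eqI:
  assumes "t \<in> tiles S \<Gamma>" "q \<in> tiles S \<Gamma>" "j < 5" "B q ! (mirror j) = reversepath (B t ! j)"
  shows "across t j = q"
  using across[OF assms(1,3)] side_unique[OF _ assms(2) mirror_less[OF assms(3)] mirror_less[OF assms(3)]] assms(4)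
  by metis

lemma across_across: "t \<in> tiles S \<Gamma> \<Longrightarrow> j < 5 \<Longrightarrow> across (across t j) (mirror j) = t"
  by (rule across_eqI) (auto simp: across mirror_less mirror_mirror)

text \<open>Index 3 is the one fixed by \<open>mirror\<close>, so crossing this side is an
  involution on the pentagons. It will correspond to the reversal of coarse edges.\<close>

definition opp :: "'a set \<Rightarrow> 'a set" where "opp t = across t 3"

lemma opp: "t \<in> tiles S \<Gamma> \<Longrightarrow> opp t \<in> tiles S \<Gamma>" "t \<in> tiles S \<Gamma> \<Longrightarrow> B (opp t) ! 3 = reversepath (B t ! 3)"
  "t \<in> tiles S \<Gamma> \<Longrightarrow> opp (opp t) = t"
  using across[of t 3] across_across[of t 3] by (simp_all add: opp_def)

lemma opp_neq: "t \<in> tiles S \<Gamma> \<Longrightarrow> opp t \<noteq> t"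
  using opp(2)[of t] reversepath_neq[OF edge_simple[OF side[of t 3]]] by auto

lemma opp_vertices:
  assumes "t \<in> tiles S \<Gamma>"
  shows "pathstart (B (opp t) ! 3) = pathstart (B t ! 4)" "pathstart (B (opp t) ! 4) = pathstart (B t ! 3)"
proof -
  show "pathstart (B (opp t) ! 3) = pathstart (B t ! 4)"
    unfolding opp(2)[OF assms] using side_finish(4)[OF assms] by simp
  have "pathstart (B (opp t) ! 4) = pathfinish (B (opp t) ! 3)" using side_finish(4)[OF opp(1)[OF assms]] by simp
  then show "pathstart (B (opp t) ! 4) = pathstart (B t ! 3)" unfolding opp(2)[OF assms] by simp
qed

text \<open>Here the degree 3 of the unlabelled vertices enters. The three listed edges have the
  indices 3, 1 and 4 in their walks and are therefore different, which leaves no room for another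
  edge.\<close>

lemma darts_at_dividing:
  assumes t: "t \<in> tiles S \<Gamma>"
  shows "{\<gamma>\<in>\<Gamma>. pathstart \<gamma> = pathstart (B t ! 3)} = {B t ! 3, reversepath (B t ! 2), B (opp t) ! 4}"
proof -
  have "{B t ! 3, B (across t 2) ! 1, B (opp t) ! 4} \<subseteq> {\<gamma>\<in>\<Gamma>. pathstart \<gamma> = pathstart (B t ! 3)}"
    using side[OF t] side[OF opp(1)[OF t]] edge_reverse[OF side[OF t, of 2]] across(2)[OF t, of 2] side_finish(3)[OF t]
      opp_vertices(2)[OF t] by auto
  moreover have "card {B t ! 3, B (across t 2) ! 1, B (opp t) ! 4} = 3"
  proof -
    have q: "across t 2 \<in> tiles S \<Gamma>" using across(1)[OF t] by simp
    have "B t ! 3 \<noteq> B (across t 2) ! 1" "B t ! 3 \<noteq> B (opp t) ! 4" "B (across t 2) ! 1 \<noteq> B (opp t) ! 4"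
      using side_unique[OF t q, of 3 1] side_unique[OF t opp(1)[OF t], of 3 4] side_unique[OF q opp(1)[OF t], of 1 4] by auto
    then show ?thesis by simp
  qed
  moreover have "card {\<gamma>\<in>\<Gamma>. pathstart \<gamma> = pathstart (B t ! 3)} = 3"
    using plain[OF t, of 3] by (simp add: vertex_degree_def)
  ultimately have "{B t ! 3, B (across t 2) ! 1, B (opp t) ! 4} = {\<gamma>\<in>\<Gamma>. pathstart \<gamma> = pathstart (B t ! 3)}"
    using finite_edges by (intro card_subset_eq) auto
  then show ?thesis using across(2)[OF t, of 2] by simp
qed

text \<open>Among the three edges leaving this vertex only one has index 3.\<close>

lemma dividing_unique:
  assumes "t \<in> tiles S \<Gamma>" "q \<in> tiles S \<Gamma>" "pathstart (B t ! 3) = pathstart (B q ! 3)"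
  shows "t = q"
proof -
  have "B q ! 3 \<in> {\<gamma>\<in>\<Gamma>. pathstart \<gamma> = pathstart (B t ! 3)}" using side[OF assms(2)] assms(3) by simp
  then have "B q ! 3 \<in> {B t ! 3, reversepath (B t ! 2), B (opp t) ! 4}" unfolding darts_at_dividing[OF assms(1)] .
  then show ?thesis
    using side_unique[OF assms(2,1), of 3 3] reverse_side_index[OF assms(1,2), of 3 2]
      side_unique[OF assms(2) opp(1)[OF assms(1)], of 3 4] by auto
qed

section \<open>Edges of the coarse tiling\<close>

text \<open>The edge of the coarse tiling that contains the side \<open>B t ! 3\<close>.\<close>

definition coarse :: "'a set \<Rightarrow> real \<Rightarrow> 'a" where
  "coarse t s = (if s \<le> 1/3 then (B (opp t) ! 4) (1 - 3 * s)
     else if s \<le> 2/3 then (B t ! 3) (3 * s - 1) else (B t ! 4) (3 * s - 2))"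

lemma coarse_first: "s \<le> 1/3 \<Longrightarrow> coarse t s = (B (opp t) ! 4) (1 - 3 * s)"
  by (simp add: coarse_def)

lemma coarse_middle:
  assumes "t \<in> tiles S \<Gamma>" "1/3 \<le> s" "s \<le> 2/3"
  shows "coarse t s = (B t ! 3) (3 * s - 1)"
proof (cases "s = 1/3")
  case True
  show ?thesis unfolding True using opp_vertices(2)[OF assms(1)] by (simp add: coarse_def pathstart_def)
qed (use assms in \<open>auto simp: coarse_def\<close>)

lemma coarse_last:
  assumes "t \<in> tiles S \<Gamma>" "2/3 \<le> s"
  shows "coarse t s = (B t ! 4) (3 * s - 2)"
proof (cases "s = 2/3")
  case True
  show ?thesis unfolding True using side_finish(4)[OF assms(1)] by (simp add: coarse_def pathstart_def pathfinish_def)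
qed (use assms in \<open>auto simp: coarse_def\<close>)

text \<open>Describing the first third by side 4 of \<open>opp t\<close> makes the symmetry visible:
  exchanging \<open>t\<close> and \<open>opp t\<close> exchanges the outer thirds. The equation
  holds on the whole real line, since \<open>embedded_graph\<close> asks for the reversed edge as a
  function.\<close>

lemma reversepath_coarse:
  assumes t: "t \<in> tiles S \<Gamma>"
  shows "reversepath (coarse t) = coarse (opp t)"
proof
  fix s :: real
  consider "s \<le> 1/3" | "1/3 \<le> s" "s \<le> 2/3" | "2/3 \<le> s" by linarith
  then show "reversepath (coarse t) s = coarse (opp t) s"
  proof cases
    case 1
    then show ?thesis using coarse_last[OF t, of "1 - s"] coarse_first[of s "opp t"] opp(3)[OF t]
      by (simp add: reversepath_def algebra_simps)
  next
    case 2
    then show ?thesis using coarse_middle[OF t, of "1 - s"] coarse_middle[OF opp(1)[OF t], of s] opp(2)[OF t]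
      by (simp add: reversepath_def algebra_simps)
  next
    case 3
    then show ?thesis using coarse_first[of "1 - s" t] coarse_last[OF opp(1)[OF t], of s]
      by (simp add: reversepath_def algebra_simps)
  qed
qed

lemma coarse_reverse: "t \<in> tiles S \<Gamma> \<Longrightarrow> coarse t s = coarse (opp t) (1 - s)"
  using fun_cong[OF reversepath_coarse[of "opp t"], of s] opp[of t] by (simp add: reversepath_def)

lemma coarse_piece:
  assumes t: "t \<in> tiles S \<Gamma>" and s: "s \<in> {0..1}"
  obtains q j u where "q \<in> tiles S \<Gamma>" "j \<in> {3, 4}" "u \<in> {0..1}" "coarse t s = (B q ! j) u"
proof -
  consider "s \<le> 1/3" | "1/3 \<le> s" "s \<le> 2/3" | "2/3 \<le> s" by linarith
  then show thesis
  proof cases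
    case 1
    then show ?thesis using s by (intro that[OF opp(1)[OF t] _ _ coarse_first]) auto
  next
    case 2
    then show ?thesis by (intro that[OF t _ _ coarse_middle[OF t]]) auto
  next
    case 3
    then show ?thesis using s by (intro that[OF t _ _ coarse_last[OF t]]) auto
  qed
qed

lemma coarse_vertex:
  assumes t: "t \<in> tiles S \<Gamma>" and s: "s \<in> {0..1}" and v: "coarse t s \<in> vertices \<Gamma>"
  shows "s \<in> {0, 1/3, 2/3, 1}"
proof (rule ccontr)
  assume n: "s \<notin> {0, 1/3, 2/3, 1}"
  then consider "s < 1/3" | "1/3 < s" "s < 2/3" | "2/3 < s" by force
  then show False
  proof cases
    case 1
    then show ?thesis using edge_inner_not_vertex[OF side[OF opp(1)[OF t], of 4], of "1 - 3 * s"]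
        coarse_first[of s t] v n s by auto
  next
    case 2
    then show ?thesis using edge_inner_not_vertex[OF side[OF t, of 3], of "3 * s - 1"]
        coarse_middle[OF t, of s] v n s by auto
  next
    case 3
    then show ?thesis using edge_inner_not_vertex[OF side[OF t, of 4], of "3 * s - 2"]
        coarse_last[OF t, of s] v n s by auto
  qed
qed

lemma coarse_points:
  assumes t: "t \<in> tiles S \<Gamma>"
  shows "coarse t 0 = pathstart (B (opp t) ! 0)" "coarse t (1/3) = pathstart (B t ! 3)"
    "coarse t (2/3) = pathstart (B t ! 4)" "coarse t 1 = pathstart (B t ! 0)"
  using coarse_first[of 0 t] coarse_middle[OF t, of "1/3"] coarse_last[OF t, of "2/3"] coarse_last[OF t, of 1]
    side_finish(5)[OF t] side_finish(5)[OF opp(1)[OF t]] by (simp_all add: pathstart_def pathfinish_def)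

lemma sides_meet:
  assumes "t \<in> tiles S \<Gamma>" "q \<in> tiles S \<Gamma>" "i < 5" "j < 5" "s \<in> {0<..<1}" "u \<in> {0..1}" "(B t ! i) s = (B q ! j) u"
  shows "q = t \<and> j = i \<and> u = s \<or> j = mirror i \<and> B q ! j = reversepath (B t ! i) \<and> u = 1 - s"
  using edge_inner_eq[OF side[OF assms(1,3)] side[OF assms(2,4)] assms(5,6,7)]
    side_unique[OF assms(2,1,4,3)] reverse_side_index[OF assms(1,2,4,3)] by blast

text \<open>By reversal \<open>s\<close> may be assumed to lie in the first half of the edge. The
  side indices then decide which pieces of the two coarse edges can share an interior point.\<close>

lemma coarse_inner_eq:
  assumes t: "t \<in> tiles S \<Gamma>" and q: "q \<in> tiles S \<Gamma>" and s: "s \<in> {0<..<1}" and u: "u \<in> {0..1}"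
    and eq: "coarse t s = coarse q u"
  shows "q = t \<and> u = s \<or> q = opp t \<and> u = 1 - s"
proof -
  have half: "q = t \<and> u = s \<or> q = opp t \<and> u = 1 - s"
    if t: "t \<in> tiles S \<Gamma>" and s: "0 < s" "s \<le> 1/2" and eq: "coarse t s = coarse q u" for t s
  proof -
    note t' = opp(1)[OF t] and q' = opp(1)[OF q]
    consider "s < 1/3" | "s = 1/3" | "1/3 < s" using s by linarith
    then show ?thesis
    proof cases
      case 1
      then have e: "coarse t s = (B (opp t) ! 4) (1 - 3 * s)" by (simp add: coarse_first)
      consider "u \<le> 1/3" | "1/3 \<le> u" "u \<le> 2/3" | "2/3 \<le> u" by linarith
      then show ?thesis
      proof cases
        case c: 1
        then have "opp q = opp t \<and> u = s"
          using sides_meet[OF t' q', of 4 4 "1 - 3 * s" "1 - 3 * u"] e eq 1 s u by (auto simp: coarse_first)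
        then show ?thesis using opp(3) t q by metis
      next
        case c: 2
        then show ?thesis
          using sides_meet[OF t' q, of 4 3 "1 - 3 * s" "3 * u - 1"] e eq 1 s u by (auto simp: coarse_middle[OF q])
      next
        case c: 3
        then show ?thesis
          using sides_meet[OF t' q, of 4 4 "1 - 3 * s" "3 * u - 2"] e eq 1 s u by (auto simp: coarse_last[OF q])
      qed
    next
      case 2
      \<comment> \<open>A dividing point is a vertex, so \<open>u\<close> is one of 0, 1/3, 2/3, 1.
        The ends are bullets and drop out by their label; for the other two values the dividing
        point determines the pentagon.\<close>
      then have v: "coarse q u = pathstart (B t ! 3)" using eq coarse_points(2)[OF t] unfolding 2 by simp
      then have "coarse q u \<in> vertices \<Gamma>" using pathstart_in_vertices[OF side[OF t]] by simp
      then have "u \<in> {0, 1/3, 2/3, 1}" using coarse_vertex[OF q u] by blast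
      moreover have "u \<noteq> 0" "u \<noteq> 1"
        using v coarse_points[OF q] label_side[OF t] label_side[OF q] label_side[OF q'] by (metis zero_neq_numeral)+
      moreover have "q = t" if "u = 1/3" using v coarse_points(2)[OF q] dividing_unique[OF q t] that by simp
      moreover have "q = opp t" if "u = 2/3"
      proof -
        have "pathstart (B (opp q) ! 3) = pathstart (B t ! 3)"
          using v coarse_points(3)[OF q] opp_vertices(1)[OF q] that by simp
        then show ?thesis using dividing_unique[OF q' t] opp(3)[OF q] by metis
      qed
      ultimately show ?thesis using 2 by auto
    next
      case 3
      then have e: "coarse t s = (B t ! 3) (3 * s - 1)" using s by (simp add: coarse_middle[OF t])
      have s3: "3 * s - 1 \<in> {0<..<1}" using 3 s by auto
      consider "u \<le> 1/3" | "1/3 \<le> u" "u \<le> 2/3" | "2/3 \<le> u" by linarith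
      then show ?thesis
      proof cases
        case c: 1
        then show ?thesis
          using sides_meet[OF t q', of 3 4 "3 * s - 1" "1 - 3 * u"] e eq s3 u by (auto simp: coarse_first)
      next
        case c: 2
        then have "q = t \<and> u = s \<or> B q ! 3 = B (opp t) ! 3 \<and> u = 1 - s"
          using sides_meet[OF t q, of 3 3 "3 * s - 1" "3 * u - 1"] e eq s3 opp(2)[OF t]
          by (auto simp: coarse_middle[OF q])
        then show ?thesis using side_unique[OF q t', of 3 3] by auto
      next
        case c: 3
        then show ?thesis
          using sides_meet[OF t q, of 3 4 "3 * s - 1" "3 * u - 2"] e eq s3 u by (auto simp: coarse_last[OF q])
      qed
    qed
  qed
  show ?thesis
  proof (cases "s \<le> 1/2")
    case True
    then show ?thesis using half[OF t _ _ eq] s by simp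
  next
    case False
    have "coarse (opp t) (1 - s) = coarse q u" using coarse_reverse[OF t, of s] eq by simp
    then show ?thesis using half[OF opp(1)[OF t], of "1 - s"] False s opp(3)[OF t] by auto
  qed
qed

definition coarse_graph :: "(real \<Rightarrow> 'a) set" where "coarse_graph = coarse ` tiles S \<Gamma>"

lemma inj_coarse: "inj_on coarse (tiles S \<Gamma>)"
proof (rule inj_onI)
  fix t q assume "t \<in> tiles S \<Gamma>" "q \<in> tiles S \<Gamma>" "coarse t = coarse q"
  \<comment> \<open>Any interior parameter except 1/2 would do: at 1/2 the case
    \<open>q = opp t\<close> could not be excluded.\<close>
  then show "t = q" using coarse_inner_eq[of t q "2/5" "2/5"] by simp
qed

lemma path_coarse:
  assumes t: "t \<in> tiles S \<Gamma>"
  shows "path (coarse t)"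
proof -
  have c: "continuous_on {0..1} (B q ! j)" if "q \<in> tiles S \<Gamma>" "j < 5" for q j
    using edge_simple[OF side[OF that]] unfolding simple_path_def path_def by blast
  have "continuous_on {s \<in> {0..1}. s \<le> 1/3} (\<lambda>s. (B (opp t) ! 4) (1 - 3 * s))"
    by (rule continuous_on_compose2[OF c[OF opp(1)[OF t], of 4]]) (auto intro!: continuous_intros)
  moreover have "continuous_on {s \<in> {s \<in> {0..1}. 1/3 \<le> s}. s \<le> 2/3} (\<lambda>s. (B t ! 3) (3 * s - 1))"
    by (rule continuous_on_compose2[OF c[OF t, of 3]]) (auto intro!: continuous_intros)
  moreover have "continuous_on {s \<in> {s \<in> {0..1}. 1/3 \<le> s}. 2/3 \<le> s} (\<lambda>s. (B t ! 4) (3 * s - 2))"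
    by (rule continuous_on_compose2[OF c[OF t, of 4]]) (auto intro!: continuous_intros)
  moreover have "(B (opp t) ! 4) (1 - 3 * s) = (B t ! 3) (3 * s - 1)" if "s = 1/3" for s
    using coarse_middle[OF t, of "1/3"] coarse_first[of "1/3" t] unfolding that by simp
  moreover have "(B t ! 3) (3 * s - 1) = (B t ! 4) (3 * s - 2)" if "s = 2/3" for s
    using coarse_middle[OF t, of "2/3"] coarse_last[OF t, of "2/3"] unfolding that by simp
  ultimately show ?thesis unfolding path_def coarse_def
    by (intro continuous_on_cases_le continuous_on_id) auto
qed

lemma path_image_coarse:
  assumes t: "t \<in> tiles S \<Gamma>"
  shows "path_image (coarse t) \<subseteq> skeleton" "path_image (coarse t) \<subseteq> S"
proof -
  have "coarse t s \<in> skeleton \<inter> S" if s: "s \<in> {0..1}" for s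
  proof -
    obtain q j u where q: "q \<in> tiles S \<Gamma>" and j: "j \<in> {3, 4}" and u: "u \<in> {0..1}" and eq: "coarse t s = (B q ! j) u"
      using coarse_piece[OF t s] .
    have "B q ! j \<in> \<Gamma>" using side[OF q] j by auto
    then show ?thesis using edge_in_skeleton edge_in_surface u unfolding eq path_image_def by blast
  qed
  then show "path_image (coarse t) \<subseteq> skeleton" "path_image (coarse t) \<subseteq> S" unfolding path_image_def by blast+
qed

lemma embedded_coarse: "embedded_graph S coarse_graph"
  unfolding embedded_graph_def
proof (intro conjI ballI impI)
  show "finite coarse_graph" unfolding coarse_graph_def using finite_tiles by simp
  fix \<gamma> assume "\<gamma> \<in> coarse_graph"
  then obtain t where t: "t \<in> tiles S \<Gamma>" "\<gamma> = coarse t" unfolding coarse_graph_def by blast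
  show "simple_path \<gamma>"
    unfolding simple_path_def loop_free_def t(2)
  proof (intro conjI ballI impI)
    show "path (coarse t)" using path_coarse t by blast
    fix s u :: real assume su: "s \<in> {0..1}" "u \<in> {0..1}" "coarse t s = coarse t u"
    consider "s \<in> {0<..<1}" | "u \<in> {0<..<1}" | "s \<in> {0,1}" "u \<in> {0,1}" using su by force
    then show "s = u \<or> s = 0 \<and> u = 1 \<or> s = 1 \<and> u = 0"
    proof cases
      case 1
      then show ?thesis using coarse_inner_eq[OF t(1) t(1) 1 su(2,3)] opp_neq[OF t(1)] by metis
    next
      case 2
      then show ?thesis using coarse_inner_eq[OF t(1) t(1) 2 su(1) su(3)[symmetric]] opp_neq[OF t(1)] by metis
    qed auto
  qed
  show "path_image \<gamma> \<subseteq> S" using path_image_coarse t by blast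
  show "reversepath \<gamma> \<in> coarse_graph" unfolding t(2) reversepath_coarse[OF t(1)] coarse_graph_def using opp(1)[OF t(1)] by blast
  fix \<delta> assume "\<delta> \<in> coarse_graph" and ne: "\<delta> \<noteq> \<gamma>" "\<delta> \<noteq> reversepath \<gamma>"
  then obtain q where q: "q \<in> tiles S \<Gamma>" "\<delta> = coarse q" unfolding coarse_graph_def by blast
  have "q \<noteq> t" "q \<noteq> opp t" using ne unfolding t(2) q(2) reversepath_coarse[OF t(1)] by blast+
  then show "\<gamma> ` {0<..<1} \<inter> path_image \<delta> = {}"
    using coarse_inner_eq[OF t(1) q(1)] unfolding t(2) q(2) path_image_def by blast
qed

text \<open>By the labels, only sides of index 0 leave a bullet. Each pentagon with such a side
  there contributes the coarse edge of its \<open>opp\<close>, so the degree is at least the old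
  one.\<close>

lemma coarse_degree:
  assumes "v \<in> vertices coarse_graph"
  shows "3 \<le> vertex_degree coarse_graph v"
proof -
  obtain t0 where t0: "t0 \<in> tiles S \<Gamma>" "v = pathstart (B (opp t0) ! 0)"
    using assms coarse_points(1) unfolding vertices_def coarse_graph_def pathstart_def by auto
  define T where "T = {t \<in> tiles S \<Gamma>. pathstart (B t ! 0) = v}"
  have label: "label v = 0" using t0 label_side[OF opp(1)[OF t0(1)]] by simp
  have "{\<gamma>\<in>\<Gamma>. pathstart \<gamma> = v} = (\<lambda>t. B t ! 0) ` T"
  proof (intro equalityI subsetI)
    fix \<gamma> assume g: "\<gamma> \<in> {\<gamma>\<in>\<Gamma>. pathstart \<gamma> = v}"
    then obtain t j where t: "t \<in> tiles S \<Gamma>" "j < 5" "\<gamma> = B t ! j" using side_cover by blast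
    have "label (pathstart (B t ! j)) = 0" using g t label by simp
    then have "j = 0" using t(2) label_side[OF t(1)] unfolding less_5_cases by auto
    then show "\<gamma> \<in> (\<lambda>t. B t ! 0) ` T" using g t unfolding T_def by blast
  qed (use side in \<open>auto simp: T_def\<close>)
  moreover have "inj_on (\<lambda>t. B t ! 0) T" using side_unique[of _ _ 0 0] unfolding inj_on_def T_def by simp
  ultimately have "vertex_degree \<Gamma> v = card T" unfolding vertex_degree_def by (simp add: card_image)
  moreover have "v \<in> vertices \<Gamma>" using t0 side[OF opp(1)[OF t0(1)], of 0] pathstart_in_vertices by simp
  ultimately have T3: "3 \<le> card T" using degree_ge_3 by metis
  have "inj_on (\<lambda>t. coarse (opp t)) T"
    unfolding inj_on_def T_def using inj_onD[OF inj_coarse] opp by (metis (lifting) mem_Collect_eq)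
  then have T: "card ((\<lambda>t. coarse (opp t)) ` T) = card T" by (rule card_image)
  have sub: "(\<lambda>t. coarse (opp t)) ` T \<subseteq> {\<gamma>\<in>coarse_graph. pathstart \<gamma> = v}"
  proof clarify
    fix t assume "t \<in> T"
    then have t: "t \<in> tiles S \<Gamma>" "pathstart (B t ! 0) = v" by (auto simp: T_def)
    show "coarse (opp t) \<in> coarse_graph \<and> pathstart (coarse (opp t)) = v"
      unfolding pathstart_def[of "coarse (opp t)"] coarse_points(1)[OF opp(1)[OF t(1)]] opp(3)[OF t(1)] t(2)
      unfolding coarse_graph_def using opp(1)[OF t(1)] by blast
  qed
  have "finite {\<gamma>\<in>coarse_graph. pathstart \<gamma> = v}" unfolding coarse_graph_def using finite_tiles by simp
  from card_mono[OF this sub] show ?thesis unfolding vertex_degree_def T using T3 by linarith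
qed

section \<open>The pentagons around a circle\<close>

text \<open>The next pentagon around the circle of \<open>t\<close>.\<close>

definition nxt :: "'a set \<Rightarrow> 'a set" where "nxt t = (if t \<in> tiles S \<Gamma> then across t 1 else t)"

lemma nxt:
  assumes "t \<in> tiles S \<Gamma>"
  shows "nxt t \<in> tiles S \<Gamma>" "B (nxt t) ! 2 = reversepath (B t ! 1)"
  using across[OF assms, of 1] assms by (simp_all add: nxt_def)

lemma nxt_circle: "t \<in> tiles S \<Gamma> \<Longrightarrow> pathstart (B (nxt t) ! 2) = pathstart (B t ! 2)"
  using nxt(2) side_finish(2) by simp

text \<open>Crossing side 2 undoes crossing side 1. Outside the tiles \<open>nxt\<close> was set to
  the identity so that injectivity holds on the whole type, as required for iterating it.\<close>

lemma inj_nxt: "inj nxt"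
proof (rule injI)
  fix t q assume eq: "nxt t = nxt q"
  have "across (nxt t) 2 = t" if "t \<in> tiles S \<Gamma>" for t
    using across_across[OF that, of 1] that by (simp add: nxt_def)
  moreover have "t \<in> tiles S \<Gamma> \<longleftrightarrow> q \<in> tiles S \<Gamma>" using eq nxt(1) unfolding nxt_def by metis
  ultimately show "t = q" using eq unfolding nxt_def by metis
qed

text \<open>The reversed side 0 of \<open>t\<close> leaves the dividing point of
  \<open>nxt t\<close>. Of the three edges there, the other two are excluded by their indices. Hence
  the coarse edge of \<open>nxt t\<close> begins with side 0 of \<open>t\<close>.\<close>

lemma nxt_first_side:
  assumes t: "t \<in> tiles S \<Gamma>"
  shows "B (opp (nxt t)) ! 4 = reversepath (B t ! 0)"
proof -
  note q = nxt(1)[OF t]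
  have "pathstart (B (nxt t) ! 3) = pathstart (B t ! 1)" using side_finish(3)[OF q] nxt(2)[OF t] by simp
  then have "reversepath (B t ! 0) \<in> {\<gamma>\<in>\<Gamma>. pathstart \<gamma> = pathstart (B (nxt t) ! 3)}"
    using edge_reverse[OF side[OF t, of 0]] side_finish(1)[OF t] by simp
  then have "reversepath (B t ! 0) \<in> {B (nxt t) ! 3, reversepath (B (nxt t) ! 2), B (opp (nxt t)) ! 4}"
    unfolding darts_at_dividing[OF q] .
  moreover have "reversepath (B t ! 0) \<noteq> B (nxt t) ! 3"
    using reverse_side_index[OF t q, of 3 0] by auto
  moreover have "reversepath (B t ! 0) \<noteq> reversepath (B (nxt t) ! 2)"
  proof
    assume "reversepath (B t ! 0) = reversepath (B (nxt t) ! 2)"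
    then have "B t ! 0 = B (nxt t) ! 2" by (metis reversepath_reversepath)
    then show False using side_unique[OF t q, of 0 2] by simp
  qed
  ultimately show ?thesis by (metis insertE singletonD)
qed

lemma coarse_nxt_first: "t \<in> tiles S \<Gamma> \<Longrightarrow> s \<le> 1/3 \<Longrightarrow> coarse (nxt t) s = (B t ! 0) (3 * s)"
  by (simp add: coarse_first nxt_first_side reversepath_def)

definition fan :: "'a set \<Rightarrow> nat \<Rightarrow> 'a set" where "fan t i = (nxt ^^ i) t"

lemma fan_simps [simp]: "fan t 0 = t" "fan t (Suc i) = nxt (fan t i)"
  by (simp_all add: fan_def)

definition period :: "'a set \<Rightarrow> nat" where "period t = (LEAST n. 0 < n \<and> fan t n = t)"

lemma fan_tile: "t \<in> tiles S \<Gamma> \<Longrightarrow> fan t i \<in> tiles S \<Gamma>"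
  by (induction i) (auto intro: nxt)

lemma fan_circle: "t \<in> tiles S \<Gamma> \<Longrightarrow> pathstart (B (fan t i) ! 2) = pathstart (B t ! 2)"
  by (induction i) (auto simp: nxt_circle fan_tile)

lemma period:
  assumes "t \<in> tiles S \<Gamma>"
  shows "0 < period t" "fan t (period t) = t"
proof -
  have "finite {y. \<exists>n. y = (nxt ^^ n) t}"
    by (rule finite_subset[OF _ finite_tiles]) (use fan_tile[OF assms] in \<open>auto simp: fan_def\<close>)
  then obtain n where "n > 0" "(nxt ^^ n) t = t" using funpow_inj_finite[OF inj_nxt] by blast
  then have "\<exists>n. 0 < n \<and> fan t n = t" by (auto simp: fan_def)
  from LeastI_ex[OF this, folded period_def]
  show "0 < period t" "fan t (period t) = t" by blast+
qed

lemma fan_mod: "t \<in> tiles S \<Gamma> \<Longrightarrow> fan t (i mod period t) = fan t i"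
  unfolding fan_def by (rule funpow_mod_eq) (use period in \<open>simp add: fan_def\<close>)

lemma fan_inj:
  assumes t: "t \<in> tiles S \<Gamma>"
  shows "inj_on (fan t) {..<period t}"
proof (rule linorder_inj_onI)
  fix i j assume ij: "i < j" "i \<in> {..<period t}" "j \<in> {..<period t}"
  show "fan t i \<noteq> fan t j"
  proof
    assume "fan t i = fan t j"
    moreover have "fan t j = (nxt ^^ i) (fan t (j - i))"
      using funpow_add[of i "j - i" nxt] ij by (simp add: fan_def)
    ultimately have "fan t (j - i) = t" using inj_fn[OF inj_nxt, of i] by (auto simp: fan_def dest: injD)
    then have "period t \<le> j - i" unfolding period_def using ij by (intro Least_le) auto
    then show False using ij by auto
  qed
qed auto

text \<open>The spokes of one orbit of \<open>nxt\<close> are closed under passing from one side of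
  a corner at the circle to the other, so \<open>single_cycle_at_vertex\<close> makes them all the
  edges at the circle.\<close>

lemma fan_darts:
  assumes t: "t \<in> tiles S \<Gamma>"
  shows "{\<gamma>\<in>\<Gamma>. pathstart \<gamma> = pathstart (B t ! 2)} = (\<lambda>i. B (fan t i) ! 2) ` {..<period t}"
proof -
  define C where "C = (\<lambda>i. B (fan t i) ! 2) ` {..<period t}"
  have in_C: "B (fan t i) ! 2 \<in> C" for i
    unfolding C_def fan_mod[OF t, of i, symmetric] using period(1)[OF t] by auto
  have C: "C = {\<gamma>\<in>\<Gamma>. pathstart \<gamma> = pathstart (B t ! 2)}"
  proof (rule single_cycle_at_vertex[OF surface])
    show "C \<subseteq> {\<gamma>\<in>\<Gamma>. pathstart \<gamma> = pathstart (B t ! 2)}"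
      unfolding C_def using side[OF fan_tile[OF t]] fan_circle[OF t] by auto
    show "C \<noteq> {}" using in_C by blast
    fix t' j assume t': "t' \<in> tiles S \<Gamma>" and "j < length (B t')"
    then have j: "j < 5" using five by simp
    show "B t' ! (Suc j mod length (B t')) \<in> C \<longleftrightarrow> reversepath (B t' ! j) \<in> C"
      unfolding five[OF t']
    proof
      assume "B t' ! (Suc j mod 5) \<in> C"
      then obtain i where i: "B t' ! (Suc j mod 5) = B (fan t i) ! 2" unfolding C_def by blast
      \<comment> \<open>Only the corner between sides 1 and 2 lies at a circle, so the condition has
        content just for \<open>j = 1\<close>.\<close>
      then have "t' = fan t i \<and> Suc j mod 5 = 2" using side_unique[OF t' fan_tile[OF t], of "Suc j mod 5" 2] by simp
      then have "t' = fan t i" "j = 1" using j by (auto simp: mod_Suc split: if_splits)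
      then show "reversepath (B t' ! j) \<in> C" using in_C[of "Suc i"] nxt(2)[OF t'] by simp
    next
      assume "reversepath (B t' ! j) \<in> C"
      then obtain i where i: "B (fan t i) ! 2 = reversepath (B t' ! j)" unfolding C_def by auto
      have "mirror j = 2" using reverse_side_index[OF t' fan_tile[OF t] _ j i] by simp
      then have j1: "j = 1" using j unfolding less_5_cases by auto
      have "B (nxt t') ! 2 = B (fan t i) ! 2" using i nxt(2)[OF t'] j1 by simp
      then have e: "nxt t' = fan t i" using side_unique[OF nxt(1)[OF t'] fan_tile[OF t], of 2 2] by simp
      have "\<exists>i'. fan t i = nxt (fan t i')"
      proof (cases i)
        case 0
        \<comment> \<open>The predecessor of the first pentagon is the last one of the
          cycle.\<close>
        have "fan t i = nxt (fan t (period t - 1))"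
          using 0 period[OF t] fan_simps(2)[of t "period t - 1"] by simp
        then show ?thesis ..
      qed auto
      then obtain i' where "t' = fan t i'" using e inj_nxt by (metis injD)
      then show "B t' ! (Suc j mod 5) \<in> C" using in_C j1 by (simp add: numeral_2_eq_2)
    qed
  qed
  then show ?thesis unfolding C_def by simp
qed

lemma fan_cover:
  assumes t: "t \<in> tiles S \<Gamma>" and q: "q \<in> tiles S \<Gamma>" "pathstart (B q ! 2) = pathstart (B t ! 2)"
  obtains i where "i < period t" "q = fan t i"
proof -
  have "B q ! 2 \<in> {\<gamma>\<in>\<Gamma>. pathstart \<gamma> = pathstart (B t ! 2)}" using side[OF q(1)] q(2) by simp
  then obtain i where "i < period t" "B q ! 2 = B (fan t i) ! 2" unfolding fan_darts[OF t] by auto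
  then show thesis using that[of i] side_unique[OF q(1) fan_tile[OF t], of 2 2] by simp
qed

text \<open>The circle is a vertex of the given tiling and has degree at least 3. This bound makes
  the sectors convex and the coarse walks long enough.\<close>

lemma period_ge_3:
  assumes t: "t \<in> tiles S \<Gamma>"
  shows "3 \<le> period t"
proof -
  have "card ((\<lambda>i. B (fan t i) ! 2) ` {..<period t}) \<le> period t"
    using card_image_le[of "{..<period t}" "\<lambda>i. B (fan t i) ! 2"] by simp
  moreover have "3 \<le> vertex_degree \<Gamma> (pathstart (B t ! 2))"
    by (rule degree_ge_3[OF pathstart_in_vertices[OF side[OF t]]]) simp
  ultimately show ?thesis unfolding vertex_degree_def fan_darts[OF t] by simp
qed

end

text \<open>As the family is finite, the union of all members but one is relatively closed as well.
  A connected set that contains a member therefore cannot leave it.\<close>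

lemma components_eqI:
  assumes fin: "finite F" and union: "\<Union>F = X"
    and disj: "\<And>A A'. \<lbrakk>A \<in> F; A' \<in> F; A \<noteq> A'\<rbrakk> \<Longrightarrow> A \<inter> A' = {}"
    and conn: "\<And>A. A \<in> F \<Longrightarrow> connected A" and ne: "\<And>A. A \<in> F \<Longrightarrow> A \<noteq> {}"
    and cl: "\<And>A. A \<in> F \<Longrightarrow> closedin (top_of_set X) A"
  shows "components X = F"
proof -
  have comp: "A \<in> components X" if A: "A \<in> F" for A
    unfolding in_components_maximal
  proof (intro conjI allI impI)
    fix D assume D: "D \<noteq> {} \<and> A \<subseteq> D \<and> D \<subseteq> X \<and> connected D"
    define R where "R = \<Union>(F - {A})"
    have "closedin (top_of_set X) R" unfolding R_def using fin cl by (intro closedin_Union) auto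
    then obtain C' where C': "closed C'" "R = X \<inter> C'" unfolding closedin_closed by (elim exE conjE)
    obtain C where C: "closed C" "A = X \<inter> C" using cl[OF A] unfolding closedin_closed by (elim exE conjE)
    have AX: "A \<union> R = X" unfolding R_def using union A by blast
    have "A \<inter> R = {}" unfolding R_def using disj[OF A] by blast
    then have "C \<inter> C' \<inter> D = {}" using C C' D by blast
    moreover have "D \<subseteq> C \<union> C'" using AX C C' D by blast
    ultimately have "C \<inter> D = {} \<or> C' \<inter> D = {}"
      using D C C' by (intro connected_closedD[of D C C']) auto
    moreover have "C \<inter> D \<noteq> {}" using D C ne[OF A] by blast
    ultimately have "C' \<inter> D = {}" by blast
    then have "D \<subseteq> A" using AX C' D by blast
    then show "D = A" using D by blast
  qed (use A union conn ne in auto)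
  show ?thesis
  proof (intro equalityI subsetI)
    fix D assume D: "D \<in> components X"
    then obtain x where x: "x \<in> D" "x \<in> X" using in_components_nonempty in_components_subset by blast
    then obtain A where A: "A \<in> F" "x \<in> A" using union by blast
    then have "D = A" using components_nonoverlap[OF D comp[OF A(1)]] x by blast
    then show "D \<in> F" using A by simp
  qed (rule comp)
qed

section \<open>Cells: the tiles of the coarse tiling\<close>

context pentagon_pattern
begin

text \<open>Side 1 need not be added, being the reverse of side 2 of the next pentagon. The
  half-open parameter range keeps the circle and leaves out the dividing point, which belongs to a
  coarse edge.\<close>

definition cell :: "'a \<Rightarrow> 'a set" where
  "cell w = (\<Union>t\<in>{t \<in> tiles S \<Gamma>. pathstart (B t ! 2) = w}. t \<union> (B t ! 2) ` {0..<1})"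

definition coarse_skeleton :: "'a set" where "coarse_skeleton = (\<Union>\<gamma>\<in>coarse_graph. path_image \<gamma>)"

lemma coarse_skeleton_iff: "y \<in> coarse_skeleton \<longleftrightarrow> (\<exists>t\<in>tiles S \<Gamma>. \<exists>s\<in>{0..1}. y = coarse t s)"
  unfolding coarse_skeleton_def coarse_graph_def path_image_def by blast

text \<open>Turned by two sides, the pentagon is read from its circle, as
  \<open>sector_to_pentagon\<close> expects at the angle 0.\<close>

definition shifted_chart :: "'a set \<Rightarrow> complex \<Rightarrow> 'a" where
  "shifted_chart t z = chart t (z * polar 5 1 2)"

lemma shifted_chart_boundary:
  assumes t: "t \<in> tiles S \<Gamma>" and s: "s \<in> {0..1}"
  shows "shifted_chart t (polar 5 1 s) = (B t ! 2) s"
    "shifted_chart t (polar 5 1 (1 + s)) = (B t ! 3) s"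
    "shifted_chart t (polar 5 1 (2 + s)) = (B t ! 4) s"
    "shifted_chart t (polar 5 1 (3 + s)) = (B t ! 0) s"
    "shifted_chart t (polar 5 1 (4 + s)) = (B t ! 1) s"
proof -
  have key: "shifted_chart t (polar 5 1 (real j + s)) = (B t ! i) s" if "i = (j + 2) mod 5" for i j
  proof -
    have "shifted_chart t (polar 5 1 (real j + s)) = chart t (polar 5 1 (real (j + 2) + s))"
      by (simp add: shifted_chart_def polar_mult_polar algebra_simps)
    also have "polar 5 1 (real (j + 2) + s) = polar 5 1 (real ((j + 2) mod 5) + s)"
      by (rule polar_mod[symmetric]) simp
    also have "chart t \<dots> = (B t ! ((j + 2) mod 5)) s"
      using chart_boundary[OF t, of "(j + 2) mod 5" s] five[OF t] s by simp
    finally show ?thesis using that by simp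
  qed
  show "shifted_chart t (polar 5 1 s) = (B t ! 2) s"
    "shifted_chart t (polar 5 1 (1 + s)) = (B t ! 3) s"
    "shifted_chart t (polar 5 1 (2 + s)) = (B t ! 4) s"
    "shifted_chart t (polar 5 1 (3 + s)) = (B t ! 0) s"
    "shifted_chart t (polar 5 1 (4 + s)) = (B t ! 1) s"
    using key[of 2 0] key[of 3 1] key[of 4 2] key[of 0 3] key[of 1 4] by simp_all
qed

lemma fan_cong:
  assumes "t \<in> tiles S \<Gamma>" "int i = int j + int (period t) * m"
  shows "fan t i = fan t j"
proof -
  have "int i mod int (period t) = int j mod int (period t)" using assms(2) by simp
  then have "i mod period t = j mod period t" by (metis of_nat_eq_iff of_nat_mod)
  then show ?thesis using fan_mod[OF assms(1)] by metis
qed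

text \<open>
  The pentagons around a circle, each straightened to a sector by \<open>sector_to_pentagon\<close>, are glued to
  a disk. The sectors are turned by a third of their angle, because the spokes end at the first
  dividing points of the edges of the coarse tiling.
\<close>

lemma cell_chart:
  assumes t: "t \<in> tiles S \<Gamma>"
  obtains H where "continuous_on (cball 0 1) H" "inj_on H (ball 0 1)" "H ` ball 0 1 = cell (pathstart (B t ! 2))"
    "\<And>j s. \<lbrakk>j < period t; s \<in> {0..1}\<rbrakk> \<Longrightarrow> H (polar (period t) 1 (real j + s)) = coarse (fan t j) s"
proof -
  define n where "n = period t"
  define w where "w = pathstart (B t ! 2)"
  have n: "n \<ge> 3" and n0: "n > 0" using period_ge_3[OF t] by (auto simp: n_def)
  note ft = fan_tile[OF t]
  obtain \<Phi> where \<Phi>: "continuous_on (sector n) \<Phi>" "inj_on \<Phi> (sector n)" "\<Phi> ` sector n = cball (0::complex) 1"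
    and \<Phi>0: "\<And>r. r \<in> {0..1} \<Longrightarrow> \<Phi> (polar n r 0) = polar 5 1 r"
    and \<Phi>arc: "\<And>x. x \<in> {0..1} \<Longrightarrow> \<Phi> (polar n 1 x) = polar 5 1 (1 + 3 * x)"
    and \<Phi>1: "\<And>r. r \<in> {0..1} \<Longrightarrow> \<Phi> (polar n r 1) = polar 5 1 (5 - r)"
    and \<Phi>in: "\<And>r x. \<lbrakk>0 < r; r < 1; 0 < x; x < 1\<rbrakk> \<Longrightarrow> \<Phi> (polar n r x) \<in> ball 0 1"
    by (rule sector_to_pentagon[OF n], rule that) blast+
  have sec: "polar n r x \<in> sector n" if "r \<in> {0..1}" "x \<in> {0..1}" for r x
    using that unfolding sector_def by blast
  define piece where "piece q z = shifted_chart q (\<Phi> z)" for q z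
  define P where "P i z = z * polar n 1 (real i + 1/3)" for i z
  have piece0: "piece (fan t i) (polar n r 0) = (B (fan t i) ! 2) r" if "r \<in> {0..1}" for i r
    using that \<Phi>0 shifted_chart_boundary(1)[OF ft] by (simp add: piece_def)
  \<comment> \<open>The last radius carries side 1 backwards, which is side 2 of the next pentagon
    and thus agrees with the first radius of the next sector.\<close>
  have piece1: "piece (fan t i) (polar n r 1) = (B (fan t (Suc i)) ! 2) r" if "r \<in> {0..1}" for i r
  proof -
    have "piece (fan t i) (polar n r 1) = shifted_chart (fan t i) (polar 5 1 (4 + (1 - r)))"
      using that \<Phi>1 by (simp add: piece_def)
    also have "\<dots> = (B (fan t i) ! 1) (1 - r)" using that by (intro shifted_chart_boundary(5)[OF ft]) auto
    finally show ?thesis using nxt(2)[OF ft, of i] by (simp add: reversepath_def)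
  qed
  \<comment> \<open>The arc of sector \<open>i\<close> carries the last two thirds of coarse edge
    \<open>i\<close> and then, by \<open>piece_arc'\<close>, the first third of the following one.
    This accounts for the shift by 1/3.\<close>
  have piece_arc: "piece (fan t i) (polar n 1 x) = coarse (fan t i) (x + 1/3)" if "0 \<le> x" "x \<le> 2/3" for i x
  proof (cases "x \<le> 1/3")
    case True
    have "piece (fan t i) (polar n 1 x) = (B (fan t i) ! 3) (3 * x)"
      using that True \<Phi>arc[of x] shifted_chart_boundary(2)[OF ft, of "3 * x"] by (simp add: piece_def)
    then show ?thesis using that True coarse_middle[OF ft, of "x + 1/3" i] by (simp add: algebra_simps)
  next
    case False
    have "piece (fan t i) (polar n 1 x) = (B (fan t i) ! 4) (3 * x - 1)"
      using that False \<Phi>arc[of x] shifted_chart_boundary(3)[OF ft, of "3 * x - 1"] by (simp add: piece_def)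
    then show ?thesis using that False coarse_last[OF ft, of "x + 1/3" i] by (simp add: algebra_simps)
  qed
  have piece_arc': "piece (fan t i) (polar n 1 x) = coarse (fan t (Suc i)) (x - 2/3)" if "2/3 \<le> x" "x \<le> 1" for i x
  proof -
    have "piece (fan t i) (polar n 1 x) = (B (fan t i) ! 0) (3 * x - 2)"
      using that \<Phi>arc[of x] shifted_chart_boundary(4)[OF ft, of "3 * x - 2"] by (simp add: piece_def)
    then show ?thesis using that coarse_nxt_first[OF ft, of "x - 2/3" i] by (simp add: algebra_simps)
  qed
  have rot: "norm (z * polar 5 1 2) = norm z" for z by (simp add: norm_mult)
  have P_polar: "P i (polar n r x) = polar n r (x + real i + 1/3)" for i r x
    by (simp add: P_def polar_mult_polar add.assoc)
  \<comment> \<open>Points of placed sectors coincide only at the centre, inside equal sectors, or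
    along a common radius of neighbours; the last three cases are the values 0, 1 and -1 of an
    integer that is bounded by \<open>x - x'\<close>.\<close>
  have agree: "piece (fan t i) (polar n r x) = piece (fan t j) (polar n r' x')"
    if rx: "r \<in> {0..1}" "x \<in> {0..1}" "r' \<in> {0..1}" "x' \<in> {0..1}"
      and eq: "P i (polar n r x) = P j (polar n r' x')" for i j r x r' x'
  proof -
    have "r = r' \<and> (r = 0 \<or> (\<exists>m::int. x + real i + 1/3 = x' + real j + 1/3 + real n * m))"
      using polar_eqD[OF n0 _ _ eq[unfolded P_polar]] rx by auto
    moreover have "x + real i = x' + real j + real n * m"
      if "x + real i + 1/3 = x' + real j + 1/3 + real n * m" for m :: int using that by simp
    ultimately consider "r = 0" "r' = 0" | m :: int where "r = r'" "x + real i = x' + real j + real n * m" by metis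
    then show ?thesis
    proof cases
      case 1
      have "piece (fan t k) (polar n 0 y) = w" for k y
        using piece0[of 0 k] fan_circle[OF t, of k] by (simp add: w_def pathstart_def)
      then show ?thesis using 1 by simp
    next
      case 2
      have d: "x - x' = real_of_int (int j - int i + int n * m)" using 2(2) by simp
      have "\<bar>real_of_int (int j - int i + int n * m)\<bar> \<le> 1" unfolding d[symmetric] using rx by auto
      then have "\<bar>int j - int i + int n * m\<bar> \<le> 1" by linarith
      then consider "int j - int i + int n * m = 0" | "int j - int i + int n * m = 1" | "int j - int i + int n * m = -1"
        by linarith
      then show ?thesis
      proof cases
        case c: 1
        then have "int i = int j + int n * m" by simp
        then have "fan t i = fan t j" using fan_cong[OF t] unfolding n_def by blast
        then show ?thesis using d c 2(1) by simp
      next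
        case c: 2
        then have "x - x' = 1" using d by simp
        then have x: "x = 1" "x' = 0" using rx by auto
        have "int (Suc i) = int j + int n * m" using c by simp
        then have "fan t (Suc i) = fan t j" using fan_cong[OF t] unfolding n_def by blast
        then show ?thesis using piece0[OF rx(3), of j] piece1[OF rx(1), of i] 2(1) x by simp
      next
        case c: 3
        then have "x - x' = -1" using d by simp
        then have x: "x = 0" "x' = 1" using rx by auto
        have "int i = int (Suc j) + int n * m" using c by simp
        then have "fan t i = fan t (Suc j)" using fan_cong[OF t] unfolding n_def by blast
        then show ?thesis using piece0[OF rx(1), of i] piece1[OF rx(3), of j] 2(1) x by simp
      qed
    qed
  qed
  have cont_piece: "continuous_on (sector n) (piece (fan t i))" for i
  proof -
    have "continuous_on (sector n) (\<lambda>z. \<Phi> z * polar 5 1 2)" using \<Phi>(1) by (intro continuous_intros)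
    moreover have "(\<lambda>z. \<Phi> z * polar 5 1 2) ` sector n \<subseteq> cball 0 1"
    proof (rule image_subsetI)
      fix z assume "z \<in> sector n"
      then have "\<Phi> z \<in> cball 0 1" using \<Phi>(3) by blast
      then show "\<Phi> z * polar 5 1 2 \<in> cball 0 1" using rot[of "\<Phi> z"] by simp
    qed
    ultimately show ?thesis unfolding piece_def shifted_chart_def
      by (intro continuous_on_compose2[OF chart_continuous[OF ft]])
  qed
  obtain H where H: "continuous_on (\<Union>i\<in>{..<n}. P i ` sector n) H"
    and HP: "\<And>i z. \<lbrakk>i \<in> {..<n}; z \<in> sector n\<rbrakk> \<Longrightarrow> H (P i z) = piece (fan t i) z"
  proof (rule continuous_on_glue[of "{..<n}" "\<lambda>_. sector n" P "\<lambda>i. piece (fan t i)"])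
    fix i j z z' assume "z \<in> sector n" "z' \<in> sector n" and eq: "P i z = P j z'"
    then obtain r x r' x' where "z = polar n r x" "z' = polar n r' x'" "r \<in> {0..1}" "x \<in> {0..1}" "r' \<in> {0..1}" "x' \<in> {0..1}"
      unfolding sector_def by blast
    then show "piece (fan t i) z = piece (fan t j) z'" using agree eq by blast
  qed (use compact_sector[OF n] cont_piece in \<open>auto simp: P_def intro!: continuous_intros\<close>)
  have Hpolar: "H (polar n r (x + real i + 1/3)) = piece (fan t i) (polar n r x)"
    if "r \<in> {0..1}" "x \<in> {0..1}" for r x i
  proof -
    have "polar n r x \<in> sector n" using that by (rule sec)
    moreover have "P (i mod n) (polar n r x) = polar n r (x + real i + 1/3)"
      using polar_mod[OF n0, of r i "x + 1/3"] unfolding P_polar by (simp add: algebra_simps)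
    ultimately show ?thesis
      using HP[of "i mod n" "polar n r x"] n0 fan_mod[OF t, of i] by (simp add: n_def)
  qed
  \<comment> \<open>With \<open>x\<close> below 1, a point on a radius is assigned to the sector
    that starts there, not to the one that ends there.\<close>
  have normal: "\<exists>i x. i < n \<and> x \<in> {0..<1} \<and> z = polar n (norm z) (x + real i + 1/3)" for z
  proof (cases "z = 0")
    case False
    then have nz: "z * polar n 1 (-1/3) \<noteq> 0" by (simp add: polar_def)
    obtain y where y: "y \<in> {0..<real n}" "z * polar n 1 (-1/3) = polar n (norm z) y"
      using polar_surj[OF n0 nz] by (auto simp: norm_mult)
    have "z = (z * polar n 1 (-1/3)) * polar n 1 (1/3)"
      by (simp add: mult.assoc polar_mult_polar) (simp add: polar_def)
    then have "z = polar n (norm z) (y + 1/3)" unfolding y(2) by (simp add: polar_mult_polar)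
    moreover have "real (nat \<lfloor>y\<rfloor>) = \<lfloor>y\<rfloor>" using y(1) by simp
    then have "y - real (nat \<lfloor>y\<rfloor>) \<in> {0..<1}" by simp linarith
    moreover have "nat \<lfloor>y\<rfloor> < n" using y(1) n0 by (simp add: nat_less_iff floor_less_iff)
    ultimately show ?thesis by (intro exI[of _ "nat \<lfloor>y\<rfloor>"] exI[of _ "y - real (nat \<lfloor>y\<rfloor>)"]) auto
  qed (use n0 in \<open>auto intro: exI[of _ 0]\<close>)
  have cover: "(\<Union>i\<in>{..<n}. P i ` sector n) = cball 0 1"
  proof (intro equalityI subsetI)
    fix z assume "z \<in> (\<Union>i\<in>{..<n}. P i ` sector n)"
    then show "z \<in> cball 0 1" unfolding sector_def by (auto simp: P_polar)
  next
    fix z :: complex assume z: "z \<in> cball 0 1"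
    obtain i x where i: "i < n" and x: "x \<in> {0..<1}" and "z = P i (polar n (norm z) x)"
      using normal[of z] unfolding P_polar by blast
    moreover have "polar n (norm z) x \<in> sector n" using z x by (intro sec) auto
    ultimately show "z \<in> (\<Union>i\<in>{..<n}. P i ` sector n)" by blast
  qed
  have H_value: "if x = 0 \<or> norm z = 0 then H z = (B (fan t i) ! 2) (norm z) else H z = piece (fan t i) (polar n (norm z) x) \<and> H z \<in> fan t i"
    if z: "norm z < 1" and x: "x \<in> {0..<1}" and eq: "z = polar n (norm z) (x + real i + 1/3)" for z i x
  proof -
    have Hz: "H z = piece (fan t i) (polar n (norm z) x)"
      using Hpolar[of "norm z" x i] z x eq by simp
    show ?thesis
    proof (cases "x = 0 \<or> norm z = 0")
      case True
      then have "polar n (norm z) x = polar n (norm z) 0" by auto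
      then show ?thesis using Hz True piece0[of "norm z" i] z by auto
    next
      case False
      then have "\<Phi> (polar n (norm z) x) \<in> ball 0 1" using z x by (intro \<Phi>in) auto
      then have "\<Phi> (polar n (norm z) x) * polar 5 1 2 \<in> ball 0 1" using rot by simp
      then have "piece (fan t i) (polar n (norm z) x) \<in> fan t i"
        unfolding piece_def shifted_chart_def using chart_ball[OF ft, of i] by blast
      then show ?thesis using False Hz by simp
    qed
  qed
  have inj: "inj_on H (ball 0 1)"
  proof (rule inj_onI)
    fix y z assume y: "y \<in> ball 0 1" and z: "z \<in> ball 0 1" and eq: "H y = H z"
    obtain i x where i: "i < n" "x \<in> {0..<1}" "y = polar n (norm y) (x + real i + 1/3)" using normal by blast
    obtain i' x' where i': "i' < n" "x' \<in> {0..<1}" "z = polar n (norm z) (x' + real i' + 1/3)" using normal by blast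
    have ny: "norm y < 1" and nz: "norm z < 1" using y z by auto
    note vy = H_value[OF ny i(2,3)] and vz = H_value[OF nz i'(2,3)]
    \<comment> \<open>Inner points of pentagons miss the skeleton, so a spoke point and an inner
      point never have the same image.\<close>
    have off: "\<not> (H u = (B (fan t k) ! 2) r \<and> H u \<in> fan t k')" if "r \<in> {0..1}" for u k k' r
      using edge_in_skeleton[OF side[OF ft, of 2 k] that] tile_subset[OF ft, of k'] by auto
    show "y = z"
    proof (cases "x = 0 \<or> norm y = 0")
      case y0: True
      then have Hy: "H y = (B (fan t i) ! 2) (norm y)" using vy by simp
      have z0: "x' = 0 \<or> norm z = 0"
        using vz Hy eq off[of "norm y" z i i'] ny by (auto split: if_splits)
      then have Hz: "H z = (B (fan t i') ! 2) (norm z)" using vz by simp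
      \<comment> \<open>\<open>sides_meet\<close> needs an interior parameter, so the centre is
        treated separately.\<close>
      have meet: "norm y = norm z \<and> fan t i = fan t i'" if "norm y > 0 \<or> norm z > 0"
        using that sides_meet[OF ft ft, of 2 2 "norm y" "norm z" i i'] sides_meet[OF ft ft, of 2 2 "norm z" "norm y" i' i]
          Hy Hz eq ny nz by auto
      show ?thesis
      proof (cases "norm y > 0 \<or> norm z > 0")
        case True
        then have "norm y = norm z" "fan t i = fan t i'" using meet by blast+
        then have "i = i'" using fan_inj[OF t] i(1) i'(1) by (auto simp: n_def dest: inj_onD)
        moreover have "x = 0" "x' = 0" using y0 z0 True \<open>norm y = norm z\<close> by auto
        ultimately show ?thesis using i(3) i'(3) \<open>norm y = norm z\<close> by metis
      qed auto
    next
      case y1: False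
      then have Hy: "H y = piece (fan t i) (polar n (norm y) x)" "H y \<in> fan t i" using vy by auto
      have z1: "\<not> (x' = 0 \<or> norm z = 0)"
        using vz Hy eq off[of "norm z" z i' i] nz by (auto split: if_splits)
      then have Hz: "H z = piece (fan t i') (polar n (norm z) x')" "H z \<in> fan t i'" using vz by auto
      have ff: "fan t i = fan t i'" using tile_disjoint[OF ft ft Hy(2)] Hz(2) eq by simp
      then have ii: "i = i'" using fan_inj[OF t] i(1) i'(1) by (auto simp: n_def dest: inj_onD)
      have "\<Phi> (polar n (norm y) x) \<in> ball 0 1" "\<Phi> (polar n (norm z) x') \<in> ball 0 1"
        using \<Phi>in[of "norm y" x] \<Phi>in[of "norm z" x'] y1 z1 ny nz i(2) i'(2) by auto
      then have "\<Phi> (polar n (norm y) x) * polar 5 1 2 = \<Phi> (polar n (norm z) x') * polar 5 1 2"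
        using Hy(1) Hz(1) eq ff rot by (intro inj_onD[OF chart_inj[OF ft, of i']]) (auto simp: piece_def shifted_chart_def)
      then have "\<Phi> (polar n (norm y) x) = \<Phi> (polar n (norm z) x')" by (simp add: polar_def)
      moreover have "polar n (norm y) x \<in> sector n" "polar n (norm z) x' \<in> sector n"
        using ny nz i(2) i'(2) by (auto intro!: sec)
      ultimately have "polar n (norm y) x = polar n (norm z) x'" using \<Phi>(2) by (auto dest: inj_onD)
      then have "P i (polar n (norm y) x) = P i' (polar n (norm z) x')" using ii by simp
      then show ?thesis using i(3) i'(3) unfolding P_polar by simp
    qed
  qed
  have image: "H ` ball 0 1 = cell w"
  proof (intro equalityI subsetI)
    fix y assume "y \<in> H ` ball 0 1"
    then obtain z where z: "norm z < 1" "y = H z" by auto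
    obtain i x where "x \<in> {0..<1}" "z = polar n (norm z) (x + real i + 1/3)" using normal by blast
    then have "y \<in> fan t i \<union> (B (fan t i) ! 2) ` {0..<1}" using H_value[OF z(1), of x i] z by (auto split: if_splits)
    then show "y \<in> cell w" unfolding cell_def w_def using ft fan_circle[OF t, of i] by blast
  next
    fix y assume "y \<in> cell w"
    then obtain q where q: "q \<in> tiles S \<Gamma>" "pathstart (B q ! 2) = w" "y \<in> q \<union> (B q ! 2) ` {0..<1}"
      unfolding cell_def by blast
    obtain i where i: "i < period t" "q = fan t i" using fan_cover[OF t q(1)] q(2) unfolding w_def .
    have "\<exists>r x. r \<in> {0..<1} \<and> x \<in> {0..1} \<and> y = piece (fan t i) (polar n r x)"
    proof (cases "y \<in> q")
      case True
      then obtain \<zeta> where \<zeta>: "\<zeta> \<in> ball 0 1" "y = chart q \<zeta>" using chart_ball[OF q(1)] by blast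
      have "\<zeta> * polar 5 1 (-2) \<in> cball 0 1" using \<zeta>(1) by (simp add: norm_mult)
      then obtain z where z: "z \<in> sector n" "\<zeta> * polar 5 1 (-2) = \<Phi> z" using \<Phi>(3) by (metis imageE)
      obtain r x where rx: "z = polar n r x" "r \<in> {0..1}" "x \<in> {0..1}" using z(1) unfolding sector_def by blast
      have "\<Phi> z * polar 5 1 2 = \<zeta>"
        unfolding z(2)[symmetric] by (simp add: mult.assoc polar_mult_polar) (simp add: polar_def)
      then have y: "y = piece (fan t i) z" using \<zeta> i by (simp add: piece_def shifted_chart_def)
      have "norm (\<Phi> z) < 1" unfolding z(2)[symmetric] using \<zeta>(1) by (simp add: norm_mult)
      \<comment> \<open>The arc is sent to the circle, hence a point coming from the open pentagon
        is not on it.\<close>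
      then have "r \<noteq> 1" using \<Phi>arc[OF rx(3)] rx(1) by auto
      then show ?thesis using y rx by (intro exI[of _ r] exI[of _ x]) auto
    next
      case False
      then obtain r where "r \<in> {0..<1}" "y = (B q ! 2) r" using q(3) by blast
      then show ?thesis using piece0[of r i] i(2) by (intro exI[of _ r] exI[of _ 0]) auto
    qed
    then obtain r x where rx: "r \<in> {0..<1}" "x \<in> {0..1}" "y = piece (fan t i) (polar n r x)" by blast
    then have "y = H (polar n r (x + real i + 1/3))" using Hpolar[of r x i] by simp
    then show "y \<in> H ` ball 0 1" using rx(1) by (intro image_eqI) auto
  qed
  have boundary: "H (polar n 1 (real j + s)) = coarse (fan t j) s" if j: "j < n" and s: "s \<in> {0..1}" for j s
  proof (cases "s \<ge> 1/3")
    case True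
    then show ?thesis using Hpolar[of 1 "s - 1/3" j] piece_arc[of "s - 1/3" j] s by (simp add: algebra_simps)
  next
    case False
    \<comment> \<open>The first third of edge \<open>j\<close> lies on the preceding sector. Its
      index is written \<open>j + n - 1\<close> so that \<open>j = 0\<close> is included.\<close>
    have "fan t (Suc (j + n - 1)) = fan t j"
      using n0 by (intro fan_cong[OF t, of _ _ 1]) (simp add: n_def)
    moreover have "s + 2/3 + real (j + n - 1) + 1/3 = (real j + s) + real n * of_int 1"
      using n0 by (simp add: of_nat_diff)
    then have "polar n 1 (s + 2/3 + real (j + n - 1) + 1/3) = polar n 1 (real j + s)"
      by (simp only: polar_add_int[OF n0])
    ultimately show ?thesis using Hpolar[of 1 "s + 2/3" "j + n - 1"] piece_arc'[of "s + 2/3" "j + n - 1"] False s by simp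
  qed
  show thesis
  proof (rule that)
    show "continuous_on (cball 0 1) H" using H cover by simp
    show "inj_on H (ball 0 1)" by (rule inj)
    show "H ` ball 0 1 = cell (pathstart (B t ! 2))" using image unfolding w_def .
    show "H (polar (period t) 1 (real j + s)) = coarse (fan t j) s" if "j < period t" "s \<in> {0..1}" for j s
      using boundary that unfolding n_def by blast
  qed
qed

lemma cell_subset: "cell w \<subseteq> S"
proof -
  have "t \<union> (B t ! 2) ` {0..<1} \<subseteq> S" if "t \<in> tiles S \<Gamma>" for t
    using tile_subset[OF that] edge_in_surface[OF side[OF that, of 2]] unfolding path_image_def by auto
  then show ?thesis unfolding cell_def by blast
qed

text \<open>Inside side 2 only sides of index 2 or \<open>mirror 2\<close>, that is 1, can pass,
  whereas coarse edges consist of sides 3 and 4 up to direction. The circle itself is excluded by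
  its label.\<close>

lemma cell_coarse_disjoint: "cell w \<inter> coarse_skeleton = {}"
proof -
  have False if y: "y \<in> cell w" "y \<in> coarse_skeleton" for y
  proof -
    obtain t where t: "t \<in> tiles S \<Gamma>" "pathstart (B t ! 2) = w" "y \<in> t \<union> (B t ! 2) ` {0..<1}"
      using y(1) unfolding cell_def by blast
    obtain q s where q: "q \<in> tiles S \<Gamma>" "s \<in> {0..1}" "y = coarse q s" using y(2) unfolding coarse_skeleton_iff by blast
    obtain q' j u where q': "q' \<in> tiles S \<Gamma>" "j \<in> {3, 4}" "u \<in> {0..1}" "y = (B q' ! j) u"
      using coarse_piece[OF q(1,2)] q(3) by metis
    have j: "j < 5" using q'(2) by auto
    have "y \<in> skeleton" using edge_in_skeleton[OF side[OF q'(1) j] q'(3)] q'(4) by simp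
    then have "y \<notin> t" using tile_subset[OF t(1)] by blast
    then obtain r where r: "r \<in> {0..<1}" "y = (B t ! 2) r" using t(3) by blast
    show False
    proof (cases "r = 0")
      case False
      then show ?thesis using sides_meet[OF t(1) q'(1) _ j, of 2 r u] r q' by auto
    next
      case True
      then have yw: "y = w" using r t(2) by (simp add: pathstart_def)
      then have "y \<in> vertices \<Gamma>" using pathstart_in_vertices[OF side[OF t(1), of 2]] t(2) by simp
      then have "s \<in> {0, 1/3, 2/3, 1}" using coarse_vertex[OF q(1,2)] q(3) by simp
      then have "y \<in> {coarse q 0, coarse q (1/3), coarse q (2/3), coarse q 1}" using q(3) by blast
      then have "label y \<noteq> 1"
        unfolding coarse_points[OF q(1)] using label_side[OF q(1)] label_side[OF opp(1)[OF q(1)]] by auto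
      then show ?thesis using yw label_side(3)[OF t(1)] t(2) by simp
    qed
  qed
  then show ?thesis by blast
qed

lemma cell_disjoint:
  assumes "y \<in> cell w" "y \<in> cell w'"
  shows "w = w'"
proof -
  obtain t where t: "t \<in> tiles S \<Gamma>" "pathstart (B t ! 2) = w" "y \<in> t \<union> (B t ! 2) ` {0..<1}"
    using assms(1) unfolding cell_def by blast
  obtain q where q: "q \<in> tiles S \<Gamma>" "pathstart (B q ! 2) = w'" "y \<in> q \<union> (B q ! 2) ` {0..<1}"
    using assms(2) unfolding cell_def by blast
  have sk: "(B p ! 2) ` {0..<1} \<subseteq> skeleton" if "p \<in> tiles S \<Gamma>" for p
    using edge_in_skeleton[OF side[OF that, of 2]] by auto
  show ?thesis
  proof (cases "y \<in> skeleton")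
    case False
    then have "y \<in> t" "y \<in> q" using t q sk by blast+
    then show ?thesis using tile_disjoint[OF t(1) q(1), of y] t(2) q(2) by simp
  next
    case True
    then obtain r r' where r: "r \<in> {0..<1}" "y = (B t ! 2) r" "r' \<in> {0..<1}" "y = (B q ! 2) r'"
      using t(1,3) q(1,3) tile_subset by blast
    show ?thesis
    proof (cases "r = 0 \<and> r' = 0")
      case True
      then show ?thesis using r t(2) q(2) by (auto simp: pathstart_def)
    next
      case False
      then have "t = q"
        using sides_meet[OF t(1) q(1), of 2 2 r r'] sides_meet[OF q(1) t(1), of 2 2 r' r] r by auto
      then show ?thesis using t q by simp
    qed
  qed
qed

lemma side_34_in_coarse_skeleton:
  assumes t: "t \<in> tiles S \<Gamma>" and s: "s \<in> {0..1}"
  shows "(B t ! 3) s \<in> coarse_skeleton" "(B t ! 4) s \<in> coarse_skeleton"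
proof -
  have e: "3 * ((1 + s) / 3) - 1 = s" "3 * ((2 + s) / 3) - 2 = s" by (simp_all add: field_simps)
  have "(B t ! 3) s = coarse t ((1 + s) / 3)" using s coarse_middle[OF t, of "(1 + s) / 3"] unfolding e by simp
  moreover have "(B t ! 4) s = coarse t ((2 + s) / 3)" using s coarse_last[OF t, of "(2 + s) / 3"] unfolding e by simp
  moreover have "(1 + s) / 3 \<in> {0..1}" "(2 + s) / 3 \<in> {0..1}" using s by auto
  ultimately show "(B t ! 3) s \<in> coarse_skeleton" "(B t ! 4) s \<in> coarse_skeleton"
    unfolding coarse_skeleton_iff using t by metis+
qed

text \<open>Up to reversal every side has index 2, 3 or 4. Sides 3 and 4 make up the coarse edges,
  and sides 2 are the spokes inside the cells.\<close>

lemma cells_cover: "S - coarse_skeleton = (\<Union>w\<in>(\<lambda>t. pathstart (B t ! 2)) ` tiles S \<Gamma>. cell w)"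
proof (intro equalityI subsetI)
  fix y assume y: "y \<in> S - coarse_skeleton"
  have "\<exists>t\<in>tiles S \<Gamma>. y \<in> t \<union> (B t ! 2) ` {0..<1}"
  proof (cases "y \<in> skeleton")
    case False
    then have "y \<in> \<Union> (tiles S \<Gamma>)" unfolding tiles_eq using y by simp
    then show ?thesis by blast
  next
    case True
    then obtain \<gamma> s where "\<gamma> \<in> \<Gamma>" and s: "s \<in> {0..1}" and ys: "y = \<gamma> s" unfolding skeleton_def path_image_def by blast
    then obtain t j where t: "t \<in> tiles S \<Gamma>" and j: "j < 5" and yj: "y = (B t ! j) s" using side_cover by metis
    have s': "1 - s \<in> {0..1}" using s by auto
    \<comment> \<open>The end of side 2 is the start of side 3 and so lies on the coarse
      skeleton.\<close>
    have two: ?thesis if q: "q \<in> tiles S \<Gamma>" and u: "u \<in> {0..1}" and yq: "y = (B q ! 2) u" for q u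
    proof -
      have "u \<noteq> 1"
      proof
        assume "u = 1"
        then have "y = (B q ! 3) 0" using yq side_finish(3)[OF q] by (simp add: pathstart_def pathfinish_def)
        then show False using side_34_in_coarse_skeleton(1)[OF q, of 0] y by simp
      qed
      then show ?thesis using q u yq by (intro bexI[OF _ q]) auto
    qed
    have mirrored: "y = (B (across t j) ! mirror j) (1 - s)"
      unfolding across(2)[OF t j] yj by (simp add: reversepath_def)
    note q = across(1)[OF t j]
    consider "j = 0" | "j = 1" | "j = 2" | "j = 3" | "j = 4" using j by linarith
    then show ?thesis
    proof cases
      case 1
      then show ?thesis using mirrored side_34_in_coarse_skeleton(2)[OF q s'] y by simp
    next
      case 2
      then show ?thesis using mirrored two[OF q s'] by simp
    next
      case 3
      then show ?thesis using two[OF t s] yj by simp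
    next
      case 4
      then show ?thesis using yj side_34_in_coarse_skeleton(1)[OF t s] y by simp
    next
      case 5
      then show ?thesis using yj side_34_in_coarse_skeleton(2)[OF t s] y by simp
    qed
  qed
  then show "y \<in> (\<Union>w\<in>(\<lambda>t. pathstart (B t ! 2)) ` tiles S \<Gamma>. cell w)" unfolding cell_def by blast
next
  fix y assume "y \<in> (\<Union>w\<in>(\<lambda>t. pathstart (B t ! 2)) ` tiles S \<Gamma>. cell w)"
  then show "y \<in> S - coarse_skeleton" using cell_subset cell_coarse_disjoint by blast
qed

lemma circle_in_cell: "t \<in> tiles S \<Gamma> \<Longrightarrow> pathstart (B t ! 2) \<in> cell (pathstart (B t ! 2))"
  unfolding cell_def pathstart_def by force

lemma cell_chart_sphere:
  assumes t: "t \<in> tiles S \<Gamma>"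
    and H: "\<And>j s. \<lbrakk>j < period t; s \<in> {0..1}\<rbrakk> \<Longrightarrow> H (polar (period t) 1 (real j + s)) = coarse (fan t j) s"
  shows "H ` sphere 0 1 \<subseteq> coarse_skeleton"
proof (rule image_subsetI)
  fix z :: complex assume "z \<in> sphere 0 1"
  then have "norm z = 1" by simp
  then obtain j s where "j < period t" "s \<in> {0..<1}" "z = polar (period t) 1 (real j + s)"
    using cball_frontier_polar[OF period(1)[OF t]] by blast
  then have "H z = coarse (fan t j) s" "s \<in> {0..1}" using H by auto
  then show "H z \<in> coarse_skeleton" unfolding coarse_skeleton_iff using fan_tile[OF t] by blast
qed

lemma cell_walk:
  assumes t: "t \<in> tiles S \<Gamma>"
  shows "boundary_walk (cell (pathstart (B t ! 2))) (map (\<lambda>i. coarse (fan t i)) [0..<period t])"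
proof -
  obtain H where H: "continuous_on (cball 0 1) H" "inj_on H (ball 0 1)" "H ` ball 0 1 = cell (pathstart (B t ! 2))"
    "\<And>j s. \<lbrakk>j < period t; s \<in> {0..1}\<rbrakk> \<Longrightarrow> H (polar (period t) 1 (real j + s)) = coarse (fan t j) s"
    by (rule cell_chart[OF t], rule that) blast+
  show ?thesis
  proof (rule boundary_walkI[OF H(1-3)])
    show "H ` sphere 0 1 \<inter> cell (pathstart (B t ! 2)) = {}"
      using cell_chart_sphere[OF t H(4)] cell_coarse_disjoint by blast
  qed (use H(4) in auto)
qed

lemma coarse_tiles: "tiles S coarse_graph = cell ` (\<lambda>t. pathstart (B t ! 2)) ` tiles S \<Gamma>"
  unfolding tiles_def[of S coarse_graph] coarse_skeleton_def[symmetric]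
proof (rule components_eqI)
  show "finite (cell ` (\<lambda>t. pathstart (B t ! 2)) ` tiles S \<Gamma>)" using finite_tiles by simp
  show "\<Union> (cell ` (\<lambda>t. pathstart (B t ! 2)) ` tiles S \<Gamma>) = S - coarse_skeleton" using cells_cover by simp
  show "A \<inter> A' = {}" if AA: "A \<in> cell ` (\<lambda>t. pathstart (B t ! 2)) ` tiles S \<Gamma>"
    "A' \<in> cell ` (\<lambda>t. pathstart (B t ! 2)) ` tiles S \<Gamma>" "A \<noteq> A'" for A A'
  proof -
    obtain w w' where "A = cell w" "A' = cell w'" using AA(1,2) by blast
    then show ?thesis using AA(3) cell_disjoint by (metis disjoint_iff)
  qed
  fix A assume "A \<in> cell ` (\<lambda>t. pathstart (B t ! 2)) ` tiles S \<Gamma>"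
  then obtain t where t: "t \<in> tiles S \<Gamma>" and A: "A = cell (pathstart (B t ! 2))" by blast
  show "A \<noteq> {}" using circle_in_cell[OF t] A by blast
  obtain H where H0: "continuous_on (cball 0 1) H" "inj_on H (ball 0 1)" "H ` ball 0 1 = cell (pathstart (B t ! 2))"
    "\<And>j s. \<lbrakk>j < period t; s \<in> {0..1}\<rbrakk> \<Longrightarrow> H (polar (period t) 1 (real j + s)) = coarse (fan t j) s"
    by (rule cell_chart[OF t], rule that) blast+
  have H: "continuous_on (cball 0 1) H" "H ` ball 0 1 = A" using H0(1,3) A by simp_all
  show "connected A" unfolding H(2)[symmetric]
    by (intro connected_continuous_image continuous_on_subset[OF H(1)]) auto
  have "compact (H ` cball 0 1)" by (intro compact_continuous_image H(1) compact_cball)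
  then have "closed (H ` cball 0 1)" by (rule compact_imp_closed)
  \<comment> \<open>Relative to the complement of the coarse skeleton, the cell equals its closed
    disk, because the circle goes into the skeleton.\<close>
  moreover have "A = (S - coarse_skeleton) \<inter> H ` cball 0 1"
  proof (intro equalityI subsetI)
    fix y assume y: "y \<in> (S - coarse_skeleton) \<inter> H ` cball 0 1"
    then obtain z where z: "z \<in> cball 0 1" "y = H z" by blast
    then have "z \<notin> sphere 0 1" using cell_chart_sphere[OF t H0(4)] y by blast
    then show "y \<in> A" using z H(2) by auto
  next
    fix y assume y: "y \<in> A"
    then show "y \<in> (S - coarse_skeleton) \<inter> H ` cball 0 1"
      using cell_subset cell_coarse_disjoint unfolding A using H(2) A ball_subset_cball by blast
  qed
  ultimately show "closedin (top_of_set (S - coarse_skeleton)) A" unfolding closedin_closed by blast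
qed

end

lemma course_cong: "(\<And>s. s \<in> {0..1} \<Longrightarrow> p s = q s) \<Longrightarrow> course p = course q"
  unfolding course_def path_image_def pathstart_def pathfinish_def by force

section \<open>The given tiling as the subdivision of the coarse tiling\<close>

context pentagon_pattern
begin

text \<open>Any pentagon of the cell may serve; the choice only fixes where the coarse walk
  starts.\<close>

definition base :: "'a set \<Rightarrow> 'a set" where
  "base c = (SOME t. t \<in> tiles S \<Gamma> \<and> cell (pathstart (B t ! 2)) = c)"

definition coarse_walk :: "'a set \<Rightarrow> (real \<Rightarrow> 'a) list" where
  "coarse_walk c = map (\<lambda>i. coarse (fan (base c) i)) [0..<period (base c)]"

definition coarse_center :: "'a set \<Rightarrow> 'a" where "coarse_center c = pathstart (B (base c) ! 2)"

text \<open>\<open>subdivision_data\<close> indexes spokes by directed edges, and since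
  \<open>coarse\<close> is injective the edge determines its pentagon.\<close>

definition coarse_spoke :: "(real \<Rightarrow> 'a) \<Rightarrow> real \<Rightarrow> 'a" where
  "coarse_spoke \<gamma> = B (the_inv_into (tiles S \<Gamma>) coarse \<gamma>) ! 2"

lemma base:
  assumes "c \<in> tiles S coarse_graph"
  shows "base c \<in> tiles S \<Gamma>" "cell (coarse_center c) = c"
proof -
  have "\<exists>t. t \<in> tiles S \<Gamma> \<and> cell (pathstart (B t ! 2)) = c" using assms unfolding coarse_tiles by blast
  from someI_ex[OF this, folded base_def]
  show "base c \<in> tiles S \<Gamma>" "cell (coarse_center c) = c" unfolding coarse_center_def by blast+
qed

lemma coarse_center_cell:
  assumes "t \<in> tiles S \<Gamma>"
  shows "cell (pathstart (B t ! 2)) \<in> tiles S coarse_graph" "coarse_center (cell (pathstart (B t ! 2))) = pathstart (B t ! 2)"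
proof -
  show c: "cell (pathstart (B t ! 2)) \<in> tiles S coarse_graph" unfolding coarse_tiles using assms by blast
  show "coarse_center (cell (pathstart (B t ! 2))) = pathstart (B t ! 2)"
    using base(2)[OF c] circle_in_cell[OF assms] cell_disjoint by metis
qed

lemma coarse_spoke: "t \<in> tiles S \<Gamma> \<Longrightarrow> coarse_spoke (coarse t) = B t ! 2"
  unfolding coarse_spoke_def by (simp add: the_inv_into_f_f[OF inj_coarse])

lemma length_coarse_walk: "length (coarse_walk c) = period (base c)"
  by (simp add: coarse_walk_def)

lemma nth_coarse_walk: "j < length (coarse_walk c) \<Longrightarrow> coarse_walk c ! j = coarse (fan (base c) j)"
  by (simp add: coarse_walk_def)

lemma coarse_walk_fan:
  assumes c: "c \<in> tiles S coarse_graph" and "\<gamma> \<in> set (coarse_walk c)"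
  obtains t where "t \<in> tiles S \<Gamma>" "pathstart (B t ! 2) = coarse_center c" "\<gamma> = coarse t"
proof -
  obtain i where "\<gamma> = coarse (fan (base c) i)" using assms(2) unfolding coarse_walk_def by auto
  then show thesis
    using that[of "fan (base c) i"] fan_tile[OF base(1)[OF c]] fan_circle[OF base(1)[OF c], of i]
    unfolding coarse_center_def by blast
qed

text \<open>Directed coarse edges correspond to pentagons. Each pentagon has one place in the fan
  around its circle, and the circle determines the cell; this gives the bijection.\<close>

lemma oriented_coarse: "oriented_tiling S coarse_graph coarse_walk"
proof -
  have walk: "set (coarse_walk c) \<subseteq> coarse_graph \<and> 3 \<le> length (coarse_walk c) \<and> boundary_walk c (coarse_walk c)"
    if c: "c \<in> tiles S coarse_graph" for c
  proof (intro conjI)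
    show "set (coarse_walk c) \<subseteq> coarse_graph"
      using fan_tile[OF base(1)[OF c]] unfolding coarse_walk_def coarse_graph_def by auto
    show "3 \<le> length (coarse_walk c)" using period_ge_3[OF base(1)[OF c]] by (simp add: length_coarse_walk)
    show "boundary_walk c (coarse_walk c)"
      using cell_walk[OF base(1)[OF c]] base(2)[OF c] unfolding coarse_walk_def coarse_center_def by simp
  qed
  have "bij_betw (\<lambda>(c, j). coarse_walk c ! j) (SIGMA c:tiles S coarse_graph. {..<length (coarse_walk c)}) coarse_graph"
    unfolding bij_betw_def
  proof
    show "inj_on (\<lambda>(c, j). coarse_walk c ! j) (SIGMA c:tiles S coarse_graph. {..<length (coarse_walk c)})"
    proof (rule inj_onI)
      fix x y assume x: "x \<in> (SIGMA c:tiles S coarse_graph. {..<length (coarse_walk c)})"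
        and y: "y \<in> (SIGMA c:tiles S coarse_graph. {..<length (coarse_walk c)})"
        and eq: "(\<lambda>(c, j). coarse_walk c ! j) x = (\<lambda>(c, j). coarse_walk c ! j) y"
      obtain c j c' j' where xy: "x = (c, j)" "y = (c', j')" by fastforce
      have c: "c \<in> tiles S coarse_graph" "c' \<in> tiles S coarse_graph"
        and j: "j < length (coarse_walk c)" "j' < length (coarse_walk c')" using x y by (auto simp: xy)
      note b = base(1)[OF c(1)] and b' = base(1)[OF c(2)]
      have "coarse (fan (base c) j) = coarse (fan (base c') j')"
        using eq j by (simp add: xy nth_coarse_walk)
      then have f: "fan (base c) j = fan (base c') j'"
        using inj_onD[OF inj_coarse] fan_tile[OF b] fan_tile[OF b'] by blast
      then have "coarse_center c = coarse_center c'"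
        using fan_circle[OF b, of j] fan_circle[OF b', of j'] unfolding coarse_center_def by simp
      then have cc: "c = c'" using base(2) c by metis
      then have "j = j'" using f j inj_onD[OF fan_inj[OF b]] by (simp add: length_coarse_walk)
      then show "x = y" using cc xy by simp
    qed
    show "(\<lambda>(c, j). coarse_walk c ! j) ` (SIGMA c:tiles S coarse_graph. {..<length (coarse_walk c)}) = coarse_graph"
    proof (intro equalityI subsetI)
      fix \<gamma> assume "\<gamma> \<in> (\<lambda>(c, j). coarse_walk c ! j) ` (SIGMA c:tiles S coarse_graph. {..<length (coarse_walk c)})"
      then obtain c j where "c \<in> tiles S coarse_graph" "j < length (coarse_walk c)" "\<gamma> = coarse_walk c ! j" by auto
      then show "\<gamma> \<in> coarse_graph" using walk nth_mem by blast
    next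
      fix \<gamma> assume "\<gamma> \<in> coarse_graph"
      then obtain t where t: "t \<in> tiles S \<Gamma>" "\<gamma> = coarse t" unfolding coarse_graph_def by blast
      define c where "c = cell (pathstart (B t ! 2))"
      have c: "c \<in> tiles S coarse_graph" "coarse_center c = pathstart (B t ! 2)"
        using coarse_center_cell[OF t(1)] unfolding c_def by blast+
      then obtain i where i: "i < period (base c)" "t = fan (base c) i"
        using fan_cover[OF base(1)[OF c(1)] t(1)] unfolding coarse_center_def by metis
      then have "\<gamma> = coarse_walk c ! i" using t(2) nth_coarse_walk[of i c] by (simp add: length_coarse_walk)
      then show "\<gamma> \<in> (\<lambda>(c, j). coarse_walk c ! j) ` (SIGMA c:tiles S coarse_graph. {..<length (coarse_walk c)})"
        using c(1) i(1) by (intro image_eqI[of _ _ "(c, i)"]) (auto simp: length_coarse_walk)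
    qed
  qed
  then show ?thesis unfolding oriented_tiling_def tiling_def
    using embedded_coarse coarse_degree walk by blast
qed

lemma coarse_segments:
  assumes t: "t \<in> tiles S \<Gamma>"
  shows "course (first_segment (\<lambda>_. 1/3) (coarse t)) = course (reversepath (B (opp t) ! 4))"
    "course (middle_segment (\<lambda>_. 1/3) (coarse t)) = course (B t ! 3)"
    "course (last_segment (\<lambda>_. 1/3) (coarse t)) = course (B t ! 4)"
proof -
  show "course (first_segment (\<lambda>_. 1/3) (coarse t)) = course (reversepath (B (opp t) ! 4))"
  proof (rule course_cong)
    fix s :: real assume s: "s \<in> {0..1}"
    have "first_segment (\<lambda>_. 1/3) (coarse t) s = coarse t (s / 3)" by (simp add: first_segment_def linepath_def)
    also have "\<dots> = (B (opp t) ! 4) (1 - 3 * (s / 3))" using s by (intro coarse_first) auto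
    finally show "first_segment (\<lambda>_. 1/3) (coarse t) s = reversepath (B (opp t) ! 4) s" by (simp add: reversepath_def)
  qed
  show "course (middle_segment (\<lambda>_. 1/3) (coarse t)) = course (B t ! 3)"
  proof (rule course_cong)
    fix s :: real assume s: "s \<in> {0..1}"
    have e: "linepath (1/3) (2/3) s = (1 + s) / 3" by (simp add: linepath_def field_simps)
    have "middle_segment (\<lambda>_. 1/3) (coarse t) s = coarse t ((1 + s) / 3)" by (simp add: middle_segment_def e)
    also have "\<dots> = (B t ! 3) (3 * ((1 + s) / 3) - 1)" using s by (intro coarse_middle[OF t]) auto
    also have "3 * ((1 + s) / 3) - 1 = s" by (simp add: field_simps)
    finally show "middle_segment (\<lambda>_. 1/3) (coarse t) s = (B t ! 3) s" .
  qed
  show "course (last_segment (\<lambda>_. 1/3) (coarse t)) = course (B t ! 4)"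
  proof (rule course_cong)
    fix s :: real assume s: "s \<in> {0..1}"
    have e: "linepath (2/3) 1 s = (2 + s) / 3" by (simp add: linepath_def field_simps)
    have "last_segment (\<lambda>_. 1/3) (coarse t) s = coarse t ((2 + s) / 3)" by (simp add: last_segment_def e)
    also have "\<dots> = (B t ! 4) (3 * ((2 + s) / 3) - 2)" using s by (intro coarse_last[OF t]) auto
    also have "3 * ((2 + s) / 3) - 2 = s" by (simp add: field_simps)
    finally show "last_segment (\<lambda>_. 1/3) (coarse t) s = (B t ! 4) s" .
  qed
qed

text \<open>Interior points are excluded by the disjointness of edges, and common far ends by
  \<open>dividing_unique\<close>.\<close>

lemma spokes_meet:
  assumes t: "t \<in> tiles S \<Gamma>" and q: "q \<in> tiles S \<Gamma>" and w: "pathstart (B t ! 2) = w" "pathstart (B q ! 2) = w"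
    and ne: "t \<noteq> q"
  shows "path_image (B t ! 2) \<inter> path_image (B q ! 2) = {w}"
proof -
  have "y = w" if y: "y \<in> path_image (B t ! 2)" "y \<in> path_image (B q ! 2)" for y
  proof -
    obtain r where r: "r \<in> {0..1}" "y = (B t ! 2) r" using y(1) unfolding path_image_def by blast
    obtain r' where r': "r' \<in> {0..1}" "y = (B q ! 2) r'" using y(2) unfolding path_image_def by blast
    have "r \<notin> {0<..<1}" using sides_meet[OF t q, of 2 2 r r'] r r' ne by auto
    moreover have "r' \<notin> {0<..<1}" using sides_meet[OF q t, of 2 2 r' r] r r' ne by auto
    moreover have "\<not> (r = 1 \<and> r' = 1)"
    proof
      assume "r = 1 \<and> r' = 1"
      then have "pathfinish (B t ! 2) = pathfinish (B q ! 2)" using r r' by (simp add: pathfinish_def)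
      then show False using dividing_unique[OF t q] side_finish(3)[OF t] side_finish(3)[OF q] ne by simp
    qed
    ultimately have "r = 0 \<or> r' = 0" using r r' by auto
    then show "y = w" using r r' w by (auto simp: pathstart_def)
  qed
  moreover have "w \<in> path_image (B t ! 2)" "w \<in> path_image (B q ! 2)" using w pathstart_in_path_image by metis+
  ultimately show ?thesis by blast
qed

lemma coarse_subdivision_data:
  "subdivision_data S coarse_graph coarse_walk (\<lambda>_. 1/3) coarse_center coarse_spoke"
  unfolding subdivision_data_def
proof (intro conjI ballI impI)
  fix c assume c: "c \<in> tiles S coarse_graph"
  show "coarse_center c \<in> c" using circle_in_cell[OF base(1)[OF c]] base(2)[OF c] unfolding coarse_center_def by simp
  fix \<gamma> assume "\<gamma> \<in> set (coarse_walk c)"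
  then obtain t where t: "t \<in> tiles S \<Gamma>" "pathstart (B t ! 2) = coarse_center c" "\<gamma> = coarse t"
    using coarse_walk_fan[OF c] by blast
  \<comment> \<open>The labels of the two ends differ, so the side is an arc and not a loop.\<close>
  have "pathfinish (B t ! 2) \<noteq> pathstart (B t ! 2)"
    using label_side[OF t(1)] side_finish(3)[OF t(1)] by auto
  then have "arc (B t ! 2)" using edge_simple[OF side[OF t(1), of 2]] by (simp add: arc_simple_path)
  then show "arc (coarse_spoke \<gamma>)" unfolding t(3) coarse_spoke[OF t(1)] .
  show "pathstart (coarse_spoke \<gamma>) = coarse_center c" unfolding t(3) coarse_spoke[OF t(1)] by (rule t(2))
  show "pathfinish (coarse_spoke \<gamma>) = \<gamma> (1/3)"
    unfolding t(3) coarse_spoke[OF t(1)] coarse_points(2)[OF t(1)] by (rule side_finish(3)[OF t(1)])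
  have "(B t ! 2) ` {0..<1} \<subseteq> cell (coarse_center c)" unfolding cell_def using t(1,2) by blast
  then show "coarse_spoke \<gamma> ` {0..<1} \<subseteq> c" unfolding t(3) coarse_spoke[OF t(1)] base(2)[OF c] .
  fix \<delta> assume "\<delta> \<in> set (coarse_walk c)" and ne: "\<gamma> \<noteq> \<delta>"
  then obtain q where q: "q \<in> tiles S \<Gamma>" "pathstart (B q ! 2) = coarse_center c" "\<delta> = coarse q"
    using coarse_walk_fan[OF c] by blast
  show "path_image (coarse_spoke \<gamma>) \<inter> path_image (coarse_spoke \<delta>) = {coarse_center c}"
    unfolding t(3) q(3) coarse_spoke[OF t(1)] coarse_spoke[OF q(1)]
    by (rule spokes_meet[OF t(1) q(1) t(2) q(2)]) (use ne t(3) q(3) in blast)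
qed simp_all

lemma coarse_courses:
  "course ` \<Gamma> = course ` (\<Union>\<gamma>\<in>coarse_graph. {first_segment (\<lambda>_. 1/3) \<gamma>, middle_segment (\<lambda>_. 1/3) \<gamma>,
     last_segment (\<lambda>_. 1/3) \<gamma>, coarse_spoke \<gamma>, reversepath (coarse_spoke \<gamma>)})"
proof -
  have "\<Gamma> = (\<Union>t\<in>tiles S \<Gamma>. {reversepath (B (opp t) ! 4), B t ! 3, B t ! 4, B t ! 2, reversepath (B t ! 2)})"
  proof (intro equalityI subsetI)
    fix \<gamma> assume "\<gamma> \<in> \<Gamma>"
    then obtain t j where t: "t \<in> tiles S \<Gamma>" and j: "j < 5" and g: "\<gamma> = B t ! j" using side_cover by metis
    note q = across(1)[OF t j]
    have rev: "\<gamma> = reversepath (B (across t j) ! mirror j)" using across(2)[OF t j] g by simp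
    consider "j = 0" | "j = 1" | "j = 2" | "j = 3" | "j = 4" using j by linarith
    then show "\<gamma> \<in> (\<Union>t\<in>tiles S \<Gamma>. {reversepath (B (opp t) ! 4), B t ! 3, B t ! 4, B t ! 2, reversepath (B t ! 2)})"
    proof cases
      case 1
      \<comment> \<open>The double \<open>opp\<close> brings the neighbour into the form in which
        first segments are listed.\<close>
      then have "\<gamma> = reversepath (B (opp (opp (across t j))) ! 4)" using rev opp(3)[OF q] by simp
      then show ?thesis using opp(1)[OF q] by blast
    next
      case 2
      then have "\<gamma> = reversepath (B (across t j) ! 2)" using rev by simp
      then show ?thesis using q by blast
    qed (use t g in blast)+
  next
    fix \<gamma> assume "\<gamma> \<in> (\<Union>t\<in>tiles S \<Gamma>. {reversepath (B (opp t) ! 4), B t ! 3, B t ! 4, B t ! 2, reversepath (B t ! 2)})"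
    then show "\<gamma> \<in> \<Gamma>" using side opp(1) edge_reverse by auto
  qed
  from arg_cong[OF this, of "image course"] have "course ` \<Gamma> = (\<Union>t\<in>tiles S \<Gamma>. {course (reversepath (B (opp t) ! 4)), course (B t ! 3), course (B t ! 4),
      course (B t ! 2), course (reversepath (B t ! 2))})" 
    by (simp only: image_UN image_insert image_empty)
  also have "\<dots> = (\<Union>t\<in>tiles S \<Gamma>. {course (first_segment (\<lambda>_. 1/3) (coarse t)), course (middle_segment (\<lambda>_. 1/3) (coarse t)),
     course (last_segment (\<lambda>_. 1/3) (coarse t)), course (coarse_spoke (coarse t)), course (reversepath (coarse_spoke (coarse t)))})"
    by (rule SUP_cong) (simp_all add: coarse_segments coarse_spoke)
  also have "\<dots> = course ` (\<Union>\<gamma>\<in>coarse_graph. {first_segment (\<lambda>_. 1/3) \<gamma>, middle_segment (\<lambda>_. 1/3) \<gamma>,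
     last_segment (\<lambda>_. 1/3) \<gamma>, coarse_spoke \<gamma>, reversepath (coarse_spoke \<gamma>)})"
    unfolding coarse_graph_def by (simp add: image_UN)
  finally show ?thesis .
qed

text \<open>\<open>subdivision_pentagon\<close> starts at the center, which is position 2 of a walk
  that starts at a bullet. The sides 0 and 1 of \<open>t\<close> supply the first segment and the
  reversed spoke of \<open>nxt t\<close>.\<close>

lemma coarse_pentagon:
  assumes c: "c \<in> tiles S coarse_graph" and j: "j < length (coarse_walk c)"
  shows "\<exists>p\<in>tiles S \<Gamma>. p \<subseteq> c \<and> map course (rotate 2 (B p)) =
    map course (subdivision_pentagon (\<lambda>_. 1/3) coarse_spoke (coarse_walk c ! j) (coarse_walk c ! (Suc j mod length (coarse_walk c))))"
proof -
  define t where "t = fan (base c) j"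
  note b = base(1)[OF c]
  have t: "t \<in> tiles S \<Gamma>" unfolding t_def by (rule fan_tile[OF b])
  have \<gamma>: "coarse_walk c ! j = coarse t" unfolding t_def by (rule nth_coarse_walk[OF j])
  have "Suc j mod length (coarse_walk c) < length (coarse_walk c)" using j by (intro mod_less_divisor) linarith
  then have \<delta>: "coarse_walk c ! (Suc j mod length (coarse_walk c)) = coarse (nxt t)"
    using fan_mod[OF b, of "Suc j"] by (simp add: nth_coarse_walk t_def) (simp add: length_coarse_walk)
  have "rotate 2 (B t) = [B t ! 2, B t ! 3, B t ! 4, B t ! 0, B t ! 1]"
  proof -
    obtain x0 x1 x2 x3 x4 where "B t = [x0, x1, x2, x3, x4]"
      using five[OF t] by (auto simp: eval_nat_numeral length_Suc_conv)
    then show ?thesis by (simp add: eval_nat_numeral)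
  qed
  then have "map course (rotate 2 (B t)) = map course (subdivision_pentagon (\<lambda>_. 1/3) coarse_spoke (coarse t) (coarse (nxt t)))"
    using coarse_segments[OF t] coarse_segments[OF nxt(1)[OF t]] coarse_spoke[OF t] coarse_spoke[OF nxt(1)[OF t]]
      nxt(2)[OF t] nxt_first_side[OF t] by (simp add: subdivision_pentagon_def)
  moreover have "t \<subseteq> c"
  proof -
    have "pathstart (B t ! 2) = coarse_center c" unfolding t_def coarse_center_def by (rule fan_circle[OF b])
    then have "t \<subseteq> cell (coarse_center c)" unfolding cell_def using t by blast
    then show ?thesis using base(2)[OF c] by simp
  qed
  ultimately show ?thesis using t unfolding \<gamma> \<delta> by blast
qed

end

theorem theorem3p3:
  fixes S :: "'a::t2_space set"
    and \<Gamma> :: "(real \<Rightarrow> 'a) set"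
    and B :: "'a set \<Rightarrow> (real \<Rightarrow> 'a) list"
  assumes "closed_surface S"
    and "pentagonal_tiling S \<Gamma> B"
  shows "(\<exists>\<Gamma>\<^sub>0 B\<^sub>0. oriented_tiling S \<Gamma>\<^sub>0 B\<^sub>0 \<and> pentagonal_subdivision S \<Gamma>\<^sub>0 B\<^sub>0 \<Gamma> B) \<longleftrightarrow>
         (\<forall>t\<in>tiles S \<Gamma>. nondegenerate (B t)) \<and> (\<exists>Bul Cir. pattern_labelling S \<Gamma> B Bul Cir)"
proof
  have oriented: "oriented_tiling S \<Gamma> B" and five: "\<And>t. t \<in> tiles S \<Gamma> \<Longrightarrow> length (B t) = 5"
    using assms(2) unfolding pentagonal_tiling_def by blast+
  {
    assume "\<exists>\<Gamma>\<^sub>0 B\<^sub>0. oriented_tiling S \<Gamma>\<^sub>0 B\<^sub>0 \<and> pentagonal_subdivision S \<Gamma>\<^sub>0 B\<^sub>0 \<Gamma> B"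
    then obtain \<Gamma>\<^sub>0 B\<^sub>0 where T: "oriented_tiling S \<Gamma>\<^sub>0 B\<^sub>0" "pentagonal_subdivision S \<Gamma>\<^sub>0 B\<^sub>0 \<Gamma> B" by blast
    from T(2) obtain a c spoke where data: "subdivision_data S \<Gamma>\<^sub>0 B\<^sub>0 a c spoke"
      and courses: "course ` \<Gamma> = course ` (\<Union>\<gamma>\<in>\<Gamma>\<^sub>0. {first_segment a \<gamma>, middle_segment a \<gamma>, last_segment a \<gamma>,
                                      spoke \<gamma>, reversepath (spoke \<gamma>)})"
      and pent: "\<forall>t\<in>tiles S \<Gamma>\<^sub>0. \<forall>j<length (B\<^sub>0 t). \<exists>p\<in>tiles S \<Gamma>. p \<subseteq> t \<and> (\<exists>k.
        map course (rotate k (B p)) =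
        map course (subdivision_pentagon a spoke (B\<^sub>0 t ! j) (B\<^sub>0 t ! (Suc j mod length (B\<^sub>0 t)))))"
      unfolding pentagonal_subdivision_def by (elim exE conjE) (rule that)
    interpret T: subdivided_tiling S \<Gamma>\<^sub>0 B\<^sub>0 a c spoke by unfold_locales (rule T(1), rule data)
    interpret pentagonally_subdivided S \<Gamma>\<^sub>0 B\<^sub>0 a c spoke \<Gamma> B
    proof unfold_locales
      show "course ` \<Gamma> = course ` T.segments" unfolding T.segments_def by (rule courses)
      show "\<exists>p\<in>tiles S \<Gamma>. \<exists>k. map course (rotate k (B p)) =
        map course (subdivision_pentagon a spoke (B\<^sub>0 t ! j) (B\<^sub>0 t ! (Suc j mod length (B\<^sub>0 t))))"
        if "t \<in> tiles S \<Gamma>\<^sub>0" "j < length (B\<^sub>0 t)" for t j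
        using pent that by blast
    qed (rule oriented, rule assms(1))
    show "(\<forall>t\<in>tiles S \<Gamma>. nondegenerate (B t)) \<and> (\<exists>Bul Cir. pattern_labelling S \<Gamma> B Bul Cir)"
      using tiles_nondegenerate pattern by blast
  next
    assume "(\<forall>t\<in>tiles S \<Gamma>. nondegenerate (B t)) \<and> (\<exists>Bul Cir. pattern_labelling S \<Gamma> B Bul Cir)"
    then obtain Bul Cir where nondeg: "\<forall>t\<in>tiles S \<Gamma>. nondegenerate (B t)" and pattern: "pattern_labelling S \<Gamma> B Bul Cir"
      by blast
    interpret O: oriented_tiled S \<Gamma> B by unfold_locales (rule oriented)
    have "\<forall>t\<in>tiles S \<Gamma>. \<exists>k v0 v1 v2 v3 v4.
        map pathstart (rotate k (B t)) = [v0, v1, v2, v3, v4] \<and> v0 \<in> Bul \<and> v2 \<in> Cir \<and>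
        (\<forall>v\<in>{v1, v3, v4}. v \<notin> Bul \<and> v \<notin> Cir \<and> vertex_degree \<Gamma> v = 3)"
      using pattern unfolding pattern_labelling_def by blast
    then obtain k where k: "\<forall>t\<in>tiles S \<Gamma>. \<exists>v0 v1 v2 v3 v4.
        map pathstart (rotate (k t) (B t)) = [v0, v1, v2, v3, v4] \<and> v0 \<in> Bul \<and> v2 \<in> Cir \<and>
        (\<forall>v\<in>{v1, v3, v4}. v \<notin> Bul \<and> v \<notin> Cir \<and> vertex_degree \<Gamma> v = 3)"
      by (rule bchoice[THEN exE])
    \<comment> \<open>The position of the bullet in the given walk depends on the tile, so each walk
      is restarted there.\<close>
    define B' where "B' t = rotate (k t) (B t)" for t
    interpret O': oriented_tiled S \<Gamma> B'
      unfolding B'_def by unfold_locales (rule O.oriented_tiling_rotate)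
    have labels: "pathstart (B' t ! 0) \<in> Bul" "pathstart (B' t ! 2) \<in> Cir"
      "\<And>j. j \<in> {1, 3, 4} \<Longrightarrow> pathstart (B' t ! j) \<notin> Bul \<and> pathstart (B' t ! j) \<notin> Cir \<and> vertex_degree \<Gamma> (pathstart (B' t ! j)) = 3"
      if t: "t \<in> tiles S \<Gamma>" for t
    proof -
      obtain v0 v1 v2 v3 v4 where v: "map pathstart (B' t) = [v0, v1, v2, v3, v4]" "v0 \<in> Bul" "v2 \<in> Cir"
        "\<forall>v\<in>{v1, v3, v4}. v \<notin> Bul \<and> v \<notin> Cir \<and> vertex_degree \<Gamma> v = 3"
        using bspec[OF k t, folded B'_def] by (elim exE conjE) (rule that)
      have len: "length (B' t) = 5" using five[OF t] by (simp add: B'_def)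
      have nth: "pathstart (B' t ! j) = [v0, v1, v2, v3, v4] ! j" if "j < 5" for j
        using nth_map[of j "B' t" pathstart] that len unfolding v(1) by simp
      show "pathstart (B' t ! 0) \<in> Bul" "pathstart (B' t ! 2) \<in> Cir"
        using nth[of 0] nth[of 2] v by simp_all
      fix j :: nat assume "j \<in> {1, 3, 4}"
      then have "j < 5" "[v0, v1, v2, v3, v4] ! j \<in> {v1, v3, v4}" by auto
      then show "pathstart (B' t ! j) \<notin> Bul \<and> pathstart (B' t ! j) \<notin> Cir \<and> vertex_degree \<Gamma> (pathstart (B' t ! j)) = 3"
        unfolding nth[OF \<open>j < 5\<close>] using v(4) by blast
    qed
    interpret pentagon_pattern S \<Gamma> B' Bul Cir
    proof unfold_locales
      show "length (B' t) = 5" if "t \<in> tiles S \<Gamma>" for t using five[OF that] by (simp add: B'_def)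
      show "nondegenerate (B' t)" if t: "t \<in> tiles S \<Gamma>" for t
      proof -
        have "distinct (map pathstart (B t))" using O.nondegenerate_iff[OF t] nondeg t by blast
        then have "distinct (map pathstart (B' t))" by (simp add: B'_def flip: rotate_map)
        then show ?thesis using O'.nondegenerate_iff[OF t] by blast
      qed
      show "Bul \<inter> Cir = {}" using pattern unfolding pattern_labelling_def by blast
    qed (use assms(1) labels in auto)
    have "pentagonal_subdivision S coarse_graph coarse_walk \<Gamma> B"
      unfolding pentagonal_subdivision_def
    proof (intro exI conjI ballI allI impI)
      show "subdivision_data S coarse_graph coarse_walk (\<lambda>_. 1/3) coarse_center coarse_spoke"
        by (rule coarse_subdivision_data)
      fix c j assume "c \<in> tiles S coarse_graph" "j < length (coarse_walk c)"
      then obtain p where p: "p \<in> tiles S \<Gamma>" "p \<subseteq> c" "map course (rotate 2 (B' p)) =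
          map course (subdivision_pentagon (\<lambda>_. 1/3) coarse_spoke (coarse_walk c ! j) (coarse_walk c ! (Suc j mod length (coarse_walk c))))"
        using coarse_pentagon by blast
      show "\<exists>p\<in>tiles S \<Gamma>. p \<subseteq> c \<and> (\<exists>k. map course (rotate k (B p)) =
          map course (subdivision_pentagon (\<lambda>_. 1/3) coarse_spoke (coarse_walk c ! j) (coarse_walk c ! (Suc j mod length (coarse_walk c)))))"
        \<comment> \<open>The normalising rotation is absorbed into the rotation that
          \<open>pentagonal_subdivision\<close> permits.\<close>
        using p unfolding B'_def rotate_rotate by blast
    qed (rule coarse_courses)
    then show "\<exists>\<Gamma>\<^sub>0 B\<^sub>0. oriented_tiling S \<Gamma>\<^sub>0 B\<^sub>0 \<and> pentagonal_subdivision S \<Gamma>\<^sub>0 B\<^sub>0 \<Gamma> B"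
      using oriented_coarse by blast
  }
qed

end
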